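(* Let $(M,g)$ be a compact, connected Riemannian manifold of dimension $m$, let $V\subset C^\infty(M)$ be a vector subspace of finite dimension $N$, and let $h$ be a Euclidean inner product on $V$ with norm $|\cdot|_h$. Assume that for every $x\in M$ the linear map $V\to T_x^*M$, $v\mapsto d_xv$, is surjective. For a function $v\in V$ let $\#\{dv=0\}$ denote the number of its critical points. Then $$\frac{1}{\mathrm{area}(S(V))}\int_{S(V)}\#\{dv=0\}\,|dS_h(v)|=\frac{1}{\sigma_{N-1}}\int_M\frac{\Delta_x(V,g)}{J(\mathcal A_x^\dagger,g,h)}\,|dV_g(x)|,$$ where $S(V)=\{v\in V: |v|_h=1\}$, $|dS_h|$ is the area density on $S(V)$, and $|dV_g|$ is the volume density of $g$.
   Context: $\sigma_{N-1}$ is the area of the unit sphere $S^{N-1}\subset\mathbb R^N$. For $x\in M$ let $K_x=\{v\in V: d_xv=0\}$, and let $S(K_x)$ be the unit sphere of $K_x$ with respect to $h$, with its area density $|dS(v)|$. For $v\in K_x$ the Hessian of $v$ at $x$ is a well-defined symmetric bilinear form on $T_xM$; via $g$ it is identified with a symmetric linear operator $\mathrm{Hess}_x(v,g):T_xM\to T_xM$. Define $$\Delta_x(V,g)=\int_{S(K_x)}|\det \mathrm{Hess}_x(v,g)|\,|dS(v)|.$$ The map $\mathcal A_x^\dagger:T_xM\to V$ is defined by $h(\mathcal A_x^\dagger X,v)=d_xv(X)$ for all $X\in T_xM$, $v\in V$. Its Jacobian is $J(\mathcal A_x^\dagger,g,h)=\big(\det\big[h(\mathcal A_x^\dagger e_i,\mathcal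 A_x^\dagger e_j)\big]_{1\le i,j\le m}\big)^{1/2}$ for any $g$-orthonormal basis $e_1,\dots,e_m$ of $T_xM$. Under the surjectivity assumption almost every $v\in V$ is a Morse function and so has finitely many critical points. *)

theory Defs
  imports "HOL-Analysis.Analysis" "HOL-Library.Function_Algebras"
begin

section \<open>Real-valued functions as a vector space\<close>

text \<open>Function spaces carry the pointwise operations.  This is used both for spaces of functions
  on the manifold and for spaces of tangent vectors, which are functionals on functions.\<close>

instantiation "fun" :: (type, real_vector) real_vector
begin

definition scaleR_fun_def: "scaleR c f = (\<lambda>x. c *\<^sub>R f x)"

instance
  by standard (simp_all add: scaleR_fun_def fun_eq_iff scaleR_add_left scaleR_add_right)

end


section \<open>Smooth maps between open subsets of normed spaces\<close>

text \<open>Only meaningful for open \<open>S\<close>.\<close>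

fun Ck_on :: "nat \<Rightarrow> 'a::real_normed_vector set \<Rightarrow> ('a \<Rightarrow> 'b::real_normed_vector) \<Rightarrow> bool" where
  "Ck_on 0 S f \<longleftrightarrow> continuous_on S f"
| "Ck_on (Suc k) S f \<longleftrightarrow>
     (\<forall>x\<in>S. f differentiable (at x)) \<and> (\<forall>w. Ck_on k S (\<lambda>x. frechet_derivative f (at x) w))"

definition smooth_on :: "'a::real_normed_vector set \<Rightarrow> ('a \<Rightarrow> 'b::real_normed_vector) \<Rightarrow> bool" where
  "smooth_on S f \<longleftrightarrow> (\<forall>k. Ck_on k S f)"


section \<open>Smooth manifolds and tangent spaces\<close>

text \<open>A manifold is a whole topological type \<open>'a\<close> equipped with a smooth (not necessarily maximal)
  atlas modelled on \<open>real ^ 'm\<close>; its dimension is \<open>CARD('m)\<close>.  A chart is given by its domain and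
  its coordinate map, whose values outside the domain are irrelevant.\<close>

type_synonym ('a, 'm) chart = "'a set \<times> ('a \<Rightarrow> real ^ 'm)"

definition smooth_atlas :: "('a::topological_space, 'm::finite) chart set \<Rightarrow> bool" where
  "smooth_atlas \<A> \<longleftrightarrow>
     (\<Union>(U, \<phi>)\<in>\<A>. U) = UNIV \<and>
     (\<forall>(U, \<phi>)\<in>\<A>. open U \<and> open (\<phi> ` U) \<and> homeomorphism U (\<phi> ` U) \<phi> (inv_into U \<phi>)) \<and>
     (\<forall>(U, \<phi>)\<in>\<A>. \<forall>(U', \<psi>)\<in>\<A>. smooth_on (\<phi> ` (U \<inter> U')) (\<psi> \<circ> inv_into U \<phi>))"

text \<open>Smoothness of a function on an open subset \<open>W\<close> of the manifold, \<open>C\<^sup>\<infinity>(M)\<close>, and smoothness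
  in some neighbourhood of a point.\<close>

definition smooth_fun_on ::
    "('a::topological_space, 'm::finite) chart set \<Rightarrow> 'a set \<Rightarrow> ('a \<Rightarrow> real) \<Rightarrow> bool" where
  "smooth_fun_on \<A> W f \<longleftrightarrow> (\<forall>(U, \<phi>)\<in>\<A>. smooth_on (\<phi> ` (U \<inter> W)) (f \<circ> inv_into U \<phi>))"

definition C_infinity :: "('a::topological_space, 'm::finite) chart set \<Rightarrow> ('a \<Rightarrow> real) set" where
  "C_infinity \<A> = {f. smooth_fun_on \<A> UNIV f}"

definition smooth_near ::
    "('a::topological_space, 'm::finite) chart set \<Rightarrow> 'a \<Rightarrow> ('a \<Rightarrow> real) \<Rightarrow> bool" where
  "smooth_near \<A> x f \<longleftrightarrow> (\<exists>W. open W \<and> x \<in> W \<and> smooth_fun_on \<A> W f)"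

text \<open>Tangent vectors at \<open>x\<close> are the directional derivatives at \<open>x\<close>, acting on functions that are
  smooth near \<open>x\<close>.  They are set to 0 on all other functions, so that equality of tangent vectors
  is equality of functionals.  \<open>coord_vector \<A> c x w\<close> is the tangent vector
  \<open>\<Sum>i. w $ i * \<partial>/\<partial>x\<^sub>i\<close> in the chart \<open>c\<close>.\<close>

type_synonym 'a tangent = "('a \<Rightarrow> real) \<Rightarrow> real"

definition coord_vector ::
    "('a::topological_space, 'm::finite) chart set \<Rightarrow> ('a, 'm) chart \<Rightarrow> 'a \<Rightarrow> real ^ 'm \<Rightarrow> 'a tangent"
  where
  "coord_vector \<A> c x w = (case c of (U, \<phi>) \<Rightarrow>
     (\<lambda>f. if smooth_near \<A> x f then frechet_derivative (f \<circ> inv_into U \<phi>) (at (\<phi> x)) w else 0))"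

definition tangent_space :: "('a::topological_space, 'm::finite) chart set \<Rightarrow> 'a \<Rightarrow> 'a tangent set"
  where
  "tangent_space \<A> x = {coord_vector \<A> c x w | c w. c \<in> \<A> \<and> x \<in> fst c}"

text \<open>The differential \<open>d\<^sub>xv\<close> as a function of tangent vectors \<open>X\<close> at \<open>x\<close>; the base point is carried
  by \<open>X\<close>.\<close>

definition differential :: "('a \<Rightarrow> real) \<Rightarrow> 'a tangent \<Rightarrow> real" where
  "differential v X = X v"

definition critical_points ::
    "('a::topological_space, 'm::finite) chart set \<Rightarrow> ('a \<Rightarrow> real) \<Rightarrow> 'a set" where
  "critical_points \<A> v = {x. \<forall>X\<in>tangent_space \<A> x. differential v X = 0}"


section \<open>Inner products and spheres in finite-dimensional subspaces\<close>

definition inner_product_on :: "'v::real_vector set \<Rightarrow> ('v \<Rightarrow> 'v \<Rightarrow> real) \<Rightarrow> bool" where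
  "inner_product_on W h \<longleftrightarrow>
     (\<forall>x\<in>W. \<forall>y\<in>W. \<forall>z\<in>W. h (x + y) z = h x z + h y z) \<and>
     (\<forall>c. \<forall>x\<in>W. \<forall>y\<in>W. h (c *\<^sub>R x) y = c * h x y) \<and>
     (\<forall>x\<in>W. \<forall>y\<in>W. h x y = h y x) \<and>
     (\<forall>x\<in>W. x \<noteq> 0 \<longrightarrow> 0 < h x x)"

definition orthonormal_basis ::
    "('v::real_vector \<Rightarrow> 'v \<Rightarrow> real) \<Rightarrow> 'v set \<Rightarrow> 'v set \<Rightarrow> bool" where
  "orthonormal_basis h W B \<longleftrightarrow>
     finite B \<and> span B = W \<and> (\<forall>b\<in>B. \<forall>c\<in>B. h b c = (if b = c then 1 else 0))"

text \<open>Lebesgue measure of the Euclidean space \<open>(W, h)\<close>: product Lebesgue measure in the coordinates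
  of an orthonormal basis, the choice of which does not matter.\<close>

definition lebesgue_of :: "('v::real_vector \<Rightarrow> 'v \<Rightarrow> real) \<Rightarrow> 'v set \<Rightarrow> 'v measure" where
  "lebesgue_of h W =
     (let B = (SOME B. orthonormal_basis h W B)
      in embed_measure (\<Pi>\<^sub>M b\<in>B. lborel) (\<lambda>c. \<Sum>b\<in>B. c b *\<^sub>R b))"

definition unit_sphere :: "('v::real_vector \<Rightarrow> 'v \<Rightarrow> real) \<Rightarrow> 'v set \<Rightarrow> 'v set" where
  "unit_sphere h W = {w \<in> W. sqrt (h w w) = 1}"

text \<open>The area measure of the unit sphere of \<open>(W, h)\<close>.  As usual the area of \<open>A\<close> is \<open>dim W\<close> times
  the Lebesgue measure of the cone \<open>{t *\<^sub>R a | 0 < t \<le> 1, a \<in> A}\<close>.  If \<open>dim W = 1\<close> this is counting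
  measure on the two unit vectors; if \<open>W = {0}\<close> the sphere is empty.\<close>

definition sphere_area :: "('v::real_vector \<Rightarrow> 'v \<Rightarrow> real) \<Rightarrow> 'v set \<Rightarrow> 'v measure" where
  "sphere_area h W =
     scale_measure (of_nat (dim W))
       (distr (restrict_space (lebesgue_of h W) {w \<in> W. 0 < sqrt (h w w) \<and> sqrt (h w w) \<le> 1})
              (restrict_space (lebesgue_of h W) (unit_sphere h W))
              (\<lambda>w. w /\<^sub>R sqrt (h w w)))"


section \<open>Riemannian metrics and the volume density\<close>

definition riemannian_metric ::
    "('a::topological_space, 'm::finite) chart set \<Rightarrow> ('a \<Rightarrow> 'a tangent \<Rightarrow> 'a tangent \<Rightarrow> real) \<Rightarrow> bool"
  where
  "riemannian_metric \<A> g \<longleftrightarrow>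
     (\<forall>x. inner_product_on (tangent_space \<A> x) (g x)) \<and>
     (\<forall>c\<in>\<A>. \<forall>i j. smooth_fun_on \<A> (fst c)
        (\<lambda>x. g x (coord_vector \<A> c x (axis i 1)) (coord_vector \<A> c x (axis j 1))))"

definition metric_det ::
    "('a::topological_space, 'm::finite) chart set \<Rightarrow> ('a \<Rightarrow> 'a tangent \<Rightarrow> 'a tangent \<Rightarrow> real)
     \<Rightarrow> ('a, 'm) chart \<Rightarrow> 'a \<Rightarrow> real" where
  "metric_det \<A> g c x =
     det (\<chi> i j. g x (coord_vector \<A> c x (axis i 1)) (coord_vector \<A> c x (axis j 1)))"

text \<open>\<open>|dV\<^sub>g|\<close> is the Borel measure given by \<open>sqrt (det (g\<^sub>i\<^sub>j)) dx\<^sub>1 \<dots> dx\<^sub>m\<close> in every chart.\<close>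

definition volume_measure ::
    "('a::topological_space, 'm::finite) chart set \<Rightarrow> ('a \<Rightarrow> 'a tangent \<Rightarrow> 'a tangent \<Rightarrow> real)
     \<Rightarrow> 'a measure" where
  "volume_measure \<A> g = (THE \<mu>. sets \<mu> = sets borel \<and>
     (\<forall>(U, \<phi>)\<in>\<A>. \<forall>B\<in>sets borel. B \<subseteq> U \<longrightarrow>
        emeasure \<mu> B =
          (\<integral>\<^sup>+u\<in>\<phi> ` B. ennreal (sqrt (metric_det \<A> g (U, \<phi>) (inv_into U \<phi> u))) \<partial>lborel)))"

definition orthonormal_frame ::
    "('a::topological_space, 'm::finite) chart set \<Rightarrow> ('a \<Rightarrow> 'a tangent \<Rightarrow> 'a tangent \<Rightarrow> real)
     \<Rightarrow> 'a \<Rightarrow> ('m \<Rightarrow> 'a tangent) \<Rightarrow> bool" where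
  "orthonormal_frame \<A> g x e \<longleftrightarrow>
     inj e \<and> orthonormal_basis (g x) (tangent_space \<A> x) (range e)"

text \<open>A choice of orthonormal frame; what is computed from it below does not depend on it.\<close>

definition some_frame ::
    "('a::topological_space, 'm::finite) chart set \<Rightarrow> ('a \<Rightarrow> 'a tangent \<Rightarrow> 'a tangent \<Rightarrow> real)
     \<Rightarrow> 'a \<Rightarrow> 'm \<Rightarrow> 'a tangent" where
  "some_frame \<A> g x = (SOME e. orthonormal_frame \<A> g x e)"


section \<open>The Hessian and \<open>\<Delta>\<^sub>x(V, g)\<close>\<close>

definition kernel_at ::
    "('a::topological_space, 'm::finite) chart set \<Rightarrow> ('a \<Rightarrow> real) set \<Rightarrow> 'a \<Rightarrow> ('a \<Rightarrow> real) set" where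
  "kernel_at \<A> V x = {v \<in> V. \<forall>X\<in>tangent_space \<A> x. differential v X = 0}"

text \<open>\<open>Hess\<^sub>x v (X, Y) = X (Y' v)\<close>, where \<open>Y'\<close> extends \<open>Y\<close> to a vector field with constant
  coefficients in a chart around \<open>x\<close>; in coordinates this is \<open>\<Sum>i j. \<partial>\<^sub>i \<partial>\<^sub>j v * X\<^sub>i * Y\<^sub>j\<close>.  At a critical
  point \<open>x\<close> of \<open>v\<close> the value is the same for all charts.\<close>

definition hessian ::
    "('a::topological_space, 'm::finite) chart set \<Rightarrow> 'a \<Rightarrow> ('a \<Rightarrow> real) \<Rightarrow> 'a tangent \<Rightarrow> 'a tangent
     \<Rightarrow> real" where
  "hessian \<A> x v X Y = (THE r. \<forall>c\<in>\<A>. x \<in> fst c \<longrightarrow>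
     (\<forall>w. coord_vector \<A> c x w = Y \<longrightarrow> X (\<lambda>y. coord_vector \<A> c y w v) = r))"

definition hessian_operator ::
    "('a::topological_space, 'm::finite) chart set \<Rightarrow> ('a \<Rightarrow> 'a tangent \<Rightarrow> 'a tangent \<Rightarrow> real)
     \<Rightarrow> 'a \<Rightarrow> ('a \<Rightarrow> real) \<Rightarrow> 'a tangent \<Rightarrow> 'a tangent" where
  "hessian_operator \<A> g x v X = (THE Z. Z \<in> tangent_space \<A> x \<and>
     (\<forall>Y\<in>tangent_space \<A> x. g x Z Y = hessian \<A> x v X Y))"

text \<open>Determinant of an endomorphism \<open>L\<close> of the space with basis \<open>e\<close>, through the matrix of \<open>L\<close>.\<close>

definition endo_det :: "('m::finite \<Rightarrow> 'v::real_vector) \<Rightarrow> ('v \<Rightarrow> 'v) \<Rightarrow> real" where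
  "endo_det e L = det (\<chi> i j. representation (range e) (L (e j)) (e i))"

definition Delta ::
    "('a::topological_space, 'm::finite) chart set \<Rightarrow> ('a \<Rightarrow> 'a tangent \<Rightarrow> 'a tangent \<Rightarrow> real)
     \<Rightarrow> ('a \<Rightarrow> real) set \<Rightarrow> (('a \<Rightarrow> real) \<Rightarrow> ('a \<Rightarrow> real) \<Rightarrow> real) \<Rightarrow> 'a \<Rightarrow> real" where
  "Delta \<A> g V h x =
     (LINT v|sphere_area h (kernel_at \<A> V x).
        \<bar>endo_det (some_frame \<A> g x) (hessian_operator \<A> g x v)\<bar>)"


section \<open>The map \<open>A\<^sub>x\<^sup>\<dagger>\<close> and its Jacobian\<close>

definition adjoint_evaluation ::
    "('a \<Rightarrow> real) set \<Rightarrow> (('a \<Rightarrow> real) \<Rightarrow> ('a \<Rightarrow> real) \<Rightarrow> real) \<Rightarrow> 'a tangent \<Rightarrow> ('a \<Rightarrow> real)" where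
  "adjoint_evaluation V h X = (THE u. u \<in> V \<and> (\<forall>v\<in>V. h u v = differential v X))"

definition adjoint_jacobian ::
    "('a::topological_space, 'm::finite) chart set \<Rightarrow> ('a \<Rightarrow> 'a tangent \<Rightarrow> 'a tangent \<Rightarrow> real)
     \<Rightarrow> ('a \<Rightarrow> real) set \<Rightarrow> (('a \<Rightarrow> real) \<Rightarrow> ('a \<Rightarrow> real) \<Rightarrow> real) \<Rightarrow> 'a \<Rightarrow> real" where
  "adjoint_jacobian \<A> g V h x =
     sqrt (det (\<chi> i j. h (adjoint_evaluation V h (some_frame \<A> g x i))
                         (adjoint_evaluation V h (some_frame \<A> g x j))))"

end

theory Submission
  imports Defs
begin

text \<open>
  Fix an \<open>h\<close>-orthonormal basis \<open>b\<^sub>1, \<dots>, b\<^sub>n\<close> of \<open>V\<close> and identify \<open>V\<close> with Euclidean space.  In a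
  chart the gradient of \<open>v\<close> at \<open>x\<close> is \<open>A(x) v\<close> with an \<open>m\<close> by \<open>n\<close> matrix \<open>A(x)\<close> that depends smoothly
  on \<open>x\<close> and, by ampleness, has full rank.  Critical points of \<open>v\<close> are the zeros of \<open>A(x) v\<close>, the
  space \<open>K\<^sub>x\<close> is the kernel of \<open>A(x)\<close>, and the derivative of \<open>A(x) v\<close> in \<open>x\<close> is the Hessian.  The
  formula is therefore an instance of the Kac-Rice formula \<open>kac_rice\<close>: the integral over all \<open>v\<close> of
  \<open>\<chi>(v) #{x \<in> B. A(x) v = 0}\<close> equals the integral over \<open>x \<in> B\<close> of \<open>1 / \<surd>(det A(x) A(x)\<^sup>T)\<close> times the
  integral over \<open>w \<in> ker A(x)\<close> of \<open>\<chi>(w) |det D\<^sub>x(A(x) w)|\<close>.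

  The Kac-Rice formula rests on one observation.  Near a given point there is a fixed matrix \<open>\<xi>\<close> with
  \<open>A(x) \<xi>\<close> invertible, and after multiplying \<open>A(x)\<close> by the inverse, \<open>A(x) \<xi> = 1\<close>.  Replacing \<open>v\<close> by
  \<open>v - \<xi> p\<close> then changes \<open>A(x) v\<close> into \<open>A(x) v - p\<close> for all \<open>x\<close> simultaneously.  Averaging the left
  side over such translations turns the number of zeros into the number of solutions of
  \<open>A(x) v = p\<close>, which for fixed \<open>v\<close> is integrated over \<open>p\<close> by the area formula for a map between
  spaces of dimension \<open>m\<close> (\<open>area_formula\<close>: Sard's theorem, the inverse function theorem and change of
  variables).  After exchanging the integrals over \<open>x\<close> and \<open>v\<close>, the integral over \<open>v\<close> splits into one
  over \<open>ker A(x)\<close> and one over its complement, and the latter produces the factor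
  \<open>1 / \<surd>(det A A\<^sup>T)\<close> (\<open>nn_integral_transversal_kernel\<close>).

  To pass from unit balls to unit spheres, \<open>\<chi>\<close> is the indicator function of the punctured unit ball.
  The number of critical points is invariant under scaling and \<open>|det Hess|\<close> is homogeneous of degree
  \<open>m\<close>, so both sides become integrals over spheres, with the same factor \<open>n = (n - m) + m\<close>
  (\<open>nn_integral_homogeneous_ball\<close>).  Finally, the metric \<open>g\<close> enters \<open>\<Delta>\<^sub>x\<close>, the Jacobian of
  \<open>A\<^sub>x\<^sup>\<dagger>\<close> and the volume density only through powers of the determinant of an orthonormal frame, and
  these cancel (\<open>Delta_over_Jacobian\<close>).  Summing over a finite partition of \<open>M\<close> into pieces of charts
  gives the theorem.
\<close>

section \<open>Transport to well-ordered index types\<close>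

text \<open>Lebesgue measure, derivatives and determinants do not depend on an order of the coordinates.  The
change of variables theorem and Sard's theorem for well-ordered index types therefore hold for all
finite index types: a copy of the index type is well-ordered by an arbitrary enumeration, and the
coordinates are relabelled.\<close>

datatype 'i ordered_copy = Copy (orig: 'i)

lemma bij_Copy: "bij Copy"
  by (rule o_bij[where g = orig]) (auto simp: fun_eq_iff)

lemma bij_orig: "bij orig"
  by (rule o_bij[where g = Copy]) (auto simp: fun_eq_iff)

instance ordered_copy :: (finite) finite
proof
  have "finite (range Copy :: 'a::finite ordered_copy set)"
    by simp
  then show "finite (UNIV :: 'a::finite ordered_copy set)"
    by (simp only: bij_is_surj[OF bij_Copy])
qed

instantiation ordered_copy :: (finite) wellorder
begin

definition rank_of :: "'a ordered_copy \<Rightarrow> nat" where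
  "rank_of = (SOME f. inj_on f UNIV)"

definition less_eq_ordered_copy :: "'a ordered_copy \<Rightarrow> 'a ordered_copy \<Rightarrow> bool" where
  "x \<le> y \<longleftrightarrow> rank_of x \<le> rank_of y"

definition less_ordered_copy :: "'a ordered_copy \<Rightarrow> 'a ordered_copy \<Rightarrow> bool" where
  "x < y \<longleftrightarrow> rank_of x < rank_of y"

lemma inj_rank_of: "inj (rank_of :: 'a ordered_copy \<Rightarrow> nat)"
proof -
  obtain f :: "'a ordered_copy \<Rightarrow> nat" and n where f: "inj_on f UNIV"
    using finite_imp_inj_to_nat_seg[of "UNIV :: 'a ordered_copy set"] by auto
  show ?thesis
    unfolding rank_of_def by (rule someI[where P = "\<lambda>f. inj_on f UNIV", OF f])
qed

instance
proof
  fix x y :: "'a ordered_copy"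
  show "x \<le> y \<Longrightarrow> y \<le> x \<Longrightarrow> x = y"
    using inj_rank_of by (auto simp: less_eq_ordered_copy_def inj_def)
next
  fix P and a :: "'a ordered_copy"
  assume step: "\<And>x::'a ordered_copy. (\<And>y. y < x \<Longrightarrow> P y) \<Longrightarrow> P x"
  show "P a"
  proof (induction "rank_of a" arbitrary: a rule: less_induct)
    case less
    show ?case
      by (rule step) (rule less, simp add: less_ordered_copy_def)
  qed
qed (auto simp: less_eq_ordered_copy_def less_ordered_copy_def)

end

definition copy_vec :: "real ^ 'i \<Rightarrow> real ^ 'i::finite ordered_copy" where
  "copy_vec x = (\<chi> i. x $ orig i)"

definition orig_vec :: "real ^ 'i::finite ordered_copy \<Rightarrow> real ^ 'i" where
  "orig_vec y = (\<chi> i. y $ Copy i)"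

lemma orig_copy_vec [simp]: "orig_vec (copy_vec x) = x"
  by (simp add: copy_vec_def orig_vec_def vec_eq_iff)

lemma copy_orig_vec [simp]: "copy_vec (orig_vec y) = y"
  by (simp add: copy_vec_def orig_vec_def vec_eq_iff)

lemma linear_copy_vec: "linear copy_vec"
  by (auto simp: copy_vec_def vec_eq_iff intro!: linearI)

lemma linear_orig_vec: "linear orig_vec"
  by (auto simp: orig_vec_def vec_eq_iff intro!: linearI)

lemma bounded_linear_copy_vec: "bounded_linear copy_vec"
  by (simp add: linear_copy_vec linear_conv_bounded_linear[symmetric])

lemma bounded_linear_orig_vec: "bounded_linear orig_vec"
  by (simp add: linear_orig_vec linear_conv_bounded_linear[symmetric])

lemma borel_measurable_copy_vec [measurable]: "copy_vec \<in> borel_measurable borel"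
  by (intro borel_measurable_continuous_onI linear_continuous_on bounded_linear_copy_vec)

lemma borel_measurable_orig_vec [measurable]: "orig_vec \<in> borel_measurable borel"
  by (intro borel_measurable_continuous_onI linear_continuous_on bounded_linear_orig_vec)

lemma prod_Copy: "(\<Prod>i\<in>UNIV. f (Copy i)) = (\<Prod>i\<in>UNIV. f i)"
  by (rule prod.reindex_bij_betw) (use bij_Copy in auto)

lemma prod_Basis_vec: "(\<Prod>b\<in>Basis. f ((x::real^'i) \<bullet> b)) = (\<Prod>i\<in>UNIV. f (x $ i))"
proof -
  have "(\<Prod>b\<in>Basis. f (x \<bullet> b)) = (\<Prod>b\<in>(\<lambda>i. axis i 1 :: real^'i) ` UNIV. f (x \<bullet> b))"
    by (rule prod.cong) (auto simp: Basis_vec_def)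
  also have "\<dots> = (\<Prod>i\<in>UNIV. f (x \<bullet> axis i 1))"
    by (subst prod.reindex) (auto simp: inj_on_def axis_eq_axis)
  finally show ?thesis by (simp add: inner_axis)
qed

lemma lborel_orig_vec: "distr lborel borel orig_vec = (lborel :: (real^'i::finite) measure)"
proof (rule lborel_eqI[symmetric])
  fix l u :: "real^'i"
  assume le: "\<And>b. b \<in> Basis \<Longrightarrow> l \<bullet> b \<le> u \<bullet> b"
  have vimage: "orig_vec -` box l u = box (copy_vec l) (copy_vec u)"
  proof -
    have "(\<forall>i. l $ i < y $ Copy i \<and> y $ Copy i < u $ i) \<longleftrightarrow>
          (\<forall>i. l $ orig i < y $ i \<and> y $ i < u $ orig i)" for y :: "real ^ 'i ordered_copy"
      by (intro iffI allI) (auto dest: spec[where x = "orig _"] spec[where x = "Copy _"])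
    then show ?thesis
      by (auto simp: mem_box_cart orig_vec_def copy_vec_def)
  qed
  have le': "\<And>b. b \<in> Basis \<Longrightarrow> copy_vec l \<bullet> b \<le> copy_vec u \<bullet> b"
  proof -
    fix b :: "real ^ 'i ordered_copy" assume "b \<in> Basis"
    then obtain i where b: "b = axis i 1" by (auto simp: Basis_vec_def)
    have "l \<bullet> axis (orig i) 1 \<le> u \<bullet> axis (orig i) 1"
      by (rule le) (auto simp: Basis_vec_def)
    then show "copy_vec l \<bullet> b \<le> copy_vec u \<bullet> b"
      by (simp add: b inner_axis copy_vec_def)
  qed
  have "emeasure (distr lborel borel orig_vec) (box l u) = emeasure lborel (orig_vec -` box l u)"
    by (subst emeasure_distr) auto
  also have "\<dots> = (\<Prod>b\<in>Basis. (copy_vec u - copy_vec l) \<bullet> b)"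
    unfolding vimage by (rule emeasure_lborel_box) (rule le')
  also have "(\<Prod>b\<in>Basis. (copy_vec u - copy_vec l) \<bullet> b) = (\<Prod>i\<in>UNIV. (copy_vec u - copy_vec l) $ i)"
    by (rule prod_Basis_vec[of "\<lambda>x. x"])
  also have "\<dots> = (\<Prod>i\<in>UNIV. (u - l) $ i)"
    by (subst prod_Copy[symmetric]) (simp add: copy_vec_def)
  also have "\<dots> = (\<Prod>b\<in>Basis. (u - l) \<bullet> b)"
    by (rule prod_Basis_vec[of "\<lambda>x. x", symmetric])
  finally show "emeasure (distr lborel borel orig_vec) (box l u) = (\<Prod>b\<in>Basis. (u - l) \<bullet> b)"
    by simp
qed simp

text \<open>Conjugation by \<open>f\<close> is a sign-preserving bijection between the permutations of the two index types.\<close>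

lemma det_reindex:
  fixes A :: "'c::comm_ring_1 ^ 'b::finite ^ 'b" and f :: "'a::finite \<Rightarrow> 'b"
  assumes "bij f"
  shows "det (\<chi> i j. A $ f i $ f j) = det A"
proof -
  let ?c = "map_permutation UNIV f"
  have inj: "inj f" and f: "bij_betw f UNIV UNIV"
    using assms by (auto simp: bij_def)
  have c: "?c p (f i) = f (p i)" for p i
    using map_permutation_apply[OF inj] by simp
  have bij: "bij_betw ?c {p. p permutes UNIV} {p. p permutes UNIV}"
  proof (rule bij_betwI[where g = "map_permutation UNIV (inv f)"])
    have f': "bij_betw (inv f) UNIV UNIV"
      using assms bij_imp_bij_inv by auto
    show "?c \<in> {p. p permutes UNIV} \<rightarrow> {p. p permutes UNIV}"
      using map_permutation_permutes[OF f] by auto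
    show "map_permutation UNIV (inv f) \<in> {p. p permutes UNIV} \<rightarrow> {p. p permutes UNIV}"
      using map_permutation_permutes[OF f'] by auto
    show "map_permutation UNIV (inv f) (?c p) = p" if "p \<in> {p. p permutes UNIV}" for p
      by (rule map_permutation_compose_inv[OF f]) (use that inj in auto)
    show "?c (map_permutation UNIV (inv f) p) = p" if "p \<in> {p. p permutes UNIV}" for p
      by (rule map_permutation_compose_inv[OF f'])
         (use that assms in \<open>auto simp: bij_def surj_f_inv_f\<close>)
  qed
  have "det A = (\<Sum>p | p permutes UNIV. of_int (sign (?c p)) * (\<Prod>i\<in>UNIV. A $ i $ ?c p i))"
    unfolding det_def by (rule sum.reindex_bij_betw[OF bij, symmetric])
  also have "\<dots> = (\<Sum>p | p permutes UNIV. of_int (sign p) * (\<Prod>i\<in>UNIV. A $ f i $ f (p i)))"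
  proof (rule sum.cong[OF refl])
    fix p :: "'a \<Rightarrow> 'a" assume "p \<in> {p. p permutes UNIV}"
    then have p: "p permutes UNIV" by simp
    have "sign (?c p) = sign p"
      using inj p by (intro sign_map_permutation) auto
    moreover have "(\<Prod>i\<in>UNIV. A $ i $ ?c p i) = (\<Prod>i\<in>UNIV. A $ f i $ ?c p (f i))"
      by (rule prod.reindex_bij_betw[OF f, symmetric])
    ultimately show "of_int (sign (?c p)) * (\<Prod>i\<in>UNIV. A $ i $ ?c p i)
        = of_int (sign p) * (\<Prod>i\<in>UNIV. A $ f i $ f (p i))"
      by (simp add: c)
  qed
  finally show ?thesis by (simp add: det_def)
qed

lemma det_conjugate_copy:
  fixes L :: "real^'i::finite \<Rightarrow> real^'i"
  assumes "linear L"
  shows "det (matrix (copy_vec \<circ> L \<circ> orig_vec)) = det (matrix L)"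
proof -
  have orig: "bij orig"
    by (rule bij_orig)
  have axis: "orig_vec (axis i 1) = axis (orig i) 1" for i :: "'i ordered_copy"
    by (auto simp: orig_vec_def axis_def vec_eq_iff)
  have "matrix (copy_vec \<circ> L \<circ> orig_vec) = (\<chi> i j. matrix L $ orig i $ orig j)"
    by (simp add: matrix_def copy_vec_def axis)
  then show ?thesis by (simp add: det_reindex[OF orig])
qed

lemma has_derivative_conjugate_copy:
  assumes "(f has_derivative f') (at (orig_vec y) within S)"
  shows "((copy_vec \<circ> f \<circ> orig_vec) has_derivative (copy_vec \<circ> f' \<circ> orig_vec))
           (at y within copy_vec ` S)"
proof -
  have "orig_vec ` copy_vec ` S = S"
    by (force simp: image_iff)
  then have f: "(f has_derivative f') (at (orig_vec y) within orig_vec ` copy_vec ` S)"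
    using assms by simp
  have "((f \<circ> orig_vec) has_derivative (f' \<circ> orig_vec)) (at y within copy_vec ` S)"
    by (rule diff_chain_within[OF bounded_linear_imp_has_derivative[OF bounded_linear_orig_vec] f])
  then show ?thesis
    unfolding comp_assoc
    by (rule diff_chain_within[OF _ bounded_linear_imp_has_derivative[OF bounded_linear_copy_vec]])
qed

lemma vimage_orig_vec: "orig_vec -` S = copy_vec ` S"
  by (force simp: image_iff)

section \<open>The area formula\<close>

text \<open>The change of variables theorem concerns finite integrals.  If the right side were finite and the left
side infinite, that theorem would make the image a set of finite measure; so both sides are infinite
together.\<close>

theorem emeasure_injective_image:
  fixes f :: "real^'i::finite \<Rightarrow> real^'i"
  assumes S: "S \<in> sets borel" and fS: "f ` S \<in> sets borel"
    and der: "\<And>x. x \<in> S \<Longrightarrow> (f has_derivative f' x) (at x within S)"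
    and inj: "inj_on f S"
    and meas: "(\<lambda>x. indicator S x * \<bar>det (matrix (f' x))\<bar>) \<in> borel_measurable borel"
  shows "emeasure lborel (f ` S) = (\<integral>\<^sup>+x\<in>S. ennreal \<bar>det (matrix (f' x))\<bar> \<partial>lborel)"
proof -
  let ?f = "copy_vec \<circ> f \<circ> orig_vec"
  let ?f' = "\<lambda>y. copy_vec \<circ> f' (orig_vec y) \<circ> orig_vec"
  let ?S = "copy_vec ` S"
  let ?d = "\<lambda>y. \<bar>det (matrix (?f' y))\<bar>"
  have sets: "copy_vec ` X \<in> sets borel" if "X \<in> sets borel" for X :: "(real^'i) set"
    using measurable_sets[OF borel_measurable_orig_vec that] by (simp add: vimage_orig_vec)
  have emeas: "emeasure lborel (copy_vec ` X) = emeasure lborel X" if "X \<in> sets borel" for X :: "(real^'i) set"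
  proof -
    have "emeasure lborel X = emeasure (distr lborel borel orig_vec) X"
      by (simp add: lborel_orig_vec)
    also have "\<dots> = emeasure lborel (copy_vec ` X)"
      using that by (subst emeasure_distr) (auto simp: vimage_orig_vec)
    finally show ?thesis ..
  qed
  have image: "?f ` ?S = copy_vec ` f ` S"
    by (force simp: image_iff)
  have d: "?d y = \<bar>det (matrix (f' (orig_vec y)))\<bar>" if "y \<in> ?S" for y
  proof -
    have "orig_vec y \<in> S" using that by auto
    then show ?thesis
      using det_conjugate_copy[OF has_derivative_linear[OF der]] by simp
  qed
  have meas': "(\<lambda>y. indicator ?S y * ?d y) \<in> borel_measurable borel"
  proof -
    have "(\<lambda>y. indicator ?S y * ?d y)
        = (\<lambda>x. indicator S x * \<bar>det (matrix (f' x))\<bar>) \<circ> orig_vec"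
    proof
      fix y
      show "indicator ?S y * ?d y = ((\<lambda>x. indicator S x * \<bar>det (matrix (f' x))\<bar>) \<circ> orig_vec) y"
        using d[of y] by (cases "y \<in> ?S") (auto simp: indicator_def image_iff)
    qed
    then show ?thesis
      using measurable_comp[OF borel_measurable_orig_vec meas] by simp
  qed
  have key: "?f ` ?S \<in> lmeasurable \<and> measure lebesgue (?f ` ?S) = m
      \<longleftrightarrow> (?d has_integral m) ?S" for m
  proof (rule has_measure_differentiable_image)
    show "?S \<in> sets lebesgue"
      using sets[OF S] by simp
    show "(?f has_derivative ?f' y) (at y within ?S)" if "y \<in> ?S" for y
      using that der by (intro has_derivative_conjugate_copy) auto
    show "inj_on ?f ?S"
      using inj by (auto simp: inj_on_def) (metis orig_copy_vec)
  qed
  have "(\<integral>\<^sup>+x\<in>S. ennreal \<bar>det (matrix (f' x))\<bar> \<partial>lborel)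
      = (\<integral>\<^sup>+x. ennreal (indicator S x * \<bar>det (matrix (f' x))\<bar>) \<partial>distr lborel borel orig_vec)"
    by (subst lborel_orig_vec) (auto intro!: nn_integral_cong simp: indicator_def)
  also have "\<dots> = (\<integral>\<^sup>+y. ennreal (indicator S (orig_vec y) * \<bar>det (matrix (f' (orig_vec y)))\<bar>) \<partial>lborel)"
    using meas by (subst nn_integral_distr) auto
  also have "\<dots> = (\<integral>\<^sup>+y. ennreal (indicator ?S y * ?d y) \<partial>lborel)"
  proof (rule nn_integral_cong)
    fix y :: "real ^ 'i ordered_copy"
    have "orig_vec y \<in> S \<longleftrightarrow> y \<in> ?S"
      using vimage_orig_vec[of S] by auto
    then show "ennreal (indicator S (orig_vec y) * \<bar>det (matrix (f' (orig_vec y)))\<bar>)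
        = ennreal (indicator ?S y * ?d y)"
      using d[of y] by (cases "y \<in> ?S") auto
  qed
  finally have nn: "(\<integral>\<^sup>+x\<in>S. ennreal \<bar>det (matrix (f' x))\<bar> \<partial>lborel)
      = (\<integral>\<^sup>+y. ennreal (indicator ?S y * ?d y) \<partial>lborel)" .
  have fS': "?f ` ?S \<in> sets borel"
    unfolding image by (rule sets[OF fS])
  have "emeasure lborel (?f ` ?S) = (\<integral>\<^sup>+y. ennreal (indicator ?S y * ?d y) \<partial>lborel)"
  proof (cases "emeasure lborel (?f ` ?S) < \<infinity>")
    case True
    then have lm: "?f ` ?S \<in> lmeasurable"
      using fS' by (auto simp: fmeasurable_def)
    then have "(?d has_integral measure lebesgue (?f ` ?S)) ?S"
      using key by blast
    then have "(\<integral>\<^sup>+y. ennreal (indicator ?S y * ?d y) \<partial>lborel) = ennreal (measure lebesgue (?f ` ?S))"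
      by (intro nn_integral_has_integral_lebesgue) auto
    also have "\<dots> = emeasure lebesgue (?f ` ?S)"
      using lm by (simp add: emeasure_eq_measure2 fmeasurableD2)
    finally show ?thesis
      using fS' by simp
  next
    case False
    have "(\<integral>\<^sup>+y. ennreal (indicator ?S y * ?d y) \<partial>lborel) = \<infinity>"
    proof (rule ccontr)
      assume "(\<integral>\<^sup>+y. ennreal (indicator ?S y * ?d y) \<partial>lborel) \<noteq> \<infinity>"
      then obtain r where "(\<integral>\<^sup>+y. ennreal (indicator ?S y * ?d y) \<partial>lborel) = ennreal r" "0 \<le> r"
        by (cases "(\<integral>\<^sup>+y. ennreal (indicator ?S y * ?d y) \<partial>lborel)" rule: ennreal_cases) auto
      then have "((\<lambda>y. indicator ?S y * ?d y) has_integral r) UNIV"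
        using meas' by (intro nn_integral_has_integral) (auto simp: indicator_def)
      moreover have "(\<lambda>y. indicator ?S y * ?d y) = (\<lambda>y. if y \<in> ?S then ?d y else 0)"
        by (auto simp: indicator_def)
      ultimately have "(?d has_integral r) ?S"
        by (simp add: has_integral_restrict_UNIV)
      then have "?f ` ?S \<in> lmeasurable"
        using key by blast
      then show False
        using False fS' by (auto simp: fmeasurable_def)
    qed
    moreover have "emeasure lborel (?f ` ?S) = \<infinity>"
      using False by (simp only: infinity_ennreal_def top.not_eq_extremum not_less) (simp add: top_unique)
    ultimately show ?thesis by (simp only:)
  qed
  then show ?thesis
    unfolding nn image by (simp add: emeas[OF fS])
qed

text \<open>Sard's theorem in equal dimensions.  The set of critical values need not be a Borel set, hence the
Borel null set around it.\<close>

lemma null_critical_values: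
  fixes f :: "real^'i::finite \<Rightarrow> real^'i"
  assumes der: "\<And>x. x \<in> S \<Longrightarrow> (f has_derivative f' x) (at x)"
    and crit: "\<And>x. x \<in> S \<Longrightarrow> det (matrix (f' x)) = 0"
  obtains N where "N \<in> null_sets lborel" "f ` S \<subseteq> N"
proof -
  let ?f = "copy_vec \<circ> f \<circ> orig_vec"
  let ?f' = "\<lambda>y. copy_vec \<circ> f' (orig_vec y) \<circ> orig_vec"
  have "negligible (?f ` copy_vec ` S)"
  proof (rule baby_Sard)
    fix y assume "y \<in> copy_vec ` S"
    then have "orig_vec y \<in> S" by auto
    then have "det (matrix (?f' y)) = 0"
      using det_conjugate_copy[OF has_derivative_linear[OF der]] crit by auto
    then show "rank (matrix (?f' y)) < CARD('i ordered_copy)"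
      by (simp add: det_eq_0_rank)
    show "(?f has_derivative ?f' y) (at y within copy_vec ` S)"
      by (rule has_derivative_conjugate_copy[OF has_derivative_at_withinI[OF der]]) fact
  qed simp
  then have "?f ` copy_vec ` S \<in> null_sets (completion lborel)"
    by (simp add: negligible_iff_null_sets)
  then obtain N where N: "N \<in> null_sets lborel" "?f ` copy_vec ` S \<subseteq> N"
    by (auto simp: null_sets_completion_iff2)
  show ?thesis
  proof
    have "copy_vec -` N \<in> sets borel"
      using measurable_sets[OF borel_measurable_copy_vec, of N] N(1) by (auto simp: null_sets_def)
    moreover have "orig_vec -` copy_vec -` N = N" by auto
    ultimately have "emeasure lborel (copy_vec -` N) = 0"
      using N(1) by (subst lborel_orig_vec[symmetric], subst emeasure_distr) (auto simp: null_sets_def)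
    then show "copy_vec -` N \<in> null_sets lborel"
      using \<open>copy_vec -` N \<in> sets borel\<close> by (simp add: null_sets_def)
    show "f ` S \<subseteq> copy_vec -` N"
      using N(2) by (simp add: image_subset_iff)
  qed
qed

lemma borel_vimage_continuous_on:
  fixes g :: "'a::topological_space \<Rightarrow> 'b::topological_space"
  assumes g: "continuous_on W g" and W: "W \<in> sets borel" and S: "S \<in> sets borel"
  shows "{y \<in> W. g y \<in> S} \<in> sets borel"
proof -
  have "g -` S \<inter> space (restrict_space borel W) \<in> sets (restrict_space borel W)"
    by (rule measurable_sets[OF borel_measurable_continuous_on_restrict[OF g] S])
  moreover have "g -` S \<inter> space (restrict_space borel W) = {y \<in> W. g y \<in> S}"
    by (auto simp: space_restrict_space)
  ultimately show ?thesis
    using W by (simp add: sets_restrict_space_iff)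
qed

lemma borel_measurable_if_continuous_on:
  fixes f :: "'a::topological_space \<Rightarrow> 'b::topological_space"
  assumes "A \<in> sets borel" "continuous_on A f"
  shows "(\<lambda>x. if x \<in> A then f x else c) \<in> borel_measurable borel"
  using assms by (intro borel_measurable_continuous_on_if) auto

text \<open>Push-forward of \<open>|det f'|\<close> times Lebesgue measure under \<open>f\<close> agrees on Borel sets with Lebesgue
measure on the image, by \<open>emeasure_injective_image\<close>; the inverse map shows that images of Borel sets
are Borel sets.\<close>

lemma nn_integral_diffeomorphism:
  fixes f :: "real^'i::finite \<Rightarrow> real^'i"
  assumes U: "open U" and W: "open W" and hom: "homeomorphism U W f g"
    and der: "\<And>x. x \<in> U \<Longrightarrow> (f has_derivative f' x) (at x)"
    and cont: "continuous_on U (\<lambda>x. det (matrix (f' x)))"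
    and S: "S \<in> sets borel" "S \<subseteq> U"
    and chi [measurable]: "wt \<in> borel_measurable borel"
  shows "f ` S \<in> sets borel"
    and "(\<integral>\<^sup>+y\<in>f ` S. wt y \<partial>lborel) = (\<integral>\<^sup>+x\<in>S. wt (f x) * ennreal \<bar>det (matrix (f' x))\<bar> \<partial>lborel)"
proof -
  have image: "f ` A \<in> sets borel" if A: "A \<in> sets borel" "A \<subseteq> U" for A
  proof -
    have "f ` A = {y \<in> W. g y \<in> A}"
      using hom A(2) by (force simp: homeomorphism_def image_iff)
    also have "\<dots> \<in> sets borel"
      using hom W A(1) by (intro borel_vimage_continuous_on) (auto simp: homeomorphism_def)
    finally show ?thesis .
  qed
  show fS [measurable]: "f ` S \<in> sets borel"
    by (rule image[OF S])
  have inj: "inj_on f U"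
    using hom by (metis homeomorphism_def inj_on_inverseI)
  have f_cont: "continuous_on U f"
    using hom by (simp add: homeomorphism_def)
  let ?d = "\<lambda>x. ennreal \<bar>det (matrix (f' x))\<bar>"
  define F where "F = (\<lambda>x. if x \<in> U then f x else 0)"
  have [measurable]: "F \<in> borel_measurable borel"
    unfolding F_def using U f_cont by (intro borel_measurable_if_continuous_on) auto
  have dreal: "(\<lambda>x. indicator A x * \<bar>det (matrix (f' x))\<bar>) \<in> borel_measurable borel"
    if "A \<in> sets borel" "A \<subseteq> U" for A
  proof -
    have "(\<lambda>x. indicator A x *\<^sub>R \<bar>det (matrix (f' x))\<bar>) \<in> borel_measurable borel"
      using that cont by (intro borel_measurable_continuous_on_indicator continuous_intros)
        (auto intro: continuous_on_subset)
    then show ?thesis by simp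
  qed
  define D where "D = (\<lambda>x. indicator S x * ?d x)"
  have D_eq: "D = (\<lambda>x. ennreal (indicator S x * \<bar>det (matrix (f' x))\<bar>))"
    by (auto simp: D_def indicator_def)
  have [measurable]: "D \<in> borel_measurable borel"
    unfolding D_eq using dreal[OF S] by measurable
  have eq: "distr (density lborel D) borel F = density lborel (indicator (f ` S))"
  proof (rule measure_eqI)
    fix A assume "A \<in> sets (distr (density lborel D) borel F)"
    then have A [measurable]: "A \<in> sets borel" by simp
    let ?T = "{x \<in> U. f x \<in> A} \<inter> S"
    have T: "?T \<in> sets borel" "?T \<subseteq> U"
      using borel_vimage_continuous_on[OF f_cont borel_open[OF U] A] S by auto
    have derT: "(f has_derivative f' x) (at x within ?T)" if "x \<in> ?T" for x
      by (rule has_derivative_at_withinI[OF der]) (use that in auto)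
    have injT: "inj_on f ?T"
      using inj T(2) by (rule inj_on_subset)
    have imT: "emeasure lborel (f ` ?T) = (\<integral>\<^sup>+x\<in>?T. ?d x \<partial>lborel)"
      by (rule emeasure_injective_image[where f = f and f' = f', OF T(1) image[OF T] derT injT dreal[OF T]])
    have "emeasure (distr (density lborel D) borel F) A = emeasure (density lborel D) (F -` A)"
      by (subst emeasure_distr) auto
    also have "\<dots> = (\<integral>\<^sup>+x. D x * indicator (F -` A) x \<partial>lborel)"
      using measurable_sets[of F borel borel A] by (intro emeasure_density) auto
    also have "\<dots> = (\<integral>\<^sup>+x\<in>?T. ?d x \<partial>lborel)"
    proof (rule nn_integral_cong)
      fix x
      show "D x * indicator (F -` A) x = ?d x * indicator ?T x"
        using S(2) by (cases "x \<in> S") (auto simp: D_def F_def split: split_indicator)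
    qed
    also have "\<dots> = emeasure lborel (f ` ?T)"
      by (simp only: imT)
    also have "f ` ?T = f ` S \<inter> A"
      using S(2) by blast
    also have "emeasure lborel (f ` S \<inter> A) = emeasure (density lborel (indicator (f ` S))) A"
      by (subst emeasure_density) (auto simp: indicator_inter_arith[symmetric])
    finally show "emeasure (distr (density lborel D) borel F) A = emeasure (density lborel (indicator (f ` S))) A" .
  qed simp
  have "(\<integral>\<^sup>+y\<in>f ` S. wt y \<partial>lborel) = (\<integral>\<^sup>+y. wt y \<partial>density lborel (indicator (f ` S)))"
    by (subst nn_integral_density) (auto simp: mult.commute)
  also have "\<dots> = (\<integral>\<^sup>+x. wt (F x) \<partial>density lborel D)"
    by (subst eq[symmetric], subst nn_integral_distr) auto
  also have "\<dots> = (\<integral>\<^sup>+x. D x * wt (F x) \<partial>lborel)"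
    by (subst nn_integral_density) auto
  also have "\<dots> = (\<integral>\<^sup>+x\<in>S. wt (f x) * ?d x \<partial>lborel)"
  proof (rule nn_integral_cong)
    fix x
    show "D x * wt (F x) = wt (f x) * ?d x * indicator S x"
      using S(2) by (cases "x \<in> S") (auto simp: D_def F_def mult.commute)
  qed
  finally show "(\<integral>\<^sup>+y\<in>f ` S. wt y \<partial>lborel) = (\<integral>\<^sup>+x\<in>S. wt (f x) * ?d x \<partial>lborel)" .
qed

lemma nn_integral_lborel_linear:
  fixes M :: "real^'i::finite^'i"
  assumes "det M \<noteq> 0" and "wt \<in> borel_measurable borel"
  shows "(\<integral>\<^sup>+y. wt y \<partial>lborel) = (\<integral>\<^sup>+x. wt (M *v x) \<partial>lborel) * ennreal \<bar>det M\<bar>"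
proof -
  obtain M' where M': "M ** M' = mat 1" "M' ** M = mat 1"
    using assms(1) invertible_det_nz[of M] by (auto simp: invertible_def)
  have lin: "bounded_linear ((*v) A)" for A :: "real^'i^'i"
    by (simp add: linear_linear matrix_vector_mul_linear)
  have inv: "M *v (M' *v x) = x" "M' *v (M *v x) = x" for x
    by (simp_all add: matrix_vector_mul_assoc M')
  have "surj ((*v) M)" "surj ((*v) M')"
    using inv by (metis surjI)+
  then have hom: "homeomorphism UNIV UNIV ((*v) M) ((*v) M')"
    by (simp add: homeomorphism_def inv lin linear_continuous_on)
  have "(\<integral>\<^sup>+y. wt y \<partial>lborel) = (\<integral>\<^sup>+y\<in>(*v) M ` UNIV. wt y \<partial>lborel)"
    using hom by (simp add: homeomorphism_def)
  also have "\<dots> = (\<integral>\<^sup>+x\<in>UNIV. wt (M *v x) * ennreal \<bar>det (matrix ((*v) M))\<bar> \<partial>lborel)"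
    by (rule nn_integral_diffeomorphism(2)[OF open_UNIV open_UNIV hom
          bounded_linear_imp_has_derivative[OF lin] _ _ _ assms(2)]) simp_all
  also have "\<dots> = (\<integral>\<^sup>+x. wt (M *v x) \<partial>lborel) * ennreal \<bar>det M\<bar>"
  proof -
    have [measurable]: "(*v) M \<in> borel_measurable borel"
      by (intro borel_measurable_continuous_onI linear_continuous_on lin)
    note assms(2)[measurable]
    show ?thesis
      by (simp add: nn_integral_multc)
  qed
  finally show ?thesis .
qed

text \<open>Near its regular points \<open>f\<close> is a diffeomorphism, so the regular part of \<open>B\<close> is a countable disjoint
union of Borel sets \<open>S n\<close> on which \<open>f\<close> is one.  The number of regular preimages of \<open>y\<close> is then the
number of \<open>n\<close> with \<open>y \<in> f ` S n\<close>, and the change of variables formula applies to each \<open>S n\<close>.  Critical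
points add nothing on the right, and on the left only for \<open>y\<close> in a null set.\<close>

theorem area_formula:
  fixes f :: "real^'i::finite \<Rightarrow> real^'i"
  assumes G: "open G"
    and der: "\<And>x. x \<in> G \<Longrightarrow> (f has_derivative f' x) (at x)"
    and cont: "\<And>w. continuous_on G (\<lambda>x. f' x w)"
    and B: "B \<in> sets borel" "B \<subseteq> G"
    and chi [measurable]: "wt \<in> borel_measurable borel"
  shows "(\<integral>\<^sup>+y. wt y * emeasure (count_space UNIV) {x \<in> B. f x = y} \<partial>lborel)
       = (\<integral>\<^sup>+x\<in>B. wt (f x) * ennreal \<bar>det (matrix (f' x))\<bar> \<partial>lborel)"
proof -
  let ?d = "\<lambda>x. ennreal \<bar>det (matrix (f' x))\<bar>"
  define R where "R = {x \<in> G. det (matrix (f' x)) \<noteq> 0}"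
  have det_cont: "continuous_on G (\<lambda>x. det (matrix (f' x)))"
    unfolding det_def matrix_def by (intro continuous_intros) (simp, rule cont)
  have "open R"
    unfolding R_def using continuous_open_preimage[OF det_cont G, of "- {0}"]
    by (simp add: vimage_def Int_def open_Compl)
  define good where "good = (\<lambda>U. open U \<and> U \<subseteq> R \<and> (\<exists>W g. open W \<and> homeomorphism U W f g))"
  have "\<exists>U. good U \<and> x \<in> U" if x: "x \<in> R" for x
  proof -
    have bl: "bounded_linear (f' y)" if "y \<in> G" for y
      using der[OF that] by (rule has_derivative_bounded_linear)
    have xG: "x \<in> G" using x by (simp add: R_def)
    obtain M' where M': "matrix (f' x) ** M' = mat 1" "M' ** matrix (f' x) = mat 1"
      using x invertible_det_nz[of "matrix (f' x)"] by (auto simp: R_def invertible_def)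
    have "bounded_linear ((*v) M')"
      by (simp add: linear_linear matrix_vector_mul_linear)
    then have inv: "Blinfun ((*v) M') o\<^sub>L Blinfun (f' x) = id_blinfun"
    proof (intro blinfun_eqI)
      fix w
      have "f' x w = matrix (f' x) *v w"
        using bl[OF xG] by (simp add: bounded_linear.linear)
      then have "M' *v f' x w = w"
        by (simp only: matrix_vector_mul_assoc M' matrix_vector_mul_lid)
      then show "blinfun_apply (Blinfun ((*v) M') o\<^sub>L Blinfun (f' x)) w = blinfun_apply id_blinfun w"
        using bl[OF xG] \<open>bounded_linear ((*v) M')\<close> by (simp add: bounded_linear_Blinfun_apply)
    qed
    have RG: "R \<subseteq> G" by (auto simp: R_def)
    have der': "\<And>y. y \<in> R \<Longrightarrow> (f has_derivative blinfun_apply (Blinfun (f' y))) (at y)"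
      using der RG by (subst bounded_linear_Blinfun_apply[OF bl]) auto
    have cont': "continuous_on R (\<lambda>y. Blinfun (f' y))"
    proof (rule continuous_on_blinfun_componentwise)
      fix i :: "real^'i"
      have "continuous_on R (\<lambda>y. f' y i)"
        using cont RG by (rule continuous_on_subset)
      moreover have "f' y i = blinfun_apply (Blinfun (f' y)) i" if "y \<in> R" for y
        using bl[of y] RG that by (simp add: bounded_linear_Blinfun_apply subsetD)
      ultimately show "continuous_on R (\<lambda>y. blinfun_apply (Blinfun (f' y)) i)"
        by (simp cong: continuous_on_cong)
    qed
    obtain U' V g g' where "open U'" "U' \<subseteq> R" "x \<in> U'" "open V" "homeomorphism U' V f g"
      by (rule inverse_function_theorem[OF \<open>open R\<close> der' cont' x inv]) blast+
    then show ?thesis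
      by (auto simp: good_def)
  qed
  then have cover: "R = \<Union>(Collect good)"
    by (auto simp: good_def)
  obtain \<U> where \<U>: "\<U> \<subseteq> Collect good" "countable \<U>" "\<Union>\<U> = R"
  proof -
    have "\<And>U. U \<in> Collect good \<Longrightarrow> open U" by (simp add: good_def)
    from Lindelof[OF this] obtain \<F> where
      "\<F> \<subseteq> Collect good" "countable \<F>" "\<Union>\<F> = \<Union>(Collect good)" by blast
    then show ?thesis using that cover by blast
  qed
  \<comment> \<open>The empty set makes the enumeration possible when there are no regular points.\<close>
  define Us where "Us = from_nat_into (insert {} \<U>)"
  have range_Us: "range Us = insert {} \<U>"
    unfolding Us_def by (rule range_from_nat_into) (use \<U>(2) in auto)
  have "good {}"
    by (auto simp: good_def homeomorphism_empty intro!: exI[of _ "{}"])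
  then have good: "good (Us n)" for n
    using range_Us \<U>(1) by (metis insertE mem_Collect_eq rangeI subsetD)
  define S where "S = (\<lambda>n. B \<inter> disjointed Us n)"
  have open_Us: "open (Us n)" for n
    using good by (simp add: good_def)
  have S_borel [measurable]: "S n \<in> sets borel" for n
    unfolding S_def disjointed_def using B(1) open_Us by auto
  have S_sub: "S n \<subseteq> Us n" for n
    unfolding S_def using disjointed_subset[of Us n] by auto
  have disj: "disjoint_family S"
    unfolding S_def using disjoint_family_disjointed[of Us] by (auto simp: disjoint_family_on_def)
  have UN_S: "(\<Union>n. S n) = B \<inter> R"
    unfolding S_def using UN_disjointed_eq[of Us] range_Us \<U>(3) by auto
  have piece: "f ` S n \<in> sets borel"
      "(\<integral>\<^sup>+y\<in>f ` S n. wt y \<partial>lborel) = (\<integral>\<^sup>+x\<in>S n. wt (f x) * ?d x \<partial>lborel)" for n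
  proof -
    obtain W g where Wg: "open W" "homeomorphism (Us n) W f g"
      using good[of n] unfolding good_def by blast
    have sub: "Us n \<subseteq> G" using good[of n] by (auto simp: good_def R_def)
    have der': "\<And>x. x \<in> Us n \<Longrightarrow> (f has_derivative f' x) (at x)"
      using der sub by auto
    note * = nn_integral_diffeomorphism[OF open_Us Wg der' continuous_on_subset[OF det_cont sub]
        S_borel S_sub chi]
    show "f ` S n \<in> sets borel" by (rule *(1))
    show "(\<integral>\<^sup>+y\<in>f ` S n. wt y \<partial>lborel) = (\<integral>\<^sup>+x\<in>S n. wt (f x) * ?d x \<partial>lborel)" by (rule *(2))
  qed
  note piece(1)[measurable]
  have inj: "inj_on f (S n)" for n
  proof -
    obtain W g where "homeomorphism (Us n) W f g"
      using good[of n] unfolding good_def by blast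
    then show ?thesis
      using inj_on_inverseI[of "Us n" g f] S_sub[of n]
      by (auto simp: homeomorphism_def intro: inj_on_subset)
  qed
  have count_piece: "emeasure (count_space UNIV) {x \<in> S n. f x = y} = indicator (f ` S n) y" for n y
  proof (cases "y \<in> f ` S n")
    case True
    then obtain x where "{x \<in> S n. f x = y} = {x}"
      using inj[of n] by (auto simp: inj_on_def)
    then have one: "{x \<in> S n. f x = y} = {x}" .
    show ?thesis unfolding one using True by simp
  next
    case False
    then have none: "{x \<in> S n. f x = y} = {}" by auto
    show ?thesis unfolding none using False by simp
  qed
  have count: "emeasure (count_space UNIV) {x \<in> B \<inter> R. f x = y} = (\<Sum>n. indicator (f ` S n) y)" for y
  proof -
    have "{x \<in> B \<inter> R. f x = y} = (\<Union>n. {x \<in> S n. f x = y})"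
      using UN_S by auto
    also have "emeasure (count_space UNIV) \<dots> = (\<Sum>n. emeasure (count_space UNIV) {x \<in> S n. f x = y})"
      using disj by (intro suminf_emeasure[symmetric]) (auto simp: disjoint_family_on_def)
    finally show ?thesis by (simp add: count_piece)
  qed
  obtain N where N: "N \<in> null_sets lborel" "f ` (G - R) \<subseteq> N"
    by (rule null_critical_values[of "G - R" f f']) (use der in \<open>auto simp: R_def\<close>)
  have AE: "AE y in lborel. wt y * emeasure (count_space UNIV) {x \<in> B. f x = y}
      = (\<Sum>n. wt y * indicator (f ` S n) y)"
  proof (rule AE_I'[OF N(1)], safe)
    fix y assume ne: "wt y * emeasure (count_space UNIV) {x \<in> B. f x = y}
      \<noteq> (\<Sum>n. wt y * indicator (f ` S n) y)"
    show "y \<in> N"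
    proof (rule ccontr)
      assume "y \<notin> N"
      then have "{x \<in> B. f x = y} = {x \<in> B \<inter> R. f x = y}"
        using N(2) B(2) by blast
      then have "emeasure (count_space UNIV) {x \<in> B. f x = y} = (\<Sum>n. indicator (f ` S n) y)"
        by (simp only: count)
      then show False
        using ne by simp
    qed
  qed
  have "(\<integral>\<^sup>+y. wt y * emeasure (count_space UNIV) {x \<in> B. f x = y} \<partial>lborel)
      = (\<integral>\<^sup>+y. (\<Sum>n. wt y * indicator (f ` S n) y) \<partial>lborel)"
    using AE by (rule nn_integral_cong_AE)
  also have "\<dots> = (\<Sum>n. \<integral>\<^sup>+y. wt y * indicator (f ` S n) y \<partial>lborel)"
    by (rule nn_integral_suminf) measurable
  also have "\<dots> = (\<Sum>n. \<integral>\<^sup>+x. wt (f x) * ?d x * indicator (S n) x \<partial>lborel)"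
    by (simp add: piece(2))
  also have "\<dots> = (\<integral>\<^sup>+x. (\<Sum>n. wt (f x) * ?d x * indicator (S n) x) \<partial>lborel)"
  proof (rule nn_integral_suminf[symmetric])
    fix n
    define F where "F = (\<lambda>x. if x \<in> G then f x else 0)"
    define D where "D = (\<lambda>x. if x \<in> G then det (matrix (f' x)) else 0)"
    have "continuous_on G f"
      by (rule continuous_at_imp_continuous_on) (auto intro: has_derivative_continuous der)
    then have [measurable]: "F \<in> borel_measurable borel"
      unfolding F_def using G by (intro borel_measurable_if_continuous_on) auto
    have [measurable]: "D \<in> borel_measurable borel"
      unfolding D_def using G det_cont by (intro borel_measurable_if_continuous_on) auto
    have "(\<lambda>x. wt (f x) * ?d x * indicator (S n) x) = (\<lambda>x. wt (F x) * ennreal \<bar>D x\<bar> * indicator (S n) x)"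
      using B(2) by (auto simp: F_def D_def S_def indicator_def fun_eq_iff)
    also have "\<dots> \<in> borel_measurable lborel" by measurable
    finally show "(\<lambda>x. wt (f x) * ?d x * indicator (S n) x) \<in> borel_measurable lborel" .
  qed
  also have "\<dots> = (\<integral>\<^sup>+x. wt (f x) * ?d x * indicator (B \<inter> R) x \<partial>lborel)"
    using suminf_indicator[OF disj] by (simp add: UN_S)
  also have "\<dots> = (\<integral>\<^sup>+x\<in>B. wt (f x) * ?d x \<partial>lborel)"
    using B(2) by (intro nn_integral_cong) (auto simp: indicator_def R_def)
  finally show ?thesis .
qed

section \<open>Lebesgue measure on subspaces\<close>

lemma product_sigma_finite_lborel: "product_sigma_finite (\<lambda>_. lborel :: real measure)"
  by standard

lemma PiM_lborel_reindex:
  fixes e :: "'a \<Rightarrow> 'b"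
  assumes e: "bij_betw e I J" and I: "finite I"
  shows "distr (\<Pi>\<^sub>M i\<in>I. lborel :: real measure) (\<Pi>\<^sub>M j\<in>J. lborel) (\<lambda>c. \<lambda>j\<in>J. c (inv_into I e j))
       = (\<Pi>\<^sub>M j\<in>J. lborel)"
proof -
  have J: "finite J"
    using bij_betw_finite[OF e] I by simp
  have inv: "inv_into I e j \<in> I" if "j \<in> J" for j
    using e that by (auto simp: bij_betw_def inv_into_into)
  have meas [measurable]: "(\<lambda>c. \<lambda>j\<in>J. c (inv_into I e j)) \<in>
      measurable (\<Pi>\<^sub>M i\<in>I. lborel :: real measure) (\<Pi>\<^sub>M j\<in>J. lborel)"
    by (intro measurable_restrict measurable_component_singleton inv)
  show ?thesis
  proof (rule product_sigma_finite.PiM_eqI[OF product_sigma_finite_lborel J])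
    fix A :: "'b \<Rightarrow> real set"
    assume A: "\<And>j. j \<in> J \<Longrightarrow> A j \<in> sets lborel"
    have A': "A (e i) \<in> sets lborel" if "i \<in> I" for i
      using A bij_betw_apply[OF e that] .
    have vimage: "(\<lambda>c. \<lambda>j\<in>J. c (inv_into I e j)) -` Pi\<^sub>E J A \<inter> space (\<Pi>\<^sub>M i\<in>I. lborel :: real measure)
        = (\<Pi>\<^sub>E i\<in>I. A (e i))"
    proof -
      have "(\<forall>j\<in>J. c (inv_into I e j) \<in> A j) \<longleftrightarrow> (\<forall>i\<in>I. c i \<in> A (e i))" for c :: "'a \<Rightarrow> real"
        using e inv bij_betw_inv_into_left[OF e] bij_betw_inv_into_right[OF e] bij_betw_apply[OF e]
        by (intro iffI ballI) force+
      then show ?thesis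
        by (auto simp: space_PiM PiE_iff)
    qed
    have "emeasure (distr (\<Pi>\<^sub>M i\<in>I. lborel) (\<Pi>\<^sub>M j\<in>J. lborel) (\<lambda>c. \<lambda>j\<in>J. c (inv_into I e j))) (Pi\<^sub>E J A)
        = emeasure (\<Pi>\<^sub>M i\<in>I. lborel) (\<Pi>\<^sub>E i\<in>I. A (e i))"
      by (subst emeasure_distr[OF meas]) (use A J in \<open>auto intro!: sets_PiM_I_finite simp: vimage\<close>)
    also have "\<dots> = (\<Prod>i\<in>I. emeasure lborel (A (e i)))"
      by (rule product_sigma_finite.emeasure_PiM[OF product_sigma_finite_lborel I A'])
    also have "\<dots> = (\<Prod>j\<in>J. emeasure lborel (A j))"
      by (rule prod.reindex_bij_betw[OF e])
    finally show "emeasure (distr (\<Pi>\<^sub>M i\<in>I. lborel) (\<Pi>\<^sub>M j\<in>J. lborel) (\<lambda>c. \<lambda>j\<in>J. c (inv_into I e j))) (Pi\<^sub>E J A)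
        = (\<Prod>j\<in>J. emeasure lborel (A j))" .
  qed simp
qed

text \<open>For an orthonormal set \<open>E\<close> this is the Lebesgue measure of the subspace \<open>span E\<close>, regarded as a measure
on the ambient space.\<close>

definition coord_lebesgue :: "'e::euclidean_space set \<Rightarrow> 'e measure" where
  "coord_lebesgue E = distr (\<Pi>\<^sub>M b\<in>E. lborel) borel (\<lambda>c. \<Sum>b\<in>E. c b *\<^sub>R b)"

lemma sets_coord_lebesgue [simp, measurable_cong]: "sets (coord_lebesgue E) = sets borel"
  by (simp add: coord_lebesgue_def)

lemma space_coord_lebesgue [simp]: "space (coord_lebesgue E) = UNIV"
  by (simp add: coord_lebesgue_def)

text \<open>Used with \<open>B\<close> a basis of an abstract Euclidean space and \<open>T\<close> an isometry, to move \<open>lebesgue_of\<close> into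
the coordinate space, and with \<open>B\<close> an index type, to number the vectors of a frame.\<close>

lemma nn_integral_coord_lebesgue_image:
  fixes T :: "'a \<Rightarrow> 'e::euclidean_space"
  assumes inj: "inj_on T B" and B: "finite B" and f [measurable]: "f \<in> borel_measurable borel"
  shows "(\<integral>\<^sup>+x. f x \<partial>coord_lebesgue (T ` B)) = (\<integral>\<^sup>+c. f (\<Sum>b\<in>B. c b *\<^sub>R T b) \<partial>(\<Pi>\<^sub>M b\<in>B. lborel))"
proof -
  have T: "bij_betw T B (T ` B)"
    using inj by (rule inj_on_imp_bij_betw)
  have inv: "inv_into B T b \<in> B" if "b \<in> T ` B" for b
    using that by (rule inv_into_into)
  have [measurable]: "(\<lambda>c. \<lambda>j\<in>T ` B. c (inv_into B T j)) \<in>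
      measurable (\<Pi>\<^sub>M i\<in>B. lborel :: real measure) (\<Pi>\<^sub>M j\<in>T ` B. lborel)"
    by (intro measurable_restrict measurable_component_singleton inv)
  have "(\<integral>\<^sup>+x. f x \<partial>coord_lebesgue (T ` B))
      = (\<integral>\<^sup>+c. f (\<Sum>b\<in>T ` B. c b *\<^sub>R b) \<partial>(\<Pi>\<^sub>M b\<in>T ` B. lborel))"
    unfolding coord_lebesgue_def by (subst nn_integral_distr) auto
  also have "\<dots> = (\<integral>\<^sup>+c. f (\<Sum>b\<in>T ` B. (\<lambda>j\<in>T ` B. c (inv_into B T j)) b *\<^sub>R b) \<partial>(\<Pi>\<^sub>M b\<in>B. lborel))"
    by (subst PiM_lborel_reindex[OF T B, symmetric], subst nn_integral_distr) auto
  also have "\<dots> = (\<integral>\<^sup>+c. f (\<Sum>b\<in>B. c b *\<^sub>R T b) \<partial>(\<Pi>\<^sub>M b\<in>B. lborel))"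
    by (simp add: sum.reindex[OF inj] inv_into_f_f[OF inj] cong: sum.cong)
  finally show ?thesis .
qed

lemma nn_integral_coord_lebesgue_Un:
  assumes "E \<inter> E' = {}" "finite E" "finite E'" and f [measurable]: "f \<in> borel_measurable borel"
  shows "(\<integral>\<^sup>+x. f x \<partial>coord_lebesgue (E \<union> E'))
       = (\<integral>\<^sup>+x. \<integral>\<^sup>+y. f (x + y) \<partial>coord_lebesgue E' \<partial>coord_lebesgue E)"
proof -
  interpret product_sigma_finite "\<lambda>_. lborel :: real measure"
    by (rule product_sigma_finite_lborel)
  interpret E': finite_product_sigma_finite "\<lambda>_. lborel :: real measure" E'
    by standard fact
  have merge: "(\<Sum>b\<in>E \<union> E'. merge E E' (c, d) b *\<^sub>R b) = (\<Sum>b\<in>E. c b *\<^sub>R b) + (\<Sum>b\<in>E'. d b *\<^sub>R b)"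
    for c d :: "'a \<Rightarrow> real"
    using assms(1-3) by (subst sum.union_disjoint) (auto intro!: arg_cong2[where f = "(+)"] sum.cong)
  have [measurable]: "(\<lambda>x. \<integral>\<^sup>+d. f (x + (\<Sum>b\<in>E'. d b *\<^sub>R b)) \<partial>(\<Pi>\<^sub>M b\<in>E'. lborel)) \<in> borel_measurable borel"
    by (rule E'.borel_measurable_nn_integral) measurable
  have "(\<integral>\<^sup>+x. f x \<partial>coord_lebesgue (E \<union> E'))
      = (\<integral>\<^sup>+c. f (\<Sum>b\<in>E \<union> E'. c b *\<^sub>R b) \<partial>(\<Pi>\<^sub>M b\<in>E \<union> E'. lborel))"
    unfolding coord_lebesgue_def by (subst nn_integral_distr) auto
  also have "\<dots> = (\<integral>\<^sup>+c. \<integral>\<^sup>+d. f ((\<Sum>b\<in>E. c b *\<^sub>R b) + (\<Sum>b\<in>E'. d b *\<^sub>R b)) \<partial>(\<Pi>\<^sub>M b\<in>E'. lborel) \<partial>(\<Pi>\<^sub>M b\<in>E. lborel))"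
    by (subst product_nn_integral_fold[OF assms(1-3)]) (auto simp: merge)
  also have "\<dots> = (\<integral>\<^sup>+x. \<integral>\<^sup>+d. f (x + (\<Sum>b\<in>E'. d b *\<^sub>R b)) \<partial>(\<Pi>\<^sub>M b\<in>E'. lborel) \<partial>coord_lebesgue E)"
    unfolding coord_lebesgue_def by (subst nn_integral_distr) auto
  also have "\<dots> = (\<integral>\<^sup>+x. \<integral>\<^sup>+y. f (x + y) \<partial>coord_lebesgue E' \<partial>coord_lebesgue E)"
    unfolding coord_lebesgue_def by (subst (2) nn_integral_distr) auto
  finally show ?thesis .
qed

lemma nn_integral_coord_lebesgue_empty:
  assumes f [measurable]: "f \<in> borel_measurable borel"
  shows "(\<integral>\<^sup>+x. f x \<partial>coord_lebesgue {}) = f 0"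
  unfolding coord_lebesgue_def by (subst nn_integral_distr) (auto simp: PiM_empty)

lemma nn_integral_coord_lebesgue_insert:
  assumes E: "finite E" "b \<notin> E" and f [measurable]: "f \<in> borel_measurable borel"
  shows "(\<integral>\<^sup>+x. f x \<partial>coord_lebesgue (insert b E))
       = (\<integral>\<^sup>+x. \<integral>\<^sup>+s. f (x + s *\<^sub>R b) \<partial>lborel \<partial>coord_lebesgue E)"
proof -
  interpret product_sigma_finite "\<lambda>_. lborel :: real measure"
    by (rule product_sigma_finite_lborel)
  have single: "(\<integral>\<^sup>+y. f (x + y) \<partial>coord_lebesgue {b}) = (\<integral>\<^sup>+s. f (x + s *\<^sub>R b) \<partial>lborel)" for x
  proof -
    have "(\<integral>\<^sup>+y. f (x + y) \<partial>coord_lebesgue {b}) = (\<integral>\<^sup>+c. f (x + c b *\<^sub>R b) \<partial>(\<Pi>\<^sub>M b\<in>{b}. lborel))"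
      unfolding coord_lebesgue_def by (subst nn_integral_distr) auto
    also have "\<dots> = (\<integral>\<^sup>+s. f (x + s *\<^sub>R b) \<partial>lborel)"
      by (rule product_nn_integral_singleton) measurable
    finally show ?thesis .
  qed
  have "(\<integral>\<^sup>+x. f x \<partial>coord_lebesgue (E \<union> {b})) = (\<integral>\<^sup>+x. \<integral>\<^sup>+y. f (x + y) \<partial>coord_lebesgue {b} \<partial>coord_lebesgue E)"
    by (rule nn_integral_coord_lebesgue_Un) (use E in auto)
  then show ?thesis
    by (simp add: single)
qed

text \<open>Induction over \<open>E\<close> splits off one coordinate at a time and reduces this to affine maps of the line.\<close>

lemma nn_integral_coord_lebesgue_affine:
  assumes "finite E" "t \<in> span E" "r \<noteq> 0" "f \<in> borel_measurable borel"
  shows "(\<integral>\<^sup>+x. f x \<partial>coord_lebesgue E) = ennreal (\<bar>r\<bar> ^ card E) * (\<integral>\<^sup>+x. f (t + r *\<^sub>R x) \<partial>coord_lebesgue E)"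
  using assms
proof (induction E arbitrary: t f rule: finite_induct)
  case empty
  note empty(3)[measurable]
  have "t = 0" using empty by simp
  show ?case
    by (subst (1 2) nn_integral_coord_lebesgue_empty) (auto simp: \<open>t = 0\<close>)
next
  case (insert b E)
  note [measurable] = insert.prems(3)
  obtain k where k: "t - k *\<^sub>R b \<in> span E"
    using insert.prems(1) span_breakdown_eq by blast
  have inner: "(\<integral>\<^sup>+s. f (x + s *\<^sub>R b) \<partial>lborel)
      = ennreal \<bar>r\<bar> * (\<integral>\<^sup>+s. f (x + (k + r * s) *\<^sub>R b) \<partial>lborel)" for x
    by (rule nn_integral_real_affine[OF _ \<open>r \<noteq> 0\<close>]) measurable
  have "(\<integral>\<^sup>+x. f x \<partial>coord_lebesgue (insert b E))
      = (\<integral>\<^sup>+x. \<integral>\<^sup>+s. f (x + s *\<^sub>R b) \<partial>lborel \<partial>coord_lebesgue E)"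
    by (rule nn_integral_coord_lebesgue_insert) (use insert in auto)
  also have "\<dots> = ennreal \<bar>r\<bar> * (\<integral>\<^sup>+x. \<integral>\<^sup>+s. f (x + (k + r * s) *\<^sub>R b) \<partial>lborel \<partial>coord_lebesgue E)"
    unfolding inner by (rule nn_integral_cmult) measurable
  also have "(\<integral>\<^sup>+x. \<integral>\<^sup>+s. f (x + (k + r * s) *\<^sub>R b) \<partial>lborel \<partial>coord_lebesgue E)
      = ennreal (\<bar>r\<bar> ^ card E) *
        (\<integral>\<^sup>+x. \<integral>\<^sup>+s. f ((t - k *\<^sub>R b) + r *\<^sub>R x + (k + r * s) *\<^sub>R b) \<partial>lborel \<partial>coord_lebesgue E)"
    by (rule insert.IH[OF k \<open>r \<noteq> 0\<close>]) measurable
  also have "(\<integral>\<^sup>+x. \<integral>\<^sup>+s. f ((t - k *\<^sub>R b) + r *\<^sub>R x + (k + r * s) *\<^sub>R b) \<partial>lborel \<partial>coord_lebesgue E)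
      = (\<integral>\<^sup>+x. \<integral>\<^sup>+s. f (t + r *\<^sub>R (x + s *\<^sub>R b)) \<partial>lborel \<partial>coord_lebesgue E)"
    by (simp add: algebra_simps)
  also have "\<dots> = (\<integral>\<^sup>+x. f (t + r *\<^sub>R x) \<partial>coord_lebesgue (insert b E))"
    by (subst nn_integral_coord_lebesgue_insert) (use insert in auto)
  finally show ?case
    using insert.hyps by (simp add: ennreal_mult mult.assoc)
qed

lemma orthonormal_basis_independent:
  assumes "orthonormal_basis (\<bullet>) W E"
  shows "independent E" "pairwise orthogonal E" "\<And>b. b \<in> E \<Longrightarrow> norm b = 1"
proof -
  show "pairwise orthogonal E"
    using assms by (auto simp: orthonormal_basis_def pairwise_def orthogonal_def)
  show n: "norm b = 1" if "b \<in> E" for b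
    using assms that by (auto simp: orthonormal_basis_def norm_eq_1)
  show "independent E"
    using \<open>pairwise orthogonal E\<close> n[of 0] by (intro pairwise_orthogonal_independent) auto
qed

text \<open>An orthonormal basis differs from the standard one by an orthogonal map, which has determinant
\<open>\<plusminus>1\<close>; so the choice of the basis does not matter.\<close>

lemma coord_lebesgue_UNIV:
  fixes E :: "(real^'n::finite) set"
  assumes E: "orthonormal_basis (\<bullet>) UNIV E" and f [measurable]: "f \<in> borel_measurable borel"
  shows "(\<integral>\<^sup>+x. f x \<partial>coord_lebesgue E) = (\<integral>\<^sup>+x. f x \<partial>lborel)"
proof -
  note ind = orthonormal_basis_independent[OF E]
  have fin: "finite E" and sp: "span E = UNIV" and
    dot: "\<And>b c. b \<in> E \<Longrightarrow> c \<in> E \<Longrightarrow> b \<bullet> c = (if b = c then 1 else 0)"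
    using E by (auto simp: orthonormal_basis_def)
  have "card E = DIM(real^'n)"
    using dim_eq_card_independent[OF ind(1)] dim_span[of E] sp by simp
  then obtain T :: "real^'n \<Rightarrow> real^'n" where T: "bij_betw T Basis E"
    using finite_same_card_bij[of "Basis :: (real^'n) set" E] fin by auto
  \<comment> \<open>the orthogonal map that takes the standard basis to \<open>E\<close>\<close>
  define L where "L = (\<lambda>x::real^'n. \<Sum>b\<in>Basis. (x \<bullet> b) *\<^sub>R T b)"
  have L: "linear L"
    unfolding L_def by (intro linearI) (simp_all add: inner_add_left scaleR_add_left sum.distrib scaleR_sum_right)
  have "L x \<bullet> L y = x \<bullet> y" for x y
  proof -
    have TT: "T b \<bullet> T c = (if b = c then 1 else 0)" if "b \<in> Basis" "c \<in> Basis" for b c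
      using T that dot[of "T b" "T c"] by (auto simp: bij_betw_def inj_on_def)
    have "L x \<bullet> L y = (\<Sum>b\<in>Basis. \<Sum>c\<in>Basis. (x \<bullet> b) * ((y \<bullet> c) * (T b \<bullet> T c)))"
      by (simp only: L_def inner_sum_left inner_scaleR_left)
         (simp add: inner_sum_right sum_distrib_left)
    also have "\<dots> = (\<Sum>b\<in>Basis. \<Sum>c\<in>Basis. if c = b then (x \<bullet> b) * (y \<bullet> b) else 0)"
      by (intro sum.cong refl) (auto simp: TT)
    also have "\<dots> = x \<bullet> y"
      by (simp add: euclidean_inner[of x y])
    finally show ?thesis .
  qed
  then have orth: "orthogonal_transformation L"
    using L by (simp add: orthogonal_transformation_def)
  then have det: "\<bar>det (matrix L)\<bar> = 1"
    by simp
  have mv: "(*v) (matrix L) = L"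
    using L by simp
  have [measurable]: "L \<in> borel_measurable borel"
    using L by (intro borel_measurable_continuous_onI linear_continuous_on) (simp add: linear_linear)
  have "(\<integral>\<^sup>+x. f x \<partial>coord_lebesgue E) = (\<integral>\<^sup>+x. f x \<partial>coord_lebesgue (T ` Basis))"
    using T by (simp add: bij_betw_def)
  also have "\<dots> = (\<integral>\<^sup>+c. f (\<Sum>b\<in>Basis. c b *\<^sub>R T b) \<partial>(\<Pi>\<^sub>M b\<in>Basis. lborel))"
    by (rule nn_integral_coord_lebesgue_image) (use T in \<open>auto simp: bij_betw_def\<close>)
  also have "\<dots> = (\<integral>\<^sup>+c. f (L (\<Sum>b\<in>Basis. c b *\<^sub>R b)) \<partial>(\<Pi>\<^sub>M b\<in>Basis. lborel))"
    by (simp add: L_def)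
  also have "\<dots> = (\<integral>\<^sup>+x. f (L x) \<partial>lborel)"
    by (subst lborel_eq, subst nn_integral_distr) auto
  also have "\<dots> = (\<integral>\<^sup>+x. f x \<partial>lborel)"
    using nn_integral_lborel_linear[of "matrix L" f] det by (auto simp: mv)
  finally show ?thesis .
qed

lemma coord_lebesgue_Fubini:
  fixes F :: "'e::euclidean_space \<Rightarrow> 'b \<Rightarrow> ennreal"
  assumes E: "finite E" and N: "sigma_finite_measure N"
    and F [measurable]: "case_prod F \<in> borel_measurable (borel \<Otimes>\<^sub>M N)"
  shows "(\<integral>\<^sup>+x. \<integral>\<^sup>+s. F x s \<partial>N \<partial>coord_lebesgue E) = (\<integral>\<^sup>+s. \<integral>\<^sup>+x. F x s \<partial>coord_lebesgue E \<partial>N)"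
proof -
  interpret N: sigma_finite_measure N by fact
  interpret P: finite_product_sigma_finite "\<lambda>_. lborel :: real measure" E
    by standard fact
  interpret pair_sigma_finite "\<Pi>\<^sub>M b\<in>E. lborel :: real measure" N ..
  have "(\<integral>\<^sup>+x. \<integral>\<^sup>+s. F x s \<partial>N \<partial>coord_lebesgue E)
      = (\<integral>\<^sup>+c. \<integral>\<^sup>+s. F (\<Sum>b\<in>E. c b *\<^sub>R b) s \<partial>N \<partial>(\<Pi>\<^sub>M b\<in>E. lborel))"
    unfolding coord_lebesgue_def by (subst nn_integral_distr) auto
  also have "\<dots> = (\<integral>\<^sup>+s. \<integral>\<^sup>+c. F (\<Sum>b\<in>E. c b *\<^sub>R b) s \<partial>(\<Pi>\<^sub>M b\<in>E. lborel) \<partial>N)"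
    by (rule Fubini'[symmetric]) measurable
  also have "\<dots> = (\<integral>\<^sup>+s. \<integral>\<^sup>+x. F x s \<partial>coord_lebesgue E \<partial>N)"
    unfolding coord_lebesgue_def by (intro nn_integral_cong, subst nn_integral_distr) auto
  finally show ?thesis .
qed

text \<open>In orthonormal coordinates the unit ball lies in the cube \<open>[-1, 1]\<^sup>E\<close>.\<close>

lemma emeasure_coord_lebesgue_ball_finite:
  assumes E: "orthonormal_basis (\<bullet>) W E"
  shows "emeasure (coord_lebesgue E) (cball 0 1) < \<infinity>"
proof -
  have fin: "finite E" and dot: "\<And>b c. b \<in> E \<Longrightarrow> c \<in> E \<Longrightarrow> b \<bullet> c = (if b = c then 1 else 0)"
    using E by (auto simp: orthonormal_basis_def)
  have "emeasure (coord_lebesgue E) (cball 0 1)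
      = emeasure (\<Pi>\<^sub>M b\<in>E. lborel) ((\<lambda>c. \<Sum>b\<in>E. c b *\<^sub>R b) -` cball 0 1 \<inter> space (\<Pi>\<^sub>M b\<in>E. lborel))"
    unfolding coord_lebesgue_def by (subst emeasure_distr) auto
  also have "\<dots> \<le> emeasure (\<Pi>\<^sub>M b\<in>E. lborel) (\<Pi>\<^sub>E b\<in>E. {-1..1::real})"
  proof (rule emeasure_mono)
    show "(\<lambda>c. \<Sum>b\<in>E. c b *\<^sub>R b) -` cball 0 1 \<inter> space (\<Pi>\<^sub>M b\<in>E. lborel) \<subseteq> (\<Pi>\<^sub>E b\<in>E. {-1..1::real})"
    proof
      fix c assume c: "c \<in> (\<lambda>c. \<Sum>b\<in>E. c b *\<^sub>R b) -` cball 0 1 \<inter> space (\<Pi>\<^sub>M b\<in>E. lborel)"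
      have "\<bar>c b\<bar> \<le> 1" if b: "b \<in> E" for b
      proof -
        have "(\<Sum>b\<in>E. c b *\<^sub>R b) \<bullet> b = (\<Sum>a\<in>E. if a = b then c a else 0)"
          unfolding inner_sum_left by (rule sum.cong) (auto simp: dot b)
        also have "\<dots> = c b" using fin b by simp
        finally have "\<bar>c b\<bar> = \<bar>(\<Sum>b\<in>E. c b *\<^sub>R b) \<bullet> b\<bar>" by simp
        also have "\<dots> \<le> norm (\<Sum>b\<in>E. c b *\<^sub>R b) * norm b"
          by (rule Cauchy_Schwarz_ineq2)
        also have "\<dots> \<le> 1"
          using c orthonormal_basis_independent(3)[OF E b] by simp
        finally show ?thesis .
      qed
      then show "c \<in> (\<Pi>\<^sub>E b\<in>E. {-1..1})"
        using c by (force simp: space_PiM PiE_iff abs_le_iff)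
    qed
    show "(\<Pi>\<^sub>E b\<in>E. {-1..1}) \<in> sets (\<Pi>\<^sub>M b\<in>E. lborel :: real measure)"
      using fin by (intro sets_PiM_I_finite) auto
  qed
  also have "\<dots> = (\<Prod>b\<in>E. emeasure lborel {-1..1::real})"
    by (rule product_sigma_finite.emeasure_PiM[OF product_sigma_finite_lborel fin]) auto
  also have "\<dots> = ennreal (2 ^ card E)"
    by (simp add: ennreal_power del: ennreal_numeral)
  also have "\<dots> < \<infinity>"
    by simp
  finally show ?thesis .
qed

lemma nn_integral_power_above:
  fixes a :: real
  assumes m: "0 < m" and a: "0 \<le> a" "a \<le> 1"
  shows "(\<integral>\<^sup>+s\<in>{a..1}. ennreal (real m * s ^ (m - 1)) \<partial>lborel) = ennreal (1 - a ^ m)"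
proof -
  have "(\<integral>\<^sup>+s. ennreal (real m * s ^ (m - 1)) * indicator {a..1} s \<partial>lborel) = ennreal (1 ^ m - a ^ m)"
  proof (rule nn_integral_FTC_Icc)
    show "((\<lambda>s. s ^ m) has_real_derivative real m * s ^ (m - 1)) (at s)" for s
      by (auto intro!: derivative_eq_intros)
  qed (use a in auto)
  then show ?thesis by simp
qed

text \<open>Integration in polar coordinates, without the sphere.  With \<open>k = card E\<close> and
\<open>\<phi>(x) = f(x / |x|)\<close> on the punctured unit ball, \<open>f(x) = |x|\<^sup>m \<phi>(x)\<close> and
\<open>|x|\<^sup>m\<close> is \<open>1\<close> minus the integral of \<open>m s\<^bsup>m - 1\<^esup>\<close> over \<open>|x| \<le> s \<le> 1\<close>.  Scaling by \<open>s\<close> shows that \<open>\<phi>\<close> has integral \<open>s\<^sup>k \<integral>\<phi>\<close> over the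
ball of radius \<open>s\<close>, so that \<open>\<integral>f = (1 - m / (k + m)) \<integral>\<phi>\<close>.  Finiteness of \<open>\<integral>\<phi>\<close> is what allows the
subtraction.\<close>

lemma nn_integral_homogeneous_ball:
  fixes f :: "'e::euclidean_space \<Rightarrow> ennreal"
  assumes E: "finite E" and m: "0 < m"
    and f [measurable]: "f \<in> borel_measurable borel"
    and hom: "\<And>r x. 0 < r \<Longrightarrow> f (r *\<^sub>R x) = ennreal (r ^ m) * f x"
    and fin: "(\<integral>\<^sup>+x. f (x /\<^sub>R norm x) * indicator (cball 0 1 - {0}) x \<partial>coord_lebesgue E) < \<infinity>"
  shows "of_nat (card E + m) * (\<integral>\<^sup>+x. f x * indicator (cball 0 1 - {0}) x \<partial>coord_lebesgue E)
       = of_nat (card E) * (\<integral>\<^sup>+x. f (x /\<^sub>R norm x) * indicator (cball 0 1 - {0}) x \<partial>coord_lebesgue E)"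
proof -
  let ?k = "card E" and ?L = "coord_lebesgue E"
  define \<phi> where "\<phi> = (\<lambda>x. f (x /\<^sub>R norm x) * indicator (cball 0 1 - {0}) x)"
  define w where "w = (\<lambda>s::real. ennreal (real m * s ^ (m - 1)) * indicator {0..1} s)"
  have [measurable]: "cball 0 1 - {0} \<in> sets (borel :: 'e measure)"
    by simp
  have [measurable]: "\<phi> \<in> borel_measurable borel"
    unfolding \<phi>_def by measurable
  have [measurable]: "w \<in> borel_measurable borel"
    unfolding w_def by measurable
  define I where "I = (\<integral>\<^sup>+x. \<phi> x \<partial>?L)"
  define A where "A = (\<integral>\<^sup>+x. f x * indicator (cball 0 1 - {0}) x \<partial>?L)"
  have split: "\<phi> x = f x * indicator (cball 0 1 - {0}) x
      + (\<integral>\<^sup>+s. \<phi> x * (w s * indicator {s. norm x \<le> s} s) \<partial>lborel)" for x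
  proof (cases "x \<in> cball 0 1 - {0}")
    case True
    have "f x = ennreal (norm x ^ m) * f (x /\<^sub>R norm x)"
      using hom[of "norm x" "x /\<^sub>R norm x"] True by simp
    moreover have "(\<integral>\<^sup>+s. w s * indicator {s. norm x \<le> s} s \<partial>lborel)
        = (\<integral>\<^sup>+s\<in>{norm x..1}. ennreal (real m * s ^ (m - 1)) \<partial>lborel)"
      by (intro nn_integral_cong)
         (auto simp: w_def split: split_indicator intro: order_trans[OF norm_ge_zero])
    moreover have "\<dots> = ennreal (1 - norm x ^ m)"
      using True m by (intro nn_integral_power_above) auto
    moreover have "ennreal (norm x ^ m) + ennreal (1 - norm x ^ m) = 1"
      using True by (subst ennreal_plus[symmetric]) (auto simp: power_le_one)
    ultimately show ?thesis
      using True
      by (simp add: nn_integral_cmult \<phi>_def distrib_left[symmetric] mult.commute[of "ennreal (norm x ^ m)"])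
  qed (auto simp: \<phi>_def)
  have scaled: "(\<integral>\<^sup>+x. \<phi> x * indicator {x. norm x \<le> s} x \<partial>?L) = ennreal (s ^ ?k) * I" if s: "0 < s" "s \<le> 1" for s :: real
  proof -
    have "(\<integral>\<^sup>+x. \<phi> x * indicator {x. norm x \<le> s} x \<partial>?L)
        = ennreal (\<bar>s\<bar> ^ ?k) * (\<integral>\<^sup>+x. \<phi> (0 + s *\<^sub>R x) * indicator {x. norm x \<le> s} (0 + s *\<^sub>R x) \<partial>?L)"
      using s by (intro nn_integral_coord_lebesgue_affine[OF E]) (auto simp: span_zero)
    also have "(\<integral>\<^sup>+x. \<phi> (0 + s *\<^sub>R x) * indicator {x. norm x \<le> s} (0 + s *\<^sub>R x) \<partial>?L) = I"
      unfolding I_def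
    proof (rule nn_integral_cong)
      fix x :: 'e
      have "(s * norm x \<le> s) = (norm x \<le> 1)"
        using s by (simp add: mult_le_cancel_left1)
      moreover have "norm x \<le> 1 \<Longrightarrow> s * norm x \<le> 1"
        using s by (simp add: mult_le_one)
      moreover have dir: "(s *\<^sub>R x) /\<^sub>R norm (s *\<^sub>R x) = x /\<^sub>R norm x"
        using s by simp
      ultimately show "\<phi> (0 + s *\<^sub>R x) * indicator {x. norm x \<le> s} (0 + s *\<^sub>R x) = \<phi> x"
        using s unfolding \<phi>_def add_0 dir by (auto split: split_indicator)
    qed
    finally show ?thesis using s by simp
  qed
  have "I = (\<integral>\<^sup>+x. f x * indicator (cball 0 1 - {0}) x
      + (\<integral>\<^sup>+s. \<phi> x * (w s * indicator {s. norm x \<le> s} s) \<partial>lborel) \<partial>?L)"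
    unfolding I_def by (rule nn_integral_cong) (rule split)
  also have "\<dots> = A + (\<integral>\<^sup>+x. \<integral>\<^sup>+s. \<phi> x * (w s * indicator {s. norm x \<le> s} s) \<partial>lborel \<partial>?L)"
    unfolding A_def by (rule nn_integral_add) measurable
  also have "(\<integral>\<^sup>+x. \<integral>\<^sup>+s. \<phi> x * (w s * indicator {s. norm x \<le> s} s) \<partial>lborel \<partial>?L)
      = (\<integral>\<^sup>+s. \<integral>\<^sup>+x. \<phi> x * (w s * indicator {s. norm x \<le> s} s) \<partial>?L \<partial>lborel)"
    by (rule coord_lebesgue_Fubini[OF E sigma_finite_lborel]) measurable
  also have "\<dots> = (\<integral>\<^sup>+s. w s * ennreal (s ^ ?k) * I \<partial>lborel)"
  \<comment> \<open>scaling by \<open>s\<close> requires \<open>s \<noteq> 0\<close>\<close>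
  proof (rule nn_integral_cong_AE)
    have "AE s in lborel. s \<noteq> (0::real)"
      by (rule AE_lborel_singleton)
    then show "AE s in lborel. (\<integral>\<^sup>+x. \<phi> x * (w s * indicator {s. norm x \<le> s} s) \<partial>?L) = w s * ennreal (s ^ ?k) * I"
    proof eventually_elim
      case (elim s)
      have "(\<integral>\<^sup>+x. \<phi> x * (w s * indicator {s. norm x \<le> s} s) \<partial>?L)
          = (\<integral>\<^sup>+x. w s * (\<phi> x * indicator {x. norm x \<le> s} x) \<partial>?L)"
        by (intro nn_integral_cong) (auto split: split_indicator simp: mult.commute)
      also have "\<dots> = w s * (\<integral>\<^sup>+x. \<phi> x * indicator {x. norm x \<le> s} x \<partial>?L)"
        by (rule nn_integral_cmult) measurable
      also have "\<dots> = w s * ennreal (s ^ ?k) * I"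
        using scaled[of s] elim by (auto simp: w_def mult.assoc split: split_indicator)
      finally show ?case .
    qed
  qed
  also have "\<dots> = (\<integral>\<^sup>+s. w s * ennreal (s ^ ?k) \<partial>lborel) * I"
    by (rule nn_integral_multc) measurable
  also have "(\<integral>\<^sup>+s. w s * ennreal (s ^ ?k) \<partial>lborel) = ennreal (real m / real (?k + m))"
  proof -
    have "(\<integral>\<^sup>+s. w s * ennreal (s ^ ?k) \<partial>lborel)
        = (\<integral>\<^sup>+s. ennreal (real m * s ^ (?k + m - 1)) * indicator {0..1} s \<partial>lborel)"
    proof (rule nn_integral_cong)
      fix s :: real
      have "s ^ (m - 1) * s ^ ?k = s ^ (?k + m - 1)"
        using m by (simp add: power_add[symmetric] add.commute)
      then have "real m * s ^ (m - 1) * s ^ ?k = real m * s ^ (?k + m - 1)"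
        by (simp only: mult.assoc)
      then show "w s * ennreal (s ^ ?k) = ennreal (real m * s ^ (?k + m - 1)) * indicator {0..1} s"
        by (auto simp: w_def ennreal_mult[symmetric] split: split_indicator)
    qed
    also have "\<dots> = ennreal (real m / real (?k + m) * 1 ^ (?k + m) - real m / real (?k + m) * 0 ^ (?k + m))"
    proof (rule nn_integral_FTC_Icc)
      show "((\<lambda>s. real m / real (?k + m) * s ^ (?k + m)) has_real_derivative real m * s ^ (?k + m - 1)) (at s)" for s
        using m by (auto intro!: derivative_eq_intros)
    qed auto
    finally show ?thesis using m by (simp add: power_0_left)
  qed
  finally have I_eq: "I = A + ennreal (real m / real (?k + m)) * I" .
  have "I < \<infinity>"
    using fin by (simp add: I_def \<phi>_def)
  then obtain i where i: "I = ennreal i" "0 \<le> i"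
    by (cases I rule: ennreal_cases) auto
  have "A \<le> I"
    by (subst I_eq) simp
  then obtain a where a: "A = ennreal a" "0 \<le> a"
    using i by (cases A rule: ennreal_cases) (auto simp: top_unique)
  have "ennreal i = ennreal (a + real m / real (?k + m) * i)"
    using I_eq a(2) i(2) unfolding i(1) a(1) by (simp add: ennreal_mult[symmetric])
  then have "i = a + real m / real (?k + m) * i"
    using a(2) i(2) by (subst (asm) ennreal_inj) auto
  then have "real (?k + m) * i = real (?k + m) * a + real m * i"
    using m by (simp add: field_simps)
  then have "real (?k + m) * a = real ?k * i"
    by (simp add: algebra_simps)
  then have "ennreal (real (?k + m)) * ennreal a = ennreal (real ?k) * ennreal i"
    by (subst (1 2) ennreal_mult[symmetric]) (simp_all add: a i del: of_nat_add)
  then have "of_nat (?k + m) * A = of_nat ?k * I"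
    by (simp only: a i ennreal_of_nat_eq_real_of_nat)
  then show ?thesis
    by (simp add: A_def I_def \<phi>_def)
qed

section \<open>Area of spheres in abstract Euclidean spaces\<close>

text \<open>A map \<open>\<kappa>\<close> that is linear and isometric on \<open>(W, h)\<close>.  Integrals over \<open>W\<close> and its unit sphere become
integrals over the image of \<open>W\<close> in Euclidean space.\<close>

locale isometric_coordinates =
  fixes W :: "'v::real_vector set" and h :: "'v \<Rightarrow> 'v \<Rightarrow> real"
    and \<kappa> :: "'v \<Rightarrow> 'e::euclidean_space"
  assumes subspace_W: "subspace W" and ex_basis: "\<exists>B. orthonormal_basis h W B"
    and \<kappa>_add: "\<And>x y. x \<in> W \<Longrightarrow> y \<in> W \<Longrightarrow> \<kappa> (x + y) = \<kappa> x + \<kappa> y"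
    and \<kappa>_scaleR: "\<And>c x. x \<in> W \<Longrightarrow> \<kappa> (c *\<^sub>R x) = c *\<^sub>R \<kappa> x"
    and h_\<kappa>: "\<And>x y. x \<in> W \<Longrightarrow> y \<in> W \<Longrightarrow> h x y = \<kappa> x \<bullet> \<kappa> y"
begin

text \<open>The basis chosen in the definition of \<open>lebesgue_of\<close>.\<close>

definition "basis = (SOME B. orthonormal_basis h W B)"

definition "image_basis = \<kappa> ` basis"

lemma basis: "orthonormal_basis h W basis"
  unfolding basis_def using ex_basis by (rule someI_ex)

lemma finite_basis: "finite basis" and span_basis: "span basis = W"
  and h_basis: "\<And>b c. b \<in> basis \<Longrightarrow> c \<in> basis \<Longrightarrow> h b c = (if b = c then 1 else 0)"
  using basis by (auto simp: orthonormal_basis_def)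

lemma basis_in_W: "b \<in> basis \<Longrightarrow> b \<in> W"
  using span_basis span_base by blast

lemma \<kappa>_0: "\<kappa> 0 = 0"
  using \<kappa>_scaleR[OF subspace_0[OF subspace_W], of 0] by simp

lemma combination_in_W: "(\<Sum>b\<in>basis. c b *\<^sub>R b) \<in> W"
  by (intro subspace_sum subspace_scale subspace_W basis_in_W)

lemma in_W_E:
  assumes "w \<in> W"
  obtains c where "w = (\<Sum>b\<in>basis. c b *\<^sub>R b)"
proof -
  have "w \<in> range (\<lambda>c. \<Sum>b\<in>basis. c b *\<^sub>R b)"
    using assms by (simp only: span_finite[OF finite_basis, symmetric] span_basis)
  then show ?thesis using that by blast
qed

lemma \<kappa>_combination: "\<kappa> (\<Sum>b\<in>basis. c b *\<^sub>R b) = (\<Sum>b\<in>basis. c b *\<^sub>R \<kappa> b)"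
proof -
  have "\<kappa> (\<Sum>b\<in>S. c b *\<^sub>R b) = (\<Sum>b\<in>S. c b *\<^sub>R \<kappa> b)" if "finite S" "S \<subseteq> basis" for S
    using that
  proof (induction S rule: finite_induct)
    case (insert b S)
    have "(\<Sum>b\<in>S. c b *\<^sub>R b) \<in> W"
      using insert.prems by (intro subspace_sum subspace_scale subspace_W basis_in_W) auto
    moreover have "c b *\<^sub>R b \<in> W"
      using insert.prems by (intro subspace_scale subspace_W basis_in_W) auto
    ultimately show ?case
      using insert by (simp add: \<kappa>_add \<kappa>_scaleR basis_in_W)
  qed (simp add: \<kappa>_0)
  then show ?thesis using finite_basis by simp
qed

lemma \<kappa>_basis: "b \<in> basis \<Longrightarrow> c \<in> basis \<Longrightarrow> \<kappa> b \<bullet> \<kappa> c = (if b = c then 1 else 0)"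
  using h_\<kappa>[of b c] h_basis[of b c] basis_in_W by simp

lemma inj_on_\<kappa>_basis: "inj_on \<kappa> basis"
  by (rule inj_onI) (metis \<kappa>_basis one_neq_zero)

lemma coefficient: "b \<in> basis \<Longrightarrow> \<kappa> (\<Sum>b\<in>basis. c b *\<^sub>R b) \<bullet> \<kappa> b = c b"
proof -
  assume b: "b \<in> basis"
  have "\<kappa> (\<Sum>b\<in>basis. c b *\<^sub>R b) \<bullet> \<kappa> b = (\<Sum>a\<in>basis. if a = b then c a else 0)"
    unfolding \<kappa>_combination inner_sum_left by (rule sum.cong) (auto simp: \<kappa>_basis b)
  then show ?thesis using b finite_basis by simp
qed

lemma span_image_basis: "span image_basis = \<kappa> ` W"
proof
  have "span image_basis = range (\<lambda>u. \<Sum>v\<in>image_basis. u v *\<^sub>R v)"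
    using finite_basis by (intro span_finite) (simp add: image_basis_def)
  also have "\<dots> \<subseteq> \<kappa> ` W"
  proof safe
    fix u :: "'e \<Rightarrow> real"
    have "(\<Sum>v\<in>image_basis. u v *\<^sub>R v) = \<kappa> (\<Sum>b\<in>basis. u (\<kappa> b) *\<^sub>R b)"
      unfolding \<kappa>_combination image_basis_def by (simp add: sum.reindex inj_on_\<kappa>_basis)
    then show "(\<Sum>v\<in>image_basis. u v *\<^sub>R v) \<in> \<kappa> ` W"
      using combination_in_W by simp
  qed
  finally show "span image_basis \<subseteq> \<kappa> ` W" .
  show "\<kappa> ` W \<subseteq> span image_basis"
  proof safe
    fix w assume "w \<in> W"
    then obtain u where w: "w = (\<Sum>b\<in>basis. u b *\<^sub>R b)"
      by (rule in_W_E)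
    show "\<kappa> w \<in> span image_basis"
      unfolding w \<kappa>_combination image_basis_def
      by (intro span_sum span_scale span_base) simp
  qed
qed

lemma image_basis: "orthonormal_basis (\<bullet>) (\<kappa> ` W) image_basis"
  unfolding orthonormal_basis_def using finite_basis span_image_basis inj_on_\<kappa>_basis
  by (auto simp: image_basis_def \<kappa>_basis inj_on_eq_iff)

lemma dim_eq_card_basis: "dim W = card basis"
proof (rule dim_eq_card)
  show "independent basis"
  proof (rule independent_if_scalars_zero[OF finite_basis])
    fix c b assume "(\<Sum>b\<in>basis. c b *\<^sub>R b) = 0" "b \<in> basis"
    then show "c b = 0"
      using coefficient[of b c] by (simp add: \<kappa>_0)
  qed
qed (simp only: span_basis span_span, metis span_basis span_span)

lemma card_image_basis: "card image_basis = dim W"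
  by (simp add: image_basis_def card_image inj_on_\<kappa>_basis dim_eq_card_basis)

lemma lebesgue_of_eq:
  "lebesgue_of h W = embed_measure (\<Pi>\<^sub>M b\<in>basis. lborel) (\<lambda>c. \<Sum>b\<in>basis. c b *\<^sub>R b)"
  by (simp add: lebesgue_of_def basis_def Let_def)

lemma inj_on_combination:
  "inj_on (\<lambda>c. \<Sum>b\<in>basis. c b *\<^sub>R b) (space (\<Pi>\<^sub>M b\<in>basis. lborel :: real measure))"
proof (rule inj_onI)
  fix c d :: "'v \<Rightarrow> real"
  assume cd: "c \<in> space (\<Pi>\<^sub>M b\<in>basis. lborel)" "d \<in> space (\<Pi>\<^sub>M b\<in>basis. lborel)"
    and "(\<Sum>b\<in>basis. c b *\<^sub>R b) = (\<Sum>b\<in>basis. d b *\<^sub>R b)"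
  then have "c b = d b" if "b \<in> basis" for b
    using coefficient[OF that, of c] coefficient[OF that, of d] by simp
  then show "c = d"
    using cd by (auto simp: space_PiM intro: PiE_ext)
qed

lemma space_lebesgue_of: "space (lebesgue_of h W) = W"
proof -
  have "\<exists>c\<in>space (\<Pi>\<^sub>M b\<in>basis. lborel). w = (\<Sum>b\<in>basis. c b *\<^sub>R b)" if "w \<in> W" for w
  proof -
    obtain u where "w = (\<Sum>b\<in>basis. u b *\<^sub>R b)"
      using \<open>w \<in> W\<close> by (rule in_W_E)
    then show ?thesis
      by (intro bexI[of _ "restrict u basis"]) (auto simp: space_PiM)
  qed
  then show ?thesis
    unfolding lebesgue_of_eq space_embed_measure using combination_in_W by auto
qed

lemma measurable_\<kappa>: "\<kappa> \<in> borel_measurable (lebesgue_of h W)"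
  unfolding lebesgue_of_eq by (rule measurable_embed_measure1) (simp add: \<kappa>_combination)

lemma nn_integral_lebesgue_of:
  assumes f [measurable]: "f \<in> borel_measurable borel"
  shows "(\<integral>\<^sup>+w. f (\<kappa> w) \<partial>lebesgue_of h W) = (\<integral>\<^sup>+x. f x \<partial>coord_lebesgue image_basis)"
proof -
  have "(\<lambda>w. f (\<kappa> w)) \<in> borel_measurable (lebesgue_of h W)"
    by (rule measurable_compose[OF measurable_\<kappa> f])
  then have "(\<integral>\<^sup>+w. f (\<kappa> w) \<partial>lebesgue_of h W)
      = (\<integral>\<^sup>+c. f (\<kappa> (\<Sum>b\<in>basis. c b *\<^sub>R b)) \<partial>(\<Pi>\<^sub>M b\<in>basis. lborel))"
    unfolding lebesgue_of_eq by (rule nn_integral_embed_measure'[OF inj_on_combination])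
  also have "\<dots> = (\<integral>\<^sup>+x. f x \<partial>coord_lebesgue image_basis)"
    unfolding image_basis_def \<kappa>_combination
    by (rule nn_integral_coord_lebesgue_image[symmetric, OF inj_on_\<kappa>_basis finite_basis f])
  finally show ?thesis .
qed

lemma norm_\<kappa>: "w \<in> W \<Longrightarrow> sqrt (h w w) = norm (\<kappa> w)"
  by (simp add: h_\<kappa> norm_eq_sqrt_inner)

lemma measurable_normalize: "(\<lambda>w. w /\<^sub>R sqrt (h w w)) \<in> measurable (lebesgue_of h W) (lebesgue_of h W)"
proof -
  let ?P = "\<Pi>\<^sub>M b\<in>basis. lborel :: real measure" and ?F = "\<lambda>c. \<Sum>b\<in>basis. c b *\<^sub>R b"
  let ?r = "\<lambda>c. \<lambda>b\<in>basis. c b / norm (\<Sum>b\<in>basis. c b *\<^sub>R \<kappa> b)"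
  have "?r \<in> measurable ?P ?P"
    by (intro measurable_restrict) measurable
  moreover have "?F \<in> measurable ?P (embed_measure ?P ?F)"
    by (rule measurable_embed_measure2'[OF inj_on_combination])
  ultimately have "(\<lambda>c. ?F (?r c)) \<in> measurable ?P (embed_measure ?P ?F)"
    by (rule measurable_compose)
  moreover have "?F (?r c) = ?F c /\<^sub>R sqrt (h (?F c) (?F c))" for c
    by (simp add: norm_\<kappa> combination_in_W \<kappa>_combination scaleR_sum_right divide_inverse mult.commute)
  ultimately have "(\<lambda>c. ?F c /\<^sub>R sqrt (h (?F c) (?F c))) \<in> measurable ?P (embed_measure ?P ?F)"
    by simp
  then show ?thesis
    unfolding lebesgue_of_eq by (rule measurable_embed_measure1)
qed

lemma space_sphere_area: "space (sphere_area h W) = unit_sphere h W"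
  by (auto simp: sphere_area_def space_scale_measure space_restrict_space space_lebesgue_of unit_sphere_def)

lemma measurable_sphere_area:
  assumes f: "f \<in> borel_measurable borel" and Ff: "\<And>w. w \<in> unit_sphere h W \<Longrightarrow> F w = f (\<kappa> w)"
  shows "F \<in> borel_measurable (sphere_area h W)"
proof -
  have "(\<lambda>w. f (\<kappa> w)) \<in> borel_measurable (restrict_space (lebesgue_of h W) (unit_sphere h W))"
    by (intro measurable_restrict_space1 measurable_compose[OF measurable_\<kappa> f])
  then have "(\<lambda>w. f (\<kappa> w)) \<in> borel_measurable (sphere_area h W)"
    unfolding sphere_area_def measurable_def by (simp add: space_scale_measure)
  then show ?thesis
    using Ff by (subst measurable_cong) (auto simp: space_sphere_area)
qed

text \<open>Areas on the sphere are by definition volumes of cones in the unit ball, so a function on the sphere is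
integrated by extending it to the punctured ball constantly along rays.\<close>

theorem nn_integral_sphere_area:
  fixes f :: "'e \<Rightarrow> ennreal"
  assumes f [measurable]: "f \<in> borel_measurable borel" and Ff: "\<And>w. w \<in> unit_sphere h W \<Longrightarrow> F w = f (\<kappa> w)"
  shows "(\<integral>\<^sup>+w. F w \<partial>sphere_area h W)
    = of_nat (dim W) * (\<integral>\<^sup>+x. f (x /\<^sub>R norm x) * indicator (cball 0 1 - {0}) x \<partial>coord_lebesgue image_basis)"
proof -
  let ?L = "lebesgue_of h W"
  let ?S1 = "{w \<in> W. 0 < sqrt (h w w) \<and> sqrt (h w w) \<le> 1}" and ?S2 = "unit_sphere h W"
  let ?\<nu> = "\<lambda>w. w /\<^sub>R sqrt (h w w)"
  have S1: "w \<in> ?S1 \<longleftrightarrow> w \<in> W \<and> \<kappa> w \<in> cball 0 1 - {0}" for w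
    by (auto simp: norm_\<kappa> simp del: real_sqrt_gt_0_iff real_sqrt_le_1_iff)
  have S1_sets: "?S1 \<inter> space ?L \<in> sets ?L"
  proof -
    have "?S1 \<inter> space ?L = \<kappa> -` (cball 0 1 - {0}) \<inter> space ?L"
      by (intro set_eqI) (simp only: Int_iff S1 vimage_eq space_lebesgue_of, blast)
    also have "\<dots> \<in> sets ?L"
      by (rule measurable_sets[OF measurable_\<kappa>]) auto
    finally show ?thesis .
  qed
  have \<kappa>\<nu>: "\<kappa> (?\<nu> w) = \<kappa> w /\<^sub>R norm (\<kappa> w)" if "w \<in> W" for w
    using that by (simp add: \<kappa>_scaleR norm_\<kappa>)
  have \<nu>_sphere: "?\<nu> w \<in> ?S2" if "w \<in> ?S1" for w
  proof -
    have w: "w \<in> W" "\<kappa> w \<noteq> 0" using that S1 by auto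
    have \<nu>W: "?\<nu> w \<in> W" using w by (intro subspace_scale subspace_W)
    have "sqrt (h (?\<nu> w) (?\<nu> w)) = 1"
      unfolding norm_\<kappa>[OF \<nu>W] \<kappa>\<nu>[OF w(1)] using w(2) by simp
    then show ?thesis
      using \<nu>W by (simp only: unit_sphere_def mem_Collect_eq)
  qed
  have meas: "?\<nu> \<in> measurable (restrict_space ?L ?S1) (restrict_space ?L ?S2)"
    by (intro measurable_restrict_space2 measurable_restrict_space1 measurable_normalize)
       (auto simp: space_restrict_space intro!: \<nu>_sphere)
  have F: "F \<in> borel_measurable (restrict_space ?L ?S2)"
    using measurable_sphere_area[OF f Ff] unfolding sphere_area_def measurable_def
    by (simp add: space_scale_measure)
  have "(\<integral>\<^sup>+w. F w \<partial>sphere_area h W) = of_nat (dim W) * (\<integral>\<^sup>+w. F (?\<nu> w) \<partial>restrict_space ?L ?S1)"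
    unfolding sphere_area_def
    by (subst nn_integral_scale_measure)
       (use F in \<open>simp_all only: nn_integral_distr[OF meas] measurable_distr_eq1\<close>)
  also have "(\<integral>\<^sup>+w. F (?\<nu> w) \<partial>restrict_space ?L ?S1) = (\<integral>\<^sup>+w. F (?\<nu> w) * indicator ?S1 w \<partial>?L)"
    by (rule nn_integral_restrict_space[OF S1_sets])
  also have "\<dots> = (\<integral>\<^sup>+w. f (\<kappa> w /\<^sub>R norm (\<kappa> w)) * indicator (cball 0 1 - {0}) (\<kappa> w) \<partial>?L)"
  proof (rule nn_integral_cong)
    fix w assume "w \<in> space ?L"
    then have w: "w \<in> W" by (simp add: space_lebesgue_of)
    show "F (?\<nu> w) * indicator ?S1 w = f (\<kappa> w /\<^sub>R norm (\<kappa> w)) * indicator (cball 0 1 - {0}) (\<kappa> w)"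
    proof (cases "w \<in> ?S1")
      case True
      then have "F (?\<nu> w) = f (\<kappa> w /\<^sub>R norm (\<kappa> w))"
        using Ff[OF \<nu>_sphere[OF True]] by (simp only: \<kappa>\<nu>[OF w])
      moreover have "\<kappa> w \<in> cball 0 1 - {0}"
        using True S1 by blast
      ultimately show ?thesis
        using True by (simp only: indicator_simps)
    next
      case False
      then have "\<kappa> w \<notin> cball 0 1 - {0}"
        using w S1 by blast
      then show ?thesis
        using False by (simp only: indicator_simps not_False_eq_True mult_zero_right)
    qed
  qed
  also have "\<dots> = (\<integral>\<^sup>+x. f (x /\<^sub>R norm x) * indicator (cball 0 1 - {0}) x \<partial>coord_lebesgue image_basis)"
    by (rule nn_integral_lebesgue_of) (auto intro!: borel_measurable_times_ennreal borel_measurable_indicator)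
  finally show ?thesis .
qed

end

section \<open>Calculus of functions of class \<open>C\<^sup>k\<close>\<close>

lemma frechet_derivative_works': "f differentiable at x \<Longrightarrow> (f has_derivative frechet_derivative f (at x)) (at x)"
  by (simp add: frechet_derivative_works)

lemma Ck_on_cong:
  assumes "open S" "\<And>x. x \<in> S \<Longrightarrow> f x = g x" "Ck_on k S f"
  shows "Ck_on k S g"
  using assms
proof (induction k arbitrary: f g)
  case 0
  then show ?case by (simp cong: continuous_on_cong)
next
  case (Suc k)
  have f: "\<And>x. x \<in> S \<Longrightarrow> f differentiable (at x)"
      "\<And>w. Ck_on k S (\<lambda>x. frechet_derivative f (at x) w)"
    using Suc.prems(3) by simp_all
  have g: "(g has_derivative frechet_derivative f (at x)) (at x)" if "x \<in> S" for x
    by (rule has_derivative_transform_within_open[OF frechet_derivative_works'[OF f(1)[OF that]]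
          Suc.prems(1) that Suc.prems(2)])
  have eq: "frechet_derivative f (at x) w = frechet_derivative g (at x) w" if "x \<in> S" for x w
    using frechet_derivative_at[OF g[OF that]] by (rule fun_cong)
  have "Ck_on k S (\<lambda>x. frechet_derivative g (at x) w)" for w
    by (rule Suc.IH[OF Suc.prems(1) eq f(2)])
  moreover have "g differentiable (at x)" if "x \<in> S" for x
    using g[OF that] by (rule differentiableI)
  ultimately show ?case by simp
qed

lemma Ck_on_SucI:
  assumes S: "open S" and der: "\<And>x. x \<in> S \<Longrightarrow> (f has_derivative f' x) (at x)"
    and Ck: "\<And>w. Ck_on k S (\<lambda>x. f' x w)"
  shows "Ck_on (Suc k) S f"
proof -
  have eq: "f' x w = frechet_derivative f (at x) w" if "x \<in> S" for x w
    using frechet_derivative_at[OF der[OF that]] by (rule fun_cong)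
  have "Ck_on k S (\<lambda>x. frechet_derivative f (at x) w)" for w
    by (rule Ck_on_cong[OF S eq Ck])
  moreover have "f differentiable (at x)" if "x \<in> S" for x
    using der[OF that] by (rule differentiableI)
  ultimately show ?thesis
    by simp
qed

lemma Ck_on_SucD:
  assumes "Ck_on (Suc k) S f"
  shows "\<And>x. x \<in> S \<Longrightarrow> (f has_derivative frechet_derivative f (at x)) (at x)"
    and "\<And>w. Ck_on k S (\<lambda>x. frechet_derivative f (at x) w)"
  using assms by (auto intro: frechet_derivative_works')

lemma Ck_on_subset: "Ck_on k S f \<Longrightarrow> T \<subseteq> S \<Longrightarrow> Ck_on k T f"
  by (induction k arbitrary: f) (auto intro: continuous_on_subset)

lemma Ck_on_SucD_Ck: "Ck_on (Suc k) S f \<Longrightarrow> Ck_on k S f"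
proof (induction k arbitrary: f)
  case 0
  then show ?case
    by (auto intro!: continuous_at_imp_continuous_on differentiable_imp_continuous_within)
next
  case (Suc k)
  then show ?case by auto
qed

lemma Ck_on_imp_continuous_on: "Ck_on k S f \<Longrightarrow> continuous_on S f"
  by (induction k) (simp, blast intro: Ck_on_SucD_Ck)

lemma Ck_on_const: "open S \<Longrightarrow> Ck_on k S (\<lambda>x. c)"
proof (induction k arbitrary: c)
  case (Suc k)
  then show ?case
    by (intro Ck_on_SucI[where f' = "\<lambda>x w. 0"]) auto
qed simp

lemma Ck_on_bounded_linear:
  assumes L: "bounded_linear L" and S: "open S" and f: "Ck_on k S f"
  shows "Ck_on k S (\<lambda>x. L (f x))"
  using f
proof (induction k arbitrary: f)
  case 0
  then show ?case
    by (simp add: bounded_linear.continuous_on[OF L])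
next
  case (Suc k)
  show ?case
    by (rule Ck_on_SucI[OF S bounded_linear.has_derivative[OF L Ck_on_SucD(1)[OF Suc.prems]]
          Suc.IH[OF Ck_on_SucD(2)[OF Suc.prems]]])
qed

lemma Ck_on_add:
  assumes S: "open S" and "Ck_on k S f" "Ck_on k S g"
  shows "Ck_on k S (\<lambda>x. f x + g x)"
  using assms(2-)
proof (induction k arbitrary: f g)
  case 0
  then show ?case by (auto intro: continuous_intros)
next
  case (Suc k)
  show ?case
    by (rule Ck_on_SucI[OF S has_derivative_add[OF Ck_on_SucD(1)[OF Suc.prems(1)] Ck_on_SucD(1)[OF Suc.prems(2)]]
          Suc.IH[OF Ck_on_SucD(2)[OF Suc.prems(1)] Ck_on_SucD(2)[OF Suc.prems(2)]]])
qed

lemma Ck_on_sum: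
  assumes S: "open S" and "\<And>i. i \<in> I \<Longrightarrow> Ck_on k S (f i)"
  shows "Ck_on k S (\<lambda>x. \<Sum>i\<in>I. f i x)"
  using assms(2)
  by (induction I rule: infinite_finite_induct) (auto intro: Ck_on_const Ck_on_add S)

lemma Ck_on_mult:
  fixes f g :: "'a::real_normed_vector \<Rightarrow> real"
  assumes S: "open S" and "Ck_on k S f" "Ck_on k S g"
  shows "Ck_on k S (\<lambda>x. f x * g x)"
  using assms(2-)
proof (induction k arbitrary: f g)
  case 0
  then show ?case by (auto intro: continuous_intros)
next
  case (Suc k)
  show ?case
    by (rule Ck_on_SucI[OF S has_derivative_mult[OF Ck_on_SucD(1)[OF Suc.prems(1)] Ck_on_SucD(1)[OF Suc.prems(2)]]])
       (assumption+, intro Ck_on_add S Suc.IH Ck_on_SucD(2) Suc.prems Ck_on_SucD_Ck)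
qed

lemma Ck_on_prod:
  fixes f :: "'i \<Rightarrow> 'a::real_normed_vector \<Rightarrow> real"
  assumes S: "open S" and "\<And>i. i \<in> I \<Longrightarrow> Ck_on k S (f i)"
  shows "Ck_on k S (\<lambda>x. \<Prod>i\<in>I. f i x)"
  using assms(2)
  by (induction I rule: infinite_finite_induct) (auto intro: Ck_on_const Ck_on_mult S)

lemma Ck_on_inverse:
  fixes f :: "'a::real_normed_vector \<Rightarrow> real"
  assumes S: "open S" and "Ck_on k S f" and nz: "\<And>x. x \<in> S \<Longrightarrow> f x \<noteq> 0"
  shows "Ck_on k S (\<lambda>x. inverse (f x))"
  using assms(2)
proof (induction k)
  case 0
  then show ?case using nz by (auto intro!: continuous_intros)
next
  case (Suc k)
  note IH = Suc.IH[OF Ck_on_SucD_Ck[OF Suc.prems]]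
  show ?case
  proof (rule Ck_on_SucI[OF S])
    show "((\<lambda>x. inverse (f x)) has_derivative
        (\<lambda>w. (-1) * (inverse (f x) * (frechet_derivative f (at x) w * inverse (f x))))) (at x)" if "x \<in> S" for x
      using Deriv.has_derivative_inverse[OF nz[OF that] Ck_on_SucD(1)[OF Suc.prems that]]
      by (simp add: mult.assoc)
    show "Ck_on k S (\<lambda>x. (-1) * (inverse (f x) * (frechet_derivative f (at x) w * inverse (f x))))" for w
      by (intro Ck_on_mult Ck_on_const S IH Ck_on_SucD(2)[OF Suc.prems])
  qed
qed

lemma Ck_on_det:
  fixes A :: "'a::real_normed_vector \<Rightarrow> real^'i::finite^'i"
  assumes S: "open S" and A: "\<And>i j. Ck_on k S (\<lambda>x. A x $ i $ j)"
  shows "Ck_on k S (\<lambda>x. det (A x))"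
  unfolding det_def by (intro Ck_on_sum Ck_on_mult Ck_on_prod Ck_on_const S A)

lemma Ck_on_component: "open S \<Longrightarrow> Ck_on k S f \<Longrightarrow> Ck_on k S (\<lambda>x. f x $ i)"
  by (rule Ck_on_bounded_linear[OF bounded_linear_vec_nth])

text \<open>The derivative of \<open>f \<circ> g\<close> is a sum of products of components of the derivative of \<open>g\<close> with functions
\<open>\<partial>\<^sub>j f \<circ> g\<close>, to which the induction hypothesis applies.\<close>

lemma Ck_on_compose:
  fixes f :: "real^'j::finite \<Rightarrow> real" and g :: "'a::real_normed_vector \<Rightarrow> real^'j"
  assumes S: "open S" and T: "open T" and g: "Ck_on k S g" and gS: "g ` S \<subseteq> T" and f: "Ck_on k T f"
  shows "Ck_on k S (\<lambda>x. f (g x))"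
  using g f
proof (induction k arbitrary: f)
  case 0
  then show ?case using gS by (auto intro: continuous_on_compose2)
next
  case (Suc k)
  let ?Df = "\<lambda>y. frechet_derivative f (at y)" and ?Dg = "\<lambda>x. frechet_derivative g (at x)"
  have expand: "?Df y w = (\<Sum>j\<in>UNIV. ?Df y (axis j 1) * w $ j)" if "y \<in> T" for y w
  proof -
    have lin: "linear (?Df y)"
      using Ck_on_SucD(1)[OF Suc.prems(2) that] has_derivative_linear by blast
    have "?Df y w = ?Df y (\<Sum>j\<in>UNIV. w $ j *\<^sub>R axis j 1)"
      by (simp add: basis_expansion[of w, unfolded scalar_mult_eq_scaleR])
    also have "\<dots> = (\<Sum>j\<in>UNIV. w $ j * ?Df y (axis j 1))"
      using lin by (simp add: linear_sum linear_cmul)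
    finally show ?thesis by (simp add: mult.commute)
  qed
  show ?case
  proof (rule Ck_on_SucI[OF S])
    fix x assume x: "x \<in> S"
    then have gx: "g x \<in> T" using gS by auto
    have "(f \<circ> g has_derivative ?Df (g x) \<circ> ?Dg x) (at x)"
      by (rule diff_chain_at[OF Ck_on_SucD(1)[OF Suc.prems(1) x] Ck_on_SucD(1)[OF Suc.prems(2) gx]])
    moreover have "?Df (g x) \<circ> ?Dg x = (\<lambda>w. \<Sum>j\<in>UNIV. ?Df (g x) (axis j 1) * ?Dg x w $ j)"
      by (rule ext, unfold comp_apply) (rule expand[OF gx])
    ultimately show "((\<lambda>x. f (g x)) has_derivative (\<lambda>w. \<Sum>j\<in>UNIV. ?Df (g x) (axis j 1) * ?Dg x w $ j)) (at x)"
      by (simp add: comp_def)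
  next
    fix w
    have "Ck_on k S (\<lambda>x. ?Df (g x) (axis j 1))" for j
      by (rule Suc.IH[OF Ck_on_SucD_Ck[OF Suc.prems(1)] Ck_on_SucD(2)[OF Suc.prems(2)]])
    then show "Ck_on k S (\<lambda>x. \<Sum>j\<in>UNIV. ?Df (g x) (axis j 1) * ?Dg x w $ j)"
      by (intro Ck_on_sum Ck_on_mult S Ck_on_component Ck_on_SucD(2)[OF Suc.prems(1)])
  qed
qed

lemma smooth_on_imp_Ck_on: "smooth_on S f \<Longrightarrow> Ck_on k S f"
  by (simp add: smooth_on_def)

lemma smooth_on_compose:
  fixes f :: "real^'j::finite \<Rightarrow> real" and g :: "'a::real_normed_vector \<Rightarrow> real^'j"
  assumes "open S" "open T" "smooth_on S g" "g ` S \<subseteq> T" "smooth_on T f"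
  shows "smooth_on S (\<lambda>x. f (g x))"
  using assms by (auto simp: smooth_on_def intro: Ck_on_compose)

lemma smooth_on_derivative: "smooth_on S f \<Longrightarrow> smooth_on S (\<lambda>x. frechet_derivative f (at x) w)"
  unfolding smooth_on_def by (metis Ck_on.simps(2))

lemma smooth_on_cong: "open S \<Longrightarrow> (\<And>x. x \<in> S \<Longrightarrow> f x = g x) \<Longrightarrow> smooth_on S f \<Longrightarrow> smooth_on S g"
  by (auto simp: smooth_on_def intro: Ck_on_cong)

lemma smooth_on_has_derivative:
  "smooth_on S f \<Longrightarrow> x \<in> S \<Longrightarrow> (f has_derivative frechet_derivative f (at x)) (at x)"
  using Ck_on_SucD(1) smooth_on_imp_Ck_on by blast

section \<open>Counting points in fibres\<close>

text \<open>Half the distance to the nearest other point is a radius for which the balls are disjoint.\<close>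

lemma finite_separated_by_family:
  fixes T :: "'x::metric_space set"
  assumes T: "finite T" and Q: "\<And>x e. x \<in> T \<Longrightarrow> 0 < e \<Longrightarrow> \<exists>q\<in>\<Q>. x \<in> q \<and> q \<subseteq> ball x e"
  obtains q where "\<And>x. x \<in> T \<Longrightarrow> q x \<in> \<Q> \<and> x \<in> q x" "inj_on q T" "disjoint (q ` T)"
proof -
  have "\<exists>d. \<forall>x\<in>T. 0 < d x \<and> (\<forall>y\<in>T. y \<noteq> x \<longrightarrow> d x \<le> dist x y)"
    by (rule bchoice) (use finite_set_avoid[OF T] in blast)
  then obtain d where d: "\<And>x. x \<in> T \<Longrightarrow> 0 < d x" "\<And>x y. x \<in> T \<Longrightarrow> y \<in> T \<Longrightarrow> y \<noteq> x \<Longrightarrow> d x \<le> dist x y"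
    by blast
  have "\<exists>q. \<forall>x\<in>T. q x \<in> \<Q> \<and> x \<in> q x \<and> q x \<subseteq> ball x (d x / 2)"
    by (rule bchoice) (use Q d(1) half_gt_zero in blast)
  then obtain q where q: "\<And>x. x \<in> T \<Longrightarrow> q x \<in> \<Q> \<and> x \<in> q x \<and> q x \<subseteq> ball x (d x / 2)"
    by blast
  have sep: "q x \<inter> q y = {}" if xy: "x \<in> T" "y \<in> T" "x \<noteq> y" for x y
  proof (rule ccontr)
    assume "q x \<inter> q y \<noteq> {}"
    then obtain z where "z \<in> ball x (d x / 2)" "z \<in> ball y (d y / 2)"
      using q xy by blast
    then have "dist x z + dist y z < d x / 2 + d y / 2"
      by simp
    moreover have "dist x y \<le> dist x z + dist y z"
      by (rule dist_triangle2)
    moreover have "d x \<le> dist x y" "d y \<le> dist x y"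
      using d(2)[OF xy(1,2)] d(2)[OF xy(2,1)] xy(3) by (auto simp: dist_commute)
    ultimately show False by linarith
  qed
  show ?thesis
  proof
    show "q x \<in> \<Q> \<and> x \<in> q x" if "x \<in> T" for x
      using q that by blast
    show "inj_on q T"
      using sep q by (intro inj_onI) blast
    show "disjoint (q ` T)"
      unfolding pairwise_image
      using sep by (auto simp: pairwise_def disjnt_def)
  qed
qed

text \<open>A finite family of disjoint sets that all meet the fibre bounds the number of its points from below,
and small enough sets around the points attain it.  So the number of points is the supremum, over the
countably many finite disjoint families of closures of basic open sets, of the number of members that
meet the fibre.  The set of \<open>v\<close> whose fibre meets a given member is a countable union of projections of
closed sets along compact sets, since \<open>B\<close> is \<open>\<sigma>\<close>-compact, and therefore a Borel set.\<close>

lemma borel_measurable_count_fibre: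
  fixes Z :: "('x::euclidean_space \<times> 'v::euclidean_space) set"
  assumes B: "fsigma B" and Z: "\<And>K. compact K \<Longrightarrow> K \<subseteq> B \<Longrightarrow> closed (K \<times> UNIV \<inter> Z)"
  shows "(\<lambda>v. emeasure (count_space UNIV) {x \<in> B. (x, v) \<in> Z}) \<in> borel_measurable borel"
proof -
  obtain K :: "nat \<Rightarrow> 'x set" where "range K \<subseteq> Collect compact" and KB: "B = \<Union>(range K)"
    using B unfolding fsigma_Union_compact by (elim exE conjE)
  then have K: "compact (K j)" "K j \<subseteq> B" for j
    by auto
  obtain \<B> :: "'x set set" where \<B>: "countable \<B>" "topological_basis \<B>"
    using ex_countable_basis by blast
  define \<Q> where "\<Q> = closure ` \<B>"
  have Q_small: "\<exists>q\<in>\<Q>. x \<in> q \<and> q \<subseteq> ball x e" if e: "0 < e" for x e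
  proof -
    obtain b where b: "b \<in> \<B>" "x \<in> b" "b \<subseteq> ball x (e / 2)"
      using topological_basisE[OF \<B>(2) open_ball, of x x "e / 2"] e by auto
    have "closure b \<subseteq> cball x (e / 2)"
      using b(3) by (intro closure_minimal) auto
    also have "\<dots> \<subseteq> ball x e"
      using e by auto
    finally show ?thesis
      using b by (intro bexI[of _ "closure b"]) (auto simp: \<Q>_def intro: closure_subset[THEN subsetD])
  qed
  define P where "P = (\<lambda>q. {v. \<exists>x\<in>q \<inter> B. (x, v) \<in> Z})"
  have P [measurable]: "P q \<in> sets borel" if "q \<in> \<Q>" for q
  proof -
    have "closed q" using that by (auto simp: \<Q>_def)
    have "closed {v. \<exists>x. x \<in> q \<inter> K j \<and> (x, v) \<in> (q \<inter> K j) \<times> UNIV \<inter> Z}" for j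
    proof (rule closed_compact_projection)
      show "compact (q \<inter> K j)"
        using \<open>closed q\<close> K(1) by (rule closed_Int_compact)
      then show "closed ((q \<inter> K j) \<times> UNIV \<inter> Z)"
        by (rule Z) (use K(2)[of j] in auto)
    qed
    moreover have "P q = (\<Union>j. {v. \<exists>x. x \<in> q \<inter> K j \<and> (x, v) \<in> (q \<inter> K j) \<times> UNIV \<inter> Z})"
      unfolding P_def KB by auto
    ultimately show ?thesis by auto
  qed
  define \<F> where "\<F> = {F. finite F \<and> F \<subseteq> \<Q> \<and> disjoint F}"
  have "countable \<F>"
  proof (rule countable_subset)
    show "countable {F. finite F \<and> F \<subseteq> \<Q>}"
      using \<B>(1) by (intro countable_Collect_finite_subset) (simp add: \<Q>_def)
  qed (auto simp: \<F>_def)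
  define N where "N = (\<lambda>v. emeasure (count_space UNIV) {x \<in> B. (x, v) \<in> Z})"
  define M where "M = (\<lambda>v. SUP F\<in>\<F>. \<Sum>q\<in>F. indicator (P q) v :: ennreal)"
  have "N v \<le> M v" for v
  proof -
    have lower: "of_nat (card T) \<le> M v" if T: "finite T" "T \<subseteq> {x \<in> B. (x, v) \<in> Z}" for T
    proof -
      obtain q where q: "\<And>x. x \<in> T \<Longrightarrow> q x \<in> \<Q> \<and> x \<in> q x" "inj_on q T" "disjoint (q ` T)"
        using finite_separated_by_family[OF T(1), of \<Q>] Q_small by blast
      have "q ` T \<in> \<F>"
        using q T(1) by (auto simp: \<F>_def)
      have "of_nat (card T) = (\<Sum>x\<in>T. indicator (P (q x)) v :: ennreal)"
      proof -
        have "v \<in> P (q x)" if "x \<in> T" for x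
          using T(2) q(1)[OF that] that by (auto simp: P_def)
        then show ?thesis by simp
      qed
      also have "\<dots> = (\<Sum>q\<in>q ` T. indicator (P q) v)"
        using q(2) by (simp add: sum.reindex)
      also have "\<dots> \<le> M v"
        unfolding M_def by (rule SUP_upper) fact
      finally show ?thesis .
    qed
    show ?thesis
    proof (cases "finite {x \<in> B. (x, v) \<in> Z}")
      case True
      then show ?thesis
        using lower[OF True] by (simp add: N_def emeasure_count_space)
    next
      case False
      have "M v = top"
      proof (rule ccontr)
        assume "M v \<noteq> top"
        then obtain n where n: "M v < of_nat n"
          using ennreal_Ex_less_of_nat[of "M v"] by (auto simp: less_top)
        obtain T where "finite T" "card T = n" "T \<subseteq> {x \<in> B. (x, v) \<in> Z}"
          using infinite_arbitrarily_large[OF False] by blast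
        then show False
          using lower[of T] n by simp
      qed
      then show ?thesis by simp
    qed
  qed
  moreover have "M v \<le> N v" for v
    unfolding M_def
  proof (rule SUP_least)
    fix F assume F: "F \<in> \<F>"
    define F' where "F' = {q \<in> F. v \<in> P q}"
    have finF: "finite F" "finite F'" using F by (auto simp: \<F>_def F'_def)
    have "\<exists>x. \<forall>q\<in>F'. x q \<in> q \<inter> {x \<in> B. (x, v) \<in> Z}"
      by (rule bchoice) (auto simp: F'_def P_def)
    then obtain x where x: "\<And>q. q \<in> F' \<Longrightarrow> x q \<in> q \<inter> {x \<in> B. (x, v) \<in> Z}"
      by blast
    have inj: "inj_on x F'"
    proof (rule inj_onI)
      fix q r assume qr: "q \<in> F'" "r \<in> F'" "x q = x r"
      then have "x q \<in> q \<inter> r" using x[of q] x[of r] by auto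
      moreover have "disjoint F" using F by (simp add: \<F>_def)
      ultimately show "q = r"
        using qr(1,2) unfolding F'_def pairwise_def disjnt_def by blast
    qed
    have "(\<Sum>q\<in>F. indicator (P q) v :: ennreal) = (\<Sum>q\<in>F'. 1)"
      unfolding F'_def by (subst sum.inter_filter[OF finF(1)]) (rule sum.cong, simp_all only: indicator_def of_bool_def)
    also have "\<dots> = of_nat (card (x ` F'))"
      using inj by (simp add: card_image)
    also have "\<dots> = emeasure (count_space UNIV) (x ` F')"
      using finF(2) by (simp add: emeasure_count_space)
    also have "\<dots> \<le> N v"
      unfolding N_def using x by (intro emeasure_mono) auto
    finally show "(\<Sum>q\<in>F. indicator (P q) v) \<le> N v" .
  qed
  ultimately have "N = M"
    by (intro ext antisym)
  moreover have "M \<in> borel_measurable borel"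
    unfolding M_def using \<open>countable \<F>\<close>
    by (intro borel_measurable_SUP borel_measurable_sum borel_measurable_indicator P) (auto simp: \<F>_def)
  ultimately show ?thesis
    by (simp add: N_def)
qed

section \<open>Integration along the kernel of a linear map\<close>

lemma nn_integral_coord_lebesgue_cong:
  assumes E: "finite E" and [measurable]: "f \<in> borel_measurable borel" "g \<in> borel_measurable borel"
    and eq: "\<And>x. x \<in> span E \<Longrightarrow> f x = g x"
  shows "(\<integral>\<^sup>+x. f x \<partial>coord_lebesgue E) = (\<integral>\<^sup>+x. g x \<partial>coord_lebesgue E)"
proof -
  have "f (\<Sum>b\<in>E. c b *\<^sub>R b) = g (\<Sum>b\<in>E. c b *\<^sub>R b)" for c
    by (intro eq span_sum span_scale span_base)
  then show ?thesis
    unfolding coord_lebesgue_def by (subst (1 2) nn_integral_distr) auto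
qed

lemma transpose_inner: "(transpose A *v y) \<bullet> x = y \<bullet> (A *v x)" for A :: "real^'n::finite^'m::finite"
  by (metis dot_lmul_matrix inner_commute vector_transpose_matrix transpose_transpose)

text \<open>The map \<open>v \<mapsto> v - \<xi> A v\<close> is the projection onto \<open>ker A\<close> along the range of \<open>\<xi>\<close>.  Write \<open>v = z + w\<close> with
\<open>z\<close> orthogonal to \<open>ker A\<close> and \<open>w \<in> ker A\<close>.  Then \<open>A v = A z\<close>, and the projection of \<open>v\<close> is \<open>w\<close> plus a
vector of \<open>ker A\<close> that depends on \<open>z\<close> only; by translation invariance the integral over \<open>w\<close> is \<open>\<integral>\<phi>\<close> for
every \<open>z\<close>.  There remains \<open>\<integral>\<rho>(A z) dz = 1 / |det M|\<close>, where \<open>M\<close> is the matrix of \<open>A\<close> in an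
orthonormal basis of the complement, and \<open>M M\<^sup>T = A A\<^sup>T\<close>.\<close>

theorem nn_integral_transversal_kernel:
  fixes A :: "real^'n::finite^'m::finite" and \<xi> :: "real^'m^'n"
  assumes A\<xi>: "A ** \<xi> = mat 1"
    and E: "orthonormal_basis (\<bullet>) {v. A *v v = 0} E"
    and \<phi> [measurable]: "\<phi> \<in> borel_measurable borel" and \<rho> [measurable]: "\<rho> \<in> borel_measurable borel"
    and \<rho>1: "(\<integral>\<^sup>+y. \<rho> y \<partial>lborel) = 1"
  shows "0 < det (A ** transpose A)"
    and "card E + CARD('m) = CARD('n)"
    and "(\<integral>\<^sup>+v. \<rho> (A *v v) * \<phi> (v - \<xi> *v (A *v v)) \<partial>lborel)
      = ennreal (1 / sqrt (det (A ** transpose A))) * (\<integral>\<^sup>+w. \<phi> w \<partial>coord_lebesgue E)"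
proof -
  let ?T = "transpose A"
  note transpose_matrix_vector [simp del]
  have A\<xi>': "A *v (\<xi> *v y) = y" for y
    by (simp add: matrix_vector_mul_assoc A\<xi>)
  have T_norm: "y \<bullet> (A *v (?T *v y)) = norm (?T *v y) ^ 2" for y
    by (simp add: transpose_inner[symmetric] power2_norm_eq_inner)
  have T_inj: "y = 0" if "?T *v y = 0" for y
    using transpose_inner[of A y "\<xi> *v y"] that by (simp add: A\<xi>')
  have AT_inj: "y = 0" if "A *v (?T *v y) = 0" for y
    using T_norm[of y] that T_inj[of y] by simp
  have inv: "invertible (A ** ?T)"
    unfolding invertible_left_inverse matrix_left_invertible_ker
    using AT_inj by (auto simp: matrix_vector_mul_assoc[symmetric])
  obtain C where C: "C \<subseteq> range ((*v) ?T)" "pairwise orthogonal C" "\<And>x. x \<in> C \<Longrightarrow> norm x = 1"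
    "independent C" "card C = dim (range ((*v) ?T))" "span C = range ((*v) ?T)"
    using orthonormal_basis_subspace[of "range ((*v) ?T)"]
    by (metis linear_subspace_image matrix_vector_mul_linear subspace_UNIV)
  have finC: "finite C"
    using C(4) by (rule independent_imp_finite)
  have inj_T: "inj ((*v) ?T)"
    unfolding linear_injective_0[OF matrix_vector_mul_linear] using T_inj by auto
  have cardC: "card C = CARD('m)"
  proof -
    have "dim (range ((*v) ?T)) = dim (UNIV :: (real^'m) set)"
      by (rule dim_image_eq[OF matrix_vector_mul_linear]) (simp only: span_UNIV inj_T)
    then show ?thesis
      unfolding C(5) by (simp only: dim_UNIV DIM_cart DIM_real mult_1_right)
  qed
  obtain e :: "'m \<Rightarrow> real^'n" where e: "bij_betw e UNIV C"
    using finite_same_card_bij[of "UNIV :: 'm set" C] finC cardC by auto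
  have e_inj: "inj e" and e_range: "range e = C"
    using e by (auto simp: bij_betw_def)
  have e_dot: "e i \<bullet> e j = (if i = j then 1 else 0)" for i j
  proof (cases "i = j")
    case True
    then show ?thesis using C(3)[of "e j"] e_range by (auto simp: norm_eq_1)
  next
    case False
    then have "e i \<noteq> e j" using e_inj by (auto simp: inj_eq)
    then show ?thesis
      using C(2) e_range False by (auto simp: pairwise_def orthogonal_def)
  qed
  have E_dot: "b \<bullet> c = (if b = c then 1 else 0)" if "b \<in> E" "c \<in> E" for b c
    using E that by (auto simp: orthonormal_basis_def)
  have finE: "finite E" and spanE: "span E = {v. A *v v = 0}"
    using E by (auto simp: orthonormal_basis_def)
  have ker: "A *v b = 0" if "b \<in> E" for b
    using span_base[OF that] spanE by auto
  have cross: "b \<bullet> c = 0" if b: "b \<in> E" and c: "c \<in> C" for b c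
  proof -
    obtain y where "c = ?T *v y" using C(1) c by blast
    then have "c \<bullet> b = y \<bullet> (A *v b)" by (simp add: transpose_inner)
    then show ?thesis using ker[OF b] by (simp add: inner_commute)
  qed
  have disj: "C \<inter> E = {}"
  proof (rule ccontr)
    assume "C \<inter> E \<noteq> {}"
    then obtain b where "b \<in> C" "b \<in> E" by blast
    then show False using cross[of b b] E_dot[of b b] by simp
  qed
  have onb: "orthonormal_basis (\<bullet>) UNIV (C \<union> E)"
    unfolding orthonormal_basis_def
  proof (intro conjI ballI)
    show "finite (C \<union> E)" using finC finE by simp
    show "span (C \<union> E) = UNIV"
    proof -
      have "v \<in> span (C \<union> E)" for v
      proof -
        obtain S where S: "(A ** ?T) ** S = mat 1"
          using inv by (auto simp: invertible_def)
        define z where "z = ?T *v (S *v (A *v v))"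
        have "A *v z = A *v v"
          unfolding z_def by (simp only: matrix_vector_mul_assoc matrix_mul_assoc S matrix_mul_lid)
        then have "v - z \<in> span E" by (simp add: spanE matrix_vector_mult_diff_distrib)
        moreover have "z \<in> span C" using C(6) by (simp add: z_def)
        ultimately have "z + (v - z) \<in> span (C \<union> E)"
          by (intro span_add) (meson Un_upper1 Un_upper2 span_mono subsetD)+
        then show ?thesis by simp
      qed
      then show ?thesis by auto
    qed
    fix b c assume "b \<in> C \<union> E" "c \<in> C \<union> E"
    then consider "b \<in> C" "c \<in> C" | "b \<in> E" "c \<in> E" | "b \<in> E" "c \<in> C" | "b \<in> C" "c \<in> E" by blast
    then show "b \<bullet> c = (if b = c then 1 else 0)"
    proof cases
      case 1
      then obtain i j where "b = e i" "c = e j" using e_range by blast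
      then show ?thesis by (simp add: e_dot inj_eq[OF e_inj])
    next
      case 2
      then show ?thesis by (rule E_dot)
    next
      case 3
      moreover have "b \<noteq> c" using 3 disj by blast
      ultimately show ?thesis using cross by simp
    next
      case 4
      moreover have "b \<noteq> c" using 4 disj by blast
      ultimately show ?thesis using cross[of c b] by (simp add: inner_commute)
    qed
  qed
  have "card (C \<union> E) = dim (UNIV :: (real^'n) set)"
  proof (rule dim_eq_card[OF _ orthonormal_basis_independent(1)[OF onb], symmetric])
    show "span (C \<union> E) = span UNIV" using onb by (simp add: orthonormal_basis_def)
  qed
  moreover have "card (C \<union> E) = card C + card E"
    using disj finC finE by (intro card_Un_disjoint)
  ultimately show "card E + CARD('m) = CARD('n)"
    unfolding cardC by simp
  define M :: "real^'m^'m" where "M = (\<chi> i j. (A *v e j) $ i)"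
  have M_comb: "A *v (\<Sum>j\<in>UNIV. c j *\<^sub>R e j) = M *v (\<Sum>j\<in>UNIV. c j *\<^sub>R axis j 1)" for c
  proof -
    have "A *v (\<Sum>j\<in>UNIV. c j *\<^sub>R e j) = (\<Sum>j\<in>UNIV. c j *\<^sub>R (A *v e j))"
      by (simp add: linear_sum[OF matrix_vector_mul_linear] matrix_vector_mult_scaleR)
    also have "\<dots> = M *v (\<Sum>j\<in>UNIV. c j *\<^sub>R axis j 1)"
      by (simp add: vec_eq_iff M_def matrix_vector_mult_def axis_def if_distrib mult.commute cong: if_cong)
    finally show ?thesis .
  qed
  have MM: "M ** transpose M = A ** ?T"
  proof -
    have expand: "v = (\<Sum>k\<in>UNIV. (v \<bullet> e k) *\<^sub>R e k)" if v: "v \<in> span C" for v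
    proof -
      obtain u where u: "v = (\<Sum>k\<in>UNIV. u k *\<^sub>R e k)"
      proof -
        have "v \<in> range (\<lambda>u. \<Sum>b\<in>C. u b *\<^sub>R b)"
          using v by (simp add: span_finite[OF finC])
        then obtain u where "v = (\<Sum>b\<in>C. u b *\<^sub>R b)" by blast
        also have "\<dots> = (\<Sum>k\<in>UNIV. u (e k) *\<^sub>R e k)"
          using sum.reindex_bij_betw[OF e, of "\<lambda>b. u b *\<^sub>R b"] by simp
        finally show ?thesis by (rule that)
      qed
      have "v \<bullet> e k = u k" for k
        unfolding u inner_sum_left by (simp add: e_dot if_distrib cong: if_cong)
      then show ?thesis using u by simp
    qed
    have "(A ** ?T) $ i $ j = (M ** transpose M) $ i $ j" for i j
    proof -
      have rows: "row l A \<in> span C" for l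
      proof -
        have "row l A = ?T *v axis l 1"
          by (simp add: vec_eq_iff row_def transpose_def matrix_vector_mult_def axis_def if_distrib cong: if_cong)
        then show ?thesis using C(6) by simp
      qed
      have Me: "M $ l $ k = row l A \<bullet> e k" for l k
        by (simp add: M_def matrix_vector_mult_def row_def inner_vec_def)
      have "(A ** ?T) $ i $ j = row i A \<bullet> row j A"
        by (simp add: matrix_matrix_mult_def transpose_def row_def inner_vec_def)
      also have "\<dots> = row i A \<bullet> (\<Sum>k\<in>UNIV. (row j A \<bullet> e k) *\<^sub>R e k)"
        using expand[OF rows[of j]] by simp
      also have "\<dots> = (M ** transpose M) $ i $ j"
        by (simp add: inner_sum_right matrix_matrix_mult_def transpose_def Me mult.commute)
      finally show ?thesis .
    qed
    then show ?thesis by (simp add: vec_eq_iff)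
  qed
  have det_AT: "det (A ** ?T) = (det M)\<^sup>2"
    unfolding MM[symmetric] by (simp add: det_mul power2_eq_square)
  have detM: "det M \<noteq> 0"
    using inv invertible_det_nz[of "A ** ?T"] det_AT by auto
  show "0 < det (A ** ?T)"
    unfolding det_AT using detM by simp
  have lin [measurable]: "(*v) X \<in> borel_measurable borel" for X :: "real^'a::finite^'b::finite"
    by (intro borel_measurable_continuous_onI linear_continuous_on matrix_vector_mul_bounded_linear)
  have C_int: "(\<integral>\<^sup>+z. \<rho> (A *v z) \<partial>coord_lebesgue C) = ennreal (1 / \<bar>det M\<bar>)"
  proof -
    have axes: "orthonormal_basis (\<bullet>) UNIV (range (\<lambda>i. axis i 1 :: real^'m))"
      unfolding orthonormal_basis_def
    proof (intro conjI)
      have "range (\<lambda>i. axis i 1 :: real^'m) = Basis" by (auto simp: Basis_vec_def)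
      then show "span (range (\<lambda>i. axis i 1 :: real^'m)) = UNIV" by simp
    qed (auto simp: inner_axis_axis axis_eq_axis)
    have inj_axis: "inj (\<lambda>i. axis i 1 :: real^'m)" by (auto simp: inj_on_def axis_eq_axis)
    have "(\<integral>\<^sup>+z. \<rho> (A *v z) \<partial>coord_lebesgue C)
        = (\<integral>\<^sup>+c. \<rho> (A *v (\<Sum>j\<in>UNIV. c j *\<^sub>R e j)) \<partial>(\<Pi>\<^sub>M j\<in>UNIV. lborel))"
      unfolding e_range[symmetric] by (rule nn_integral_coord_lebesgue_image[OF e_inj]) auto
    also have "\<dots> = (\<integral>\<^sup>+c. \<rho> (M *v (\<Sum>j\<in>UNIV. c j *\<^sub>R axis j 1)) \<partial>(\<Pi>\<^sub>M j\<in>UNIV. lborel))"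
      by (simp only: M_comb)
    also have "\<dots> = (\<integral>\<^sup>+y. \<rho> (M *v y) \<partial>coord_lebesgue (range (\<lambda>i. axis i 1)))"
      by (rule nn_integral_coord_lebesgue_image[OF inj_axis, symmetric]) auto
    also have "\<dots> = (\<integral>\<^sup>+y. \<rho> (M *v y) \<partial>lborel)"
      by (rule coord_lebesgue_UNIV[OF axes]) measurable
    finally have eq: "(\<integral>\<^sup>+z. \<rho> (A *v z) \<partial>coord_lebesgue C) = (\<integral>\<^sup>+y. \<rho> (M *v y) \<partial>lborel)" .
    have "1 = (\<integral>\<^sup>+y. \<rho> (M *v y) \<partial>lborel) * ennreal \<bar>det M\<bar>"
      using nn_integral_lborel_linear[OF detM \<rho>] \<rho>1 by simp
    then have "ennreal (1 / \<bar>det M\<bar>) = (\<integral>\<^sup>+y. \<rho> (M *v y) \<partial>lborel) * (ennreal \<bar>det M\<bar> * ennreal (1 / \<bar>det M\<bar>))"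
      by (simp add: mult.assoc[symmetric])
    also have "ennreal \<bar>det M\<bar> * ennreal (1 / \<bar>det M\<bar>) = 1"
      using detM by (simp add: ennreal_mult[symmetric])
    finally show ?thesis using eq by simp
  qed
  let ?F = "\<lambda>v. \<rho> (A *v v) * \<phi> (v - \<xi> *v (A *v v))"
  have "(\<integral>\<^sup>+v. ?F v \<partial>lborel) = (\<integral>\<^sup>+v. ?F v \<partial>coord_lebesgue (C \<union> E))"
    by (rule coord_lebesgue_UNIV[OF onb, symmetric]) measurable
  also have "\<dots> = (\<integral>\<^sup>+z. \<integral>\<^sup>+w. ?F (z + w) \<partial>coord_lebesgue E \<partial>coord_lebesgue C)"
    by (rule nn_integral_coord_lebesgue_Un[OF disj finC finE]) measurable
  also have "\<dots> = (\<integral>\<^sup>+z. \<rho> (A *v z) * (\<integral>\<^sup>+w. \<phi> w \<partial>coord_lebesgue E) \<partial>coord_lebesgue C)"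
  proof (rule nn_integral_cong)
    fix z :: "real^'n"
    have tz: "z - \<xi> *v (A *v z) \<in> span E"
      unfolding spanE by (simp add: matrix_vector_mult_diff_distrib A\<xi>')
    have "(\<integral>\<^sup>+w. ?F (z + w) \<partial>coord_lebesgue E)
        = (\<integral>\<^sup>+w. \<rho> (A *v z) * \<phi> ((z - \<xi> *v (A *v z)) + 1 *\<^sub>R w) \<partial>coord_lebesgue E)"
    proof (rule nn_integral_coord_lebesgue_cong[OF finE])
      fix w assume "w \<in> span E"
      then show "?F (z + w) = \<rho> (A *v z) * \<phi> ((z - \<xi> *v (A *v z)) + 1 *\<^sub>R w)"
        by (simp add: spanE matrix_vector_right_distrib algebra_simps)
    qed measurable
    also have "\<dots> = \<rho> (A *v z) * (\<integral>\<^sup>+w. \<phi> ((z - \<xi> *v (A *v z)) + 1 *\<^sub>R w) \<partial>coord_lebesgue E)"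
      by (rule nn_integral_cmult) measurable
    also have "(\<integral>\<^sup>+w. \<phi> ((z - \<xi> *v (A *v z)) + 1 *\<^sub>R w) \<partial>coord_lebesgue E) = (\<integral>\<^sup>+w. \<phi> w \<partial>coord_lebesgue E)"
      using nn_integral_coord_lebesgue_affine[OF finE tz, of 1 \<phi>] by simp
    finally show "(\<integral>\<^sup>+w. ?F (z + w) \<partial>coord_lebesgue E) = \<rho> (A *v z) * (\<integral>\<^sup>+w. \<phi> w \<partial>coord_lebesgue E)" .
  qed
  also have "\<dots> = (\<integral>\<^sup>+z. \<rho> (A *v z) \<partial>coord_lebesgue C) * (\<integral>\<^sup>+w. \<phi> w \<partial>coord_lebesgue E)"
    by (rule nn_integral_multc) measurable
  finally show "(\<integral>\<^sup>+v. ?F v \<partial>lborel)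
      = ennreal (1 / sqrt (det (A ** ?T))) * (\<integral>\<^sup>+w. \<phi> w \<partial>coord_lebesgue E)"
    unfolding C_int det_AT by (simp add: real_sqrt_abs)
qed

section \<open>The Kac-Rice formula in a chart\<close>

text \<open>The derivative of \<open>x \<mapsto> A x *v v\<close> for fixed \<open>v\<close>.  If \<open>A x *v v\<close> is the gradient at \<open>x\<close> of a function
attached to \<open>v\<close>, this is its Hessian matrix.\<close>

definition matrix_derivative :: "(real^'m::finite \<Rightarrow> real^'n::finite^'m) \<Rightarrow> real^'m \<Rightarrow> real^'n \<Rightarrow> real^'m^'m" where
  "matrix_derivative A x v = (\<chi> i l. \<Sum>k\<in>UNIV. frechet_derivative (\<lambda>x. A x $ i $ k) (at x) (axis l 1) * v $ k)"

lemma fsigma_borel: "fsigma B \<Longrightarrow> B \<in> sets borel"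
  for B :: "'a::euclidean_space set"
proof -
  assume "fsigma B"
  then obtain K :: "nat \<Rightarrow> 'a set" where "range K \<subseteq> Collect compact" "B = \<Union>(range K)"
    unfolding fsigma_Union_compact by (elim exE conjE)
  then have "K j \<in> sets borel" for j
    by (intro borel_compact) auto
  then show ?thesis
    unfolding \<open>B = \<Union>(range K)\<close> by (intro sets.countable_UN) auto
qed

lemma nn_integral_lborel_shift:
  fixes t :: "'e::euclidean_space"
  assumes [measurable]: "g \<in> borel_measurable borel"
  shows "(\<integral>\<^sup>+v. g (v - t) \<partial>lborel) = (\<integral>\<^sup>+v. g v \<partial>lborel)"
proof -
  have "(\<integral>\<^sup>+v. g v \<partial>lborel) = (\<integral>\<^sup>+v. g v \<partial>distr lborel borel ((+) (- t)))"
    by (simp add: lborel_distr_plus)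
  also have "\<dots> = (\<integral>\<^sup>+v. g (v - t) \<partial>lborel)"
    by (subst nn_integral_distr) auto
  finally show ?thesis ..
qed

locale matrix_family =
  fixes G :: "(real^'m::finite) set" and A :: "real^'m \<Rightarrow> real^'n::finite^'m"
  assumes G: "open G" and C1: "\<And>i k. Ck_on (Suc 0) G (\<lambda>x. A x $ i $ k)"
begin

abbreviation "dA \<equiv> \<lambda>i k x. frechet_derivative (\<lambda>x. A x $ i $ k) (at x)"

lemma entry_has_derivative: "x \<in> G \<Longrightarrow> ((\<lambda>x. A x $ i $ k) has_derivative dA i k x) (at x)"
  by (rule Ck_on_SucD(1)[OF C1])

lemma continuous_on_entry: "continuous_on G (\<lambda>x. A x $ i $ k)"
  by (rule Ck_on_imp_continuous_on[OF C1])

lemma continuous_on_dA: "continuous_on G (\<lambda>x. dA i k x w)"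
  using Ck_on_SucD(2)[OF C1] by simp

lemma apply_has_derivative:
  assumes "x \<in> G"
  shows "((\<lambda>x. A x *v v) has_derivative (\<lambda>w. \<chi> i. \<Sum>k\<in>UNIV. dA i k x w * v $ k)) (at x)"
proof -
  have "((\<lambda>x. (A x *v v) \<bullet> axis i 1) has_derivative (\<lambda>w. (\<chi> i. \<Sum>k\<in>UNIV. dA i k x w * v $ k) \<bullet> axis i 1)) (at x)" for i
    unfolding inner_axis matrix_vector_mult_def vec_lambda_beta inner_real_def mult_1_right
    by (intro has_derivative_sum has_derivative_mult_left entry_has_derivative assms)
  then show ?thesis
    by (subst has_derivative_componentwise_within) (auto simp: Basis_vec_def)
qed

lemma continuous_on_apply: "continuous_on (G \<times> UNIV) (\<lambda>p. A (fst p) *v snd p)"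
  unfolding matrix_vector_mult_def
  by (intro continuous_on_vec_lambda continuous_intros continuous_on_compose2[OF continuous_on_entry]) auto

lemma continuous_on_det_derivative: "continuous_on (G \<times> UNIV) (\<lambda>p. det (matrix_derivative A (fst p) (snd p)))"
  unfolding det_def matrix_derivative_def vec_lambda_beta
  by (intro continuous_intros continuous_on_compose2[OF continuous_on_dA]) auto

lemma continuous_on_det_derivative_at:
  assumes "x \<in> G"
  shows "continuous_on UNIV (\<lambda>w. det (matrix_derivative A x w))"
proof -
  have "continuous_on UNIV (\<lambda>w. det (matrix_derivative A (fst (x, w)) (snd (x, w))))"
    by (rule continuous_on_compose2[OF continuous_on_det_derivative, where f = "\<lambda>w. (x, w)"])
       (use assms in \<open>auto intro!: continuous_intros\<close>)
  then show ?thesis by simp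
qed

lemma matrix_family_subset: "G' \<subseteq> G \<Longrightarrow> open G' \<Longrightarrow> matrix_family G' A"
  by standard (assumption, rule Ck_on_subset[OF C1])

lemma borel_measurable_count:
  assumes B: "fsigma B" "B \<subseteq> G"
  shows "(\<lambda>v. emeasure (count_space UNIV) {x \<in> B. A x *v v = 0}) \<in> borel_measurable borel"
proof -
  let ?Z = "{(x, v). A x *v v = 0}"
  have "closed (K \<times> UNIV \<inter> ?Z)" if K: "compact K" "K \<subseteq> B" for K
  proof -
    have "continuous_on (K \<times> UNIV) (\<lambda>p. A (fst p) *v snd p)"
      by (rule continuous_on_subset[OF continuous_on_apply]) (use K B in auto)
    then have "closed (K \<times> UNIV \<inter> (\<lambda>p. A (fst p) *v snd p) -` {0})"
      using K by (intro continuous_closed_preimage) (auto intro: closed_Times compact_imp_closed)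
    moreover have "K \<times> UNIV \<inter> (\<lambda>p. A (fst p) *v snd p) -` {0} = K \<times> UNIV \<inter> ?Z"
      by auto
    ultimately show ?thesis by simp
  qed
  from borel_measurable_count_fibre[OF B(1) this] show ?thesis by simp
qed

end

text \<open>Averaging over translates: \<open>v - \<xi> p\<close> has a zero at \<open>x\<close> if and only if \<open>A x *v v = p\<close>.  By translation
invariance the left side is the integral over \<open>v\<close> and \<open>p\<close>, with a probability density \<open>\<rho>\<close> in \<open>p\<close>, of
the number of such \<open>x\<close>.  The area formula for \<open>x \<mapsto> A x *v v\<close> carries out the integration over \<open>p\<close>; then
the integrals over \<open>x\<close> and \<open>v\<close> are exchanged, and \<open>nn_integral_transversal_kernel\<close> evaluates the one
over \<open>v\<close>.  The determinant may be taken at the projection of \<open>v\<close> to the kernel, because \<open>A x ** \<xi>\<close> is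
constant and so the derivative of \<open>A\<close> vanishes on the range of \<open>\<xi>\<close>.\<close>

lemma kac_rice_normalized:
  fixes A :: "real^'m::finite \<Rightarrow> real^'n::finite^'m" and \<xi> :: "real^'m^'n"
  assumes fam: "matrix_family G A"
    and \<xi>: "\<And>x. x \<in> G \<Longrightarrow> A x ** \<xi> = mat 1"
    and B: "fsigma B" "B \<subseteq> G"
    and E: "\<And>x. x \<in> G \<Longrightarrow> orthonormal_basis (\<bullet>) {v. A x *v v = 0} (E x)"
    and wt [measurable]: "wt \<in> borel_measurable borel"
  defines "R \<equiv> \<lambda>x. ennreal (1 / sqrt (det (A x ** transpose (A x)))) *
      (\<integral>\<^sup>+w. wt w * ennreal \<bar>det (matrix_derivative A x w)\<bar> \<partial>coord_lebesgue (E x))"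
  shows "(\<lambda>x. R x * indicator B x) \<in> borel_measurable borel"
    and "(\<integral>\<^sup>+v. wt v * emeasure (count_space UNIV) {x \<in> B. A x *v v = 0} \<partial>lborel)
      = (\<integral>\<^sup>+x. R x * indicator B x \<partial>lborel)"
proof -
  interpret matrix_family G A by (rule fam)
  let ?D = "matrix_derivative A"
  have D_diff: "?D x (v - w) = ?D x v - ?D x w" for x v w
    by (simp add: matrix_derivative_def vec_eq_iff right_diff_distrib sum_subtractf)
  have D_\<xi>: "?D x (\<xi> *v y) = 0" if x: "x \<in> G" for x y
  proof -
    have zero: "(\<Sum>k\<in>UNIV. dA i k x w * \<xi> $ k $ j) = 0" for i j w
    proof -
      have "((\<lambda>x. \<Sum>k\<in>UNIV. A x $ i $ k * \<xi> $ k $ j) has_derivative (\<lambda>w. \<Sum>k\<in>UNIV. dA i k x w * \<xi> $ k $ j)) (at x)"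
        by (intro has_derivative_sum has_derivative_mult_left entry_has_derivative x)
      moreover have "((\<lambda>x. \<Sum>k\<in>UNIV. A x $ i $ k * \<xi> $ k $ j) has_derivative (\<lambda>w. 0)) (at x)"
      proof (rule has_derivative_transform_within_open[OF has_derivative_const G x])
        fix z assume "z \<in> G"
        then show "(mat 1 :: real^'m^'m) $ i $ j = (\<Sum>k\<in>UNIV. A z $ i $ k * \<xi> $ k $ j)"
          by (simp add: \<xi>[symmetric] matrix_matrix_mult_def)
      qed
      ultimately have "(\<lambda>w. \<Sum>k\<in>UNIV. dA i k x w * \<xi> $ k $ j) = (\<lambda>w. 0)"
        by (rule has_derivative_unique)
      then show ?thesis by (rule fun_cong)
    qed
    have "?D x (\<xi> *v y) $ i $ l = 0" for i l
    proof -
      have "?D x (\<xi> *v y) $ i $ l = (\<Sum>k\<in>UNIV. \<Sum>j\<in>UNIV. dA i k x (axis l 1) * \<xi> $ k $ j * y $ j)"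
        by (simp add: matrix_derivative_def matrix_vector_mult_def sum_distrib_left mult.assoc)
      also have "\<dots> = (\<Sum>j\<in>UNIV. (\<Sum>k\<in>UNIV. dA i k x (axis l 1) * \<xi> $ k $ j) * y $ j)"
        by (subst sum.swap) (simp add: sum_distrib_right)
      finally show ?thesis by (simp add: zero)
    qed
    then show ?thesis by (simp add: vec_eq_iff)
  qed
  have D_proj: "?D x (v - \<xi> *v y) = ?D x v" if "x \<in> G" for x v y
    using D_\<xi>[OF that] by (simp add: D_diff)
  define N where "N = (\<lambda>v. emeasure (count_space UNIV) {x \<in> B. A x *v v = 0})"
  have [measurable]: "N \<in> borel_measurable borel"
    unfolding N_def by (rule borel_measurable_count[OF B])
  have [measurable]: "B \<in> sets borel"
    by (rule fsigma_borel[OF B(1)])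
  have lin [measurable]: "(*v) X \<in> borel_measurable borel" for X :: "real^'a::finite^'b::finite"
    by (intro borel_measurable_continuous_onI linear_continuous_on matrix_vector_mul_bounded_linear)
  \<comment> \<open>a probability density on the space of translations\<close>
  define \<rho> :: "real^'m \<Rightarrow> ennreal" where "\<rho> = indicator (box 0 One)"
  have [measurable]: "\<rho> \<in> borel_measurable borel"
    unfolding \<rho>_def by simp
  have \<rho>1: "(\<integral>\<^sup>+p. \<rho> p \<partial>lborel) = 1"
    unfolding \<rho>_def by (simp add: emeasure_lborel_box_eq)
  \<comment> \<open>Extension by \<open>0\<close> makes the integrands Borel measurable on the whole space.\<close>
  define L where "L = (\<lambda>p. if p \<in> G \<times> UNIV then A (fst p) *v snd p else 0)"
  define J where "J = (\<lambda>p. if p \<in> G \<times> UNIV then det (?D (fst p) (snd p)) else 0)"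
  have "G \<times> (UNIV :: (real^'n) set) \<in> sets borel"
    using G by (intro borel_open open_Times) auto
  then have [measurable]: "L \<in> borel_measurable (borel \<Otimes>\<^sub>M borel)" "J \<in> borel_measurable (borel \<Otimes>\<^sub>M borel)"
    unfolding borel_prod L_def J_def
    using borel_measurable_if_continuous_on continuous_on_apply continuous_on_det_derivative by blast+
  define \<Psi> where "\<Psi> = (\<lambda>x v. indicator B x * (\<rho> (L (x, v)) * (wt (v - \<xi> *v L (x, v)) * ennreal \<bar>J (x, v)\<bar>)))"
  have [measurable]: "case_prod \<Psi> \<in> borel_measurable (borel \<Otimes>\<^sub>M borel)"
    unfolding \<Psi>_def by measurable
  have inner_x: "(\<integral>\<^sup>+v. \<Psi> x v \<partial>lborel) = R x * indicator B x" for x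
  proof (cases "x \<in> B")
    case True
    then have x: "x \<in> G" using B by auto
    let ?\<phi> = "\<lambda>w. wt w * ennreal \<bar>det (?D x w)\<bar>"
    have "(\<lambda>v. J (x, v)) \<in> borel_measurable borel"
      by measurable
    then have [measurable]: "(\<lambda>v. det (?D x v)) \<in> borel_measurable borel"
      using x by (simp add: J_def)
    have "(\<integral>\<^sup>+v. \<Psi> x v \<partial>lborel) = (\<integral>\<^sup>+v. \<rho> (A x *v v) * ?\<phi> (v - \<xi> *v (A x *v v)) \<partial>lborel)"
      using True x by (simp add: \<Psi>_def L_def J_def D_proj)
    also have "\<dots> = R x"
      unfolding R_def
      by (rule nn_integral_transversal_kernel(3)[OF \<xi>[OF x] E[OF x] _ _ \<rho>1]) measurable
    finally show ?thesis using True by simp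
  qed (simp add: \<Psi>_def)
  have inner_v: "(\<integral>\<^sup>+x. \<Psi> x v \<partial>lborel) = (\<integral>\<^sup>+p. \<rho> p * (wt (v - \<xi> *v p) * N (v - \<xi> *v p)) \<partial>lborel)" for v
  proof -
    have zero_iff: "{x \<in> B. A x *v (v - \<xi> *v p) = 0} = {x \<in> B. A x *v v = p}" for p
      using \<xi> B(2) by (auto simp: matrix_vector_mult_diff_distrib matrix_vector_mul_assoc)
    have "(\<integral>\<^sup>+p. \<rho> p * (wt (v - \<xi> *v p) * N (v - \<xi> *v p)) \<partial>lborel)
        = (\<integral>\<^sup>+p. (\<rho> p * wt (v - \<xi> *v p)) * emeasure (count_space UNIV) {x \<in> B. A x *v v = p} \<partial>lborel)"
      unfolding N_def zero_iff by (simp add: mult.assoc)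
    also have "\<dots> = (\<integral>\<^sup>+x\<in>B. (\<rho> (A x *v v) * wt (v - \<xi> *v (A x *v v)))
        * ennreal \<bar>det (matrix (\<lambda>w. \<chi> i. \<Sum>k\<in>UNIV. dA i k x w * v $ k))\<bar> \<partial>lborel)"
    proof (rule area_formula[OF G apply_has_derivative _ _ B(2)])
      show "continuous_on G (\<lambda>x. \<chi> i. \<Sum>k\<in>UNIV. dA i k x w * v $ k)" for w
        by (intro continuous_on_vec_lambda continuous_intros continuous_on_dA)
    qed measurable
    also have "\<dots> = (\<integral>\<^sup>+x. \<Psi> x v \<partial>lborel)"
    proof (rule nn_integral_cong)
      fix x
      have "matrix (\<lambda>w. \<chi> i. \<Sum>k\<in>UNIV. dA i k x w * v $ k) = ?D x v"
        by (simp add: matrix_def matrix_derivative_def)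
      then show "(\<rho> (A x *v v) * wt (v - \<xi> *v (A x *v v)))
        * ennreal \<bar>det (matrix (\<lambda>w. \<chi> i. \<Sum>k\<in>UNIV. dA i k x w * v $ k))\<bar> * indicator B x = \<Psi> x v"
        using B(2) by (auto simp: \<Psi>_def L_def J_def mult.assoc split: split_indicator)
    qed
    finally show ?thesis ..
  qed
  have "(\<lambda>x. \<integral>\<^sup>+v. \<Psi> x v \<partial>lborel) \<in> borel_measurable borel"
    by measurable
  then show "(\<lambda>x. R x * indicator B x) \<in> borel_measurable borel"
    by (simp only: inner_x)
  have mn: "pair_sigma_finite (lborel :: (real^'m) measure) (lborel :: (real^'n) measure)" ..
  have "(\<integral>\<^sup>+v. wt v * N v \<partial>lborel) = (\<integral>\<^sup>+p. \<rho> p \<partial>lborel) * (\<integral>\<^sup>+v. wt v * N v \<partial>lborel)"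
    by (simp add: \<rho>1)
  also have "\<dots> = (\<integral>\<^sup>+p. \<rho> p * (\<integral>\<^sup>+v. wt v * N v \<partial>lborel) \<partial>lborel)"
    by (rule nn_integral_multc[symmetric]) measurable
  also have "\<dots> = (\<integral>\<^sup>+p. \<integral>\<^sup>+v. \<rho> p * (wt (v - \<xi> *v p) * N (v - \<xi> *v p)) \<partial>lborel \<partial>lborel)"
  proof (rule nn_integral_cong)
    fix p :: "real^'m"
    have "(\<integral>\<^sup>+v. wt (v - \<xi> *v p) * N (v - \<xi> *v p) \<partial>lborel) = (\<integral>\<^sup>+v. wt v * N v \<partial>lborel)"
      by (rule nn_integral_lborel_shift[of "\<lambda>v. wt v * N v"]) measurable
    moreover have "(\<integral>\<^sup>+v. \<rho> p * (wt (v - \<xi> *v p) * N (v - \<xi> *v p)) \<partial>lborel)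
        = \<rho> p * (\<integral>\<^sup>+v. wt (v - \<xi> *v p) * N (v - \<xi> *v p) \<partial>lborel)"
      by (rule nn_integral_cmult) measurable
    ultimately show "\<rho> p * (\<integral>\<^sup>+v. wt v * N v \<partial>lborel)
        = (\<integral>\<^sup>+v. \<rho> p * (wt (v - \<xi> *v p) * N (v - \<xi> *v p)) \<partial>lborel)" by simp
  qed
  also have "\<dots> = (\<integral>\<^sup>+v. \<integral>\<^sup>+p. \<rho> p * (wt (v - \<xi> *v p) * N (v - \<xi> *v p)) \<partial>lborel \<partial>lborel)"
    by (rule pair_sigma_finite.Fubini'[OF mn, symmetric]) measurable
  also have "\<dots> = (\<integral>\<^sup>+v. \<integral>\<^sup>+x. \<Psi> x v \<partial>lborel \<partial>lborel)"
    by (simp only: inner_v)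
  also have "\<dots> = (\<integral>\<^sup>+x. \<integral>\<^sup>+v. \<Psi> x v \<partial>lborel \<partial>lborel)"
    by (rule pair_sigma_finite.Fubini'[OF mn]) measurable
  finally show "(\<integral>\<^sup>+v. wt v * emeasure (count_space UNIV) {x \<in> B. A x *v v = 0} \<partial>lborel)
      = (\<integral>\<^sup>+x. R x * indicator B x \<partial>lborel)"
    by (simp only: inner_x N_def)
qed

text \<open>Multiplying \<open>A x\<close> by the inverse of \<open>\<Xi> x = A x ** \<xi>\<close> gives a normalized family \<open>\<Lambda>\<close> with the same
zeros.  On the kernel the derivative of \<open>A\<close> is \<open>\<Xi> x\<close> times that of \<open>\<Lambda>\<close>, since the derivative of
\<open>\<Xi>\<close> is multiplied by \<open>\<Lambda> x *v w = 0\<close>; the factor \<open>|det \<Xi>|\<close> that this produces is also that of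
\<open>\<surd>(det A A\<^sup>T)\<close>.\<close>

theorem kac_rice:
  fixes A :: "real^'m::finite \<Rightarrow> real^'n::finite^'m" and \<xi> :: "real^'m^'n"
  assumes fam: "matrix_family G A"
    and \<xi>: "\<And>x. x \<in> G \<Longrightarrow> det (A x ** \<xi>) \<noteq> 0"
    and B: "fsigma B" "B \<subseteq> G"
    and E: "\<And>x. x \<in> G \<Longrightarrow> orthonormal_basis (\<bullet>) {v. A x *v v = 0} (E x)"
    and wt [measurable]: "wt \<in> borel_measurable borel"
  defines "R \<equiv> \<lambda>x. ennreal (1 / sqrt (det (A x ** transpose (A x)))) *
      (\<integral>\<^sup>+w. wt w * ennreal \<bar>det (matrix_derivative A x w)\<bar> \<partial>coord_lebesgue (E x))"
  shows "\<And>x. x \<in> G \<Longrightarrow> 0 < det (A x ** transpose (A x))"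
    and "(\<lambda>x. R x * indicator B x) \<in> borel_measurable borel"
    and "(\<integral>\<^sup>+v. wt v * emeasure (count_space UNIV) {x \<in> B. A x *v v = 0} \<partial>lborel)
      = (\<integral>\<^sup>+x. R x * indicator B x \<partial>lborel)"
proof -
  interpret matrix_family G A by (rule fam)
  define \<Xi> where "\<Xi> = (\<lambda>x. A x ** \<xi>)"
  \<comment> \<open>Cramer's rule, which shows that the entries are continuously differentiable\<close>
  define \<Lambda> :: "real^'m \<Rightarrow> real^'n^'m" where
    "\<Lambda> = (\<lambda>x. \<chi> i k. det (\<chi> a b. if b = i then A x $ a $ k else \<Xi> x $ a $ b) / det (\<Xi> x))"
  have \<Xi>_nz: "det (\<Xi> x) \<noteq> 0" if "x \<in> G" for x
    using \<xi>[OF that] by (simp add: \<Xi>_def)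
  have \<Xi>\<Lambda>: "\<Xi> x ** \<Lambda> x = A x" if x: "x \<in> G" for x
  proof -
    have "(\<Xi> x ** \<Lambda> x) $ a $ k = A x $ a $ k" for a k
    proof -
      have "\<Xi> x *v (\<chi> i. \<Lambda> x $ i $ k) = (\<chi> a. A x $ a $ k)"
        unfolding cramer[OF \<Xi>_nz[OF x]] by (simp add: \<Lambda>_def cong: if_cong)
      then have "(\<Xi> x *v (\<chi> i. \<Lambda> x $ i $ k)) $ a = A x $ a $ k" by simp
      then show ?thesis by (simp add: matrix_vector_mult_def matrix_matrix_mult_def)
    qed
    then show ?thesis by (simp add: vec_eq_iff)
  qed
  have \<Xi>_C1: "Ck_on (Suc 0) G (\<lambda>x. \<Xi> x $ i $ j)" for i j
    unfolding \<Xi>_def matrix_matrix_mult_def vec_lambda_beta by (intro Ck_on_sum Ck_on_mult Ck_on_const G C1)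
  have \<Lambda>_fam: "matrix_family G \<Lambda>"
  proof
    fix i k
    have entry: "Ck_on (Suc 0) G (\<lambda>x. if b = i then A x $ a $ k else \<Xi> x $ a $ b)" for a b
    proof (cases "b = i")
      case True
      then show ?thesis using C1[of a k] by (simp only: if_True refl)
    next
      case False
      then show ?thesis using \<Xi>_C1[of a b] by (simp only: if_False)
    qed
    have "Ck_on (Suc 0) G (\<lambda>x. det (\<chi> a b. if b = i then A x $ a $ k else \<Xi> x $ a $ b) * inverse (det (\<Xi> x)))"
      by (intro Ck_on_mult Ck_on_inverse Ck_on_det G \<Xi>_C1 \<Xi>_nz) (simp only: vec_lambda_beta entry)
    then show "Ck_on (Suc 0) G (\<lambda>x. \<Lambda> x $ i $ k)"
      by (simp only: \<Lambda>_def vec_lambda_beta divide_inverse)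
  qed (rule G)
  interpret \<Lambda>: matrix_family G \<Lambda> by (rule \<Lambda>_fam)
  have \<Xi>_inj: "u = 0" if "\<Xi> x *v u = 0" "x \<in> G" for x u
    using \<Xi>_nz[OF that(2)] that(1) det_nz_iff_inj[of "(*v) (\<Xi> x)"]
    by (simp add: linear_injective_0)
  have \<Lambda>\<xi>: "\<Lambda> x ** \<xi> = mat 1" if x: "x \<in> G" for x
  proof -
    obtain S where S: "S ** \<Xi> x = mat 1"
      using \<Xi>_nz[OF x] invertible_det_nz[of "\<Xi> x"] by (auto simp: invertible_def)
    have "\<Xi> x ** (\<Lambda> x ** \<xi>) = \<Xi> x"
      by (simp add: matrix_mul_assoc \<Xi>\<Lambda>[OF x]) (simp add: \<Xi>_def)
    then have "S ** (\<Xi> x ** (\<Lambda> x ** \<xi>)) = S ** \<Xi> x" by simp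
    then show ?thesis by (simp add: matrix_mul_assoc S)
  qed
  have ker: "A x *v v = 0 \<longleftrightarrow> \<Lambda> x *v v = 0" if x: "x \<in> G" for x v
  proof -
    have "A x *v v = \<Xi> x *v (\<Lambda> x *v v)"
      by (simp add: matrix_vector_mul_assoc \<Xi>\<Lambda>[OF x])
    then show ?thesis using \<Xi>_inj[OF _ x] by auto
  qed
  have E\<Lambda>: "orthonormal_basis (\<bullet>) {v. \<Lambda> x *v v = 0} (E x)" if "x \<in> G" for x
    using E[OF that] ker[OF that] by simp
  have det_AA: "det (A x ** transpose (A x)) = (det (\<Xi> x))\<^sup>2 * det (\<Lambda> x ** transpose (\<Lambda> x))" if x: "x \<in> G" for x
  proof -
    have "A x ** transpose (A x) = \<Xi> x ** ((\<Lambda> x ** transpose (\<Lambda> x)) ** transpose (\<Xi> x))"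
      by (subst (1 2) \<Xi>\<Lambda>[OF x, symmetric]) (simp add: matrix_transpose_mul matrix_mul_assoc)
    then show ?thesis by (simp add: det_mul power2_eq_square)
  qed
  have pos: "0 < det (\<Lambda> x ** transpose (\<Lambda> x))" if x: "x \<in> G" for x
    by (rule nn_integral_transversal_kernel(1)[OF \<Lambda>\<xi>[OF x] E\<Lambda>[OF x], of "\<lambda>_. 0" "indicator (box 0 One)"])
       (simp_all add: emeasure_lborel_box_eq)
  then show "0 < det (A x ** transpose (A x))" if "x \<in> G" for x
    using that \<Xi>_nz[OF that] by (simp add: det_AA)
  have deriv: "matrix_derivative A x w = \<Xi> x ** matrix_derivative \<Lambda> x w" if x: "x \<in> G" and w: "\<Lambda> x *v w = 0" for x w
  proof -
    let ?d\<Xi> = "\<lambda>i j. frechet_derivative (\<lambda>x. \<Xi> x $ i $ j) (at x)"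
    have dA: "dA i k x u = (\<Sum>j\<in>UNIV. \<Xi> x $ i $ j * \<Lambda>.dA j k x u + ?d\<Xi> i j u * \<Lambda> x $ j $ k)" for i k u
    proof -
      have "((\<lambda>x. \<Sum>j\<in>UNIV. \<Xi> x $ i $ j * \<Lambda> x $ j $ k) has_derivative
          (\<lambda>u. \<Sum>j\<in>UNIV. \<Xi> x $ i $ j * \<Lambda>.dA j k x u + ?d\<Xi> i j u * \<Lambda> x $ j $ k)) (at x)"
        by (intro has_derivative_sum has_derivative_mult \<Lambda>.entry_has_derivative Ck_on_SucD(1)[OF \<Xi>_C1] x)
      then have "((\<lambda>x. A x $ i $ k) has_derivative
          (\<lambda>u. \<Sum>j\<in>UNIV. \<Xi> x $ i $ j * \<Lambda>.dA j k x u + ?d\<Xi> i j u * \<Lambda> x $ j $ k)) (at x)"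
      proof (rule has_derivative_transform_within_open[OF _ G x])
        fix z assume z: "z \<in> G"
        show "(\<Sum>j\<in>UNIV. \<Xi> z $ i $ j * \<Lambda> z $ j $ k) = A z $ i $ k"
          by (subst \<Xi>\<Lambda>[OF z, symmetric]) (simp add: matrix_matrix_mult_def)
      qed
      from has_derivative_unique[OF entry_has_derivative[OF x] this] show ?thesis by (rule fun_cong)
    qed
    have "matrix_derivative A x w $ i $ l = (\<Xi> x ** matrix_derivative \<Lambda> x w) $ i $ l" for i l
    proof -
      have \<Lambda>w: "(\<Sum>k\<in>UNIV. \<Lambda> x $ j $ k * w $ k) = 0" for j
        using arg_cong[OF w, of "\<lambda>y. y $ j"] by (simp add: matrix_vector_mult_def)
      have "matrix_derivative A x w $ i $ l
          = (\<Sum>k\<in>UNIV. \<Sum>j\<in>UNIV. \<Xi> x $ i $ j * (\<Lambda>.dA j k x (axis l 1) * w $ k) + ?d\<Xi> i j (axis l 1) * (\<Lambda> x $ j $ k * w $ k))"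
        by (simp add: matrix_derivative_def dA sum_distrib_right distrib_right mult.assoc)
      also have "\<dots> = (\<Sum>j\<in>UNIV. \<Xi> x $ i $ j * (\<Sum>k\<in>UNIV. \<Lambda>.dA j k x (axis l 1) * w $ k)
          + ?d\<Xi> i j (axis l 1) * (\<Sum>k\<in>UNIV. \<Lambda> x $ j $ k * w $ k))"
        by (subst sum.swap) (simp add: sum.distrib sum_distrib_left)
      also have "\<dots> = (\<Xi> x ** matrix_derivative \<Lambda> x w) $ i $ l"
        by (simp add: \<Lambda>w matrix_matrix_mult_def matrix_derivative_def)
      finally show ?thesis .
    qed
    then show ?thesis by (simp add: vec_eq_iff)
  qed
  define R' where "R' = (\<lambda>x. ennreal (1 / sqrt (det (\<Lambda> x ** transpose (\<Lambda> x)))) *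
      (\<integral>\<^sup>+w. wt w * ennreal \<bar>det (matrix_derivative \<Lambda> x w)\<bar> \<partial>coord_lebesgue (E x)))"
  have R: "R x = R' x" if x: "x \<in> G" for x
  proof -
    have [measurable]: "(\<lambda>w. det (matrix_derivative A x w)) \<in> borel_measurable borel"
      "(\<lambda>w. det (matrix_derivative \<Lambda> x w)) \<in> borel_measurable borel"
      by (rule borel_measurable_continuous_onI[OF continuous_on_det_derivative_at[OF x]]
          borel_measurable_continuous_onI[OF \<Lambda>.continuous_on_det_derivative_at[OF x]])+
    have span: "span (E x) = {v. \<Lambda> x *v v = 0}" and fin: "finite (E x)"
      using E\<Lambda>[OF x] by (auto simp: orthonormal_basis_def)
    have "(\<integral>\<^sup>+w. wt w * ennreal \<bar>det (matrix_derivative A x w)\<bar> \<partial>coord_lebesgue (E x))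
        = (\<integral>\<^sup>+w. ennreal \<bar>det (\<Xi> x)\<bar> * (wt w * ennreal \<bar>det (matrix_derivative \<Lambda> x w)\<bar>) \<partial>coord_lebesgue (E x))"
    proof (rule nn_integral_coord_lebesgue_cong[OF fin])
      fix w assume "w \<in> span (E x)"
      then show "wt w * ennreal \<bar>det (matrix_derivative A x w)\<bar>
          = ennreal \<bar>det (\<Xi> x)\<bar> * (wt w * ennreal \<bar>det (matrix_derivative \<Lambda> x w)\<bar>)"
        by (simp add: span deriv[OF x] det_mul abs_mult ennreal_mult mult.left_commute)
    qed measurable
    also have "\<dots> = ennreal \<bar>det (\<Xi> x)\<bar> * (\<integral>\<^sup>+w. wt w * ennreal \<bar>det (matrix_derivative \<Lambda> x w)\<bar> \<partial>coord_lebesgue (E x))"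
      by (rule nn_integral_cmult) measurable
    finally have "R x = (ennreal (1 / sqrt (det (A x ** transpose (A x)))) * ennreal \<bar>det (\<Xi> x)\<bar>) *
        (\<integral>\<^sup>+w. wt w * ennreal \<bar>det (matrix_derivative \<Lambda> x w)\<bar> \<partial>coord_lebesgue (E x))"
      by (simp add: R_def mult.assoc)
    also have "ennreal (1 / sqrt (det (A x ** transpose (A x)))) * ennreal \<bar>det (\<Xi> x)\<bar>
        = ennreal (1 / sqrt (det (\<Lambda> x ** transpose (\<Lambda> x))))"
      using pos[OF x] \<Xi>_nz[OF x]
      by (subst ennreal_mult[symmetric]) (simp_all add: det_AA[OF x] real_sqrt_mult)
    finally show ?thesis by (simp add: R'_def)
  qed
  have R_eq: "(\<lambda>x. R x * indicator B x) = (\<lambda>x. R' x * indicator B x)"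
    using R B(2) by (auto simp: fun_eq_iff indicator_def)
  have set_eq: "{x \<in> B. A x *v v = 0} = {x \<in> B. \<Lambda> x *v v = 0}" for v
    using ker B(2) by auto
  note N = kac_rice_normalized[OF \<Lambda>_fam \<Lambda>\<xi> B E\<Lambda> wt]
  show "(\<lambda>x. R x * indicator B x) \<in> borel_measurable borel"
    unfolding R_eq R'_def by (rule N(1))
  show "(\<integral>\<^sup>+v. wt v * emeasure (count_space UNIV) {x \<in> B. A x *v v = 0} \<partial>lborel)
      = (\<integral>\<^sup>+x. R x * indicator B x \<partial>lborel)"
    unfolding R_eq R'_def set_eq by (rule N(2))
qed

section \<open>Charts, tangent vectors and the Hessian\<close>

lemma smooth_on_component: "open S \<Longrightarrow> smooth_on S f \<Longrightarrow> smooth_on S (\<lambda>x. f x $ i)"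
  by (simp add: smooth_on_def Ck_on_component)

locale smooth_manifold =
  fixes \<A> :: "('a::t2_space, 'm::finite) chart set"
  assumes atlas: "smooth_atlas \<A>"
begin

lemma chart_exists: "\<exists>U \<phi>. (U, \<phi>) \<in> \<A> \<and> x \<in> U"
proof -
  have "x \<in> (\<Union>(U, \<phi>)\<in>\<A>. U)"
    using atlas unfolding smooth_atlas_def by simp
  then show ?thesis by auto
qed

lemma chartD:
  assumes "(U, \<phi>) \<in> \<A>"
  shows "open U" "open (\<phi> ` U)" "homeomorphism U (\<phi> ` U) \<phi> (inv_into U \<phi>)"
  using assms atlas unfolding smooth_atlas_def by blast+

lemma transition_smooth:
  assumes "(U, \<phi>) \<in> \<A>" "(U', \<psi>) \<in> \<A>"
  shows "smooth_on (\<phi> ` (U \<inter> U')) (\<psi> \<circ> inv_into U \<phi>)"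
  using assms atlas unfolding smooth_atlas_def by blast

lemma chart_inverse:
  assumes "(U, \<phi>) \<in> \<A>"
  shows "x \<in> U \<Longrightarrow> inv_into U \<phi> (\<phi> x) = x" "u \<in> \<phi> ` U \<Longrightarrow> \<phi> (inv_into U \<phi> u) = u"
    "u \<in> \<phi> ` U \<Longrightarrow> inv_into U \<phi> u \<in> U"
  using chartD(3)[OF assms] by (auto simp: homeomorphism_def)

lemma chart_continuous:
  assumes "(U, \<phi>) \<in> \<A>"
  shows "continuous_on U \<phi>" "continuous_on (\<phi> ` U) (inv_into U \<phi>)" "inj_on \<phi> U"
proof -
  show "continuous_on U \<phi>" "continuous_on (\<phi> ` U) (inv_into U \<phi>)"
    using chartD(3)[OF assms] by (auto simp: homeomorphism_def)
  show "inj_on \<phi> U"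
    using chart_inverse(1)[OF assms] by (metis inj_on_inverseI)
qed

lemma chart_image_eq:
  assumes "(U, \<phi>) \<in> \<A>"
  shows "\<phi> ` (U \<inter> W) = {u \<in> \<phi> ` U. inv_into U \<phi> u \<in> W}"
  using chart_inverse[OF assms] by force

lemma open_chart_image:
  assumes "(U, \<phi>) \<in> \<A>" "open W"
  shows "open (\<phi> ` (U \<inter> W))"
proof -
  have "open (\<phi> ` U \<inter> inv_into U \<phi> -` W)"
    by (rule continuous_open_preimage[OF chart_continuous(2)[OF assms(1)] chartD(2)[OF assms(1)] assms(2)])
  moreover have "\<phi> ` (U \<inter> W) = \<phi> ` U \<inter> inv_into U \<phi> -` W"
    unfolding chart_image_eq[OF assms(1)] by auto
  ultimately show ?thesis by simp
qed

lemma open_chart_vimage: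
  assumes "(U, \<phi>) \<in> \<A>" "open S"
  shows "open {x \<in> U. \<phi> x \<in> S}"
  using continuous_open_preimage[OF chart_continuous(1)[OF assms(1)] chartD(1)[OF assms(1)] assms(2)]
  by (simp add: vimage_def Int_def)

lemma smooth_fun_onD:
  "smooth_fun_on \<A> W f \<Longrightarrow> (U, \<phi>) \<in> \<A> \<Longrightarrow> smooth_on (\<phi> ` (U \<inter> W)) (f \<circ> inv_into U \<phi>)"
  by (auto simp: smooth_fun_on_def)

lemma C_infinityD: "v \<in> C_infinity \<A> \<Longrightarrow> (U, \<phi>) \<in> \<A> \<Longrightarrow> smooth_on (\<phi> ` U) (v \<circ> inv_into U \<phi>)"
  using smooth_fun_onD[of UNIV v U \<phi>] by (simp add: C_infinity_def)

lemma C_infinity_smooth_near: "v \<in> C_infinity \<A> \<Longrightarrow> smooth_near \<A> x v"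
  by (auto simp: C_infinity_def smooth_near_def intro: exI[of _ UNIV])

lemma smooth_near_has_derivative:
  assumes f: "smooth_near \<A> x f" and c: "(U, \<phi>) \<in> \<A>" "x \<in> U"
  shows "((f \<circ> inv_into U \<phi>) has_derivative frechet_derivative (f \<circ> inv_into U \<phi>) (at (\<phi> x))) (at (\<phi> x))"
proof -
  obtain W where "x \<in> W" "smooth_fun_on \<A> W f"
    using f by (auto simp: smooth_near_def)
  then show ?thesis
    using c by (intro smooth_on_has_derivative[OF smooth_fun_onD]) auto
qed

lemma coord_vector_apply:
  "smooth_near \<A> x f \<Longrightarrow> coord_vector \<A> (U, \<phi>) x w f = frechet_derivative (f \<circ> inv_into U \<phi>) (at (\<phi> x)) w"
  by (simp add: coord_vector_def)

lemma coord_vector_linear: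
  assumes c: "(U, \<phi>) \<in> \<A>" "x \<in> U"
  shows "linear (coord_vector \<A> (U, \<phi>) x)"
proof (rule linearI)
  have lin: "linear (frechet_derivative (f \<circ> inv_into U \<phi>) (at (\<phi> x)))" if "smooth_near \<A> x f" for f
    using smooth_near_has_derivative[OF that c] by (rule has_derivative_linear)
  show "coord_vector \<A> (U, \<phi>) x (a + b) = coord_vector \<A> (U, \<phi>) x a + coord_vector \<A> (U, \<phi>) x b" for a b
    using linear_add[OF lin] by (auto simp: coord_vector_def fun_eq_iff)
  show "coord_vector \<A> (U, \<phi>) x (r *\<^sub>R a) = r *\<^sub>R coord_vector \<A> (U, \<phi>) x a" for r a
    using linear_cmul[OF lin] by (auto simp: coord_vector_def fun_eq_iff scaleR_fun_def)
qed

text \<open>Coordinate functions are smooth, so a tangent vector determines its components.\<close>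

lemma coord_vector_coordinate:
  assumes c: "(U, \<phi>) \<in> \<A>" "x \<in> U"
  shows "coord_vector \<A> (U, \<phi>) x w (\<lambda>y. \<phi> y $ i) = w $ i"
proof -
  have "smooth_fun_on \<A> U (\<lambda>y. \<phi> y $ i)"
    unfolding smooth_fun_on_def
  proof safe
    fix U' \<psi> assume c': "(U', \<psi>) \<in> \<A>"
    have "smooth_on (\<psi> ` (U' \<inter> U)) (\<lambda>u. (\<phi> \<circ> inv_into U' \<psi>) u $ i)"
      by (rule smooth_on_component[OF open_chart_image[OF c' chartD(1)[OF c(1)]] transition_smooth[OF c' c(1)]])
    then show "smooth_on (\<psi> ` (U' \<inter> U)) ((\<lambda>y. \<phi> y $ i) \<circ> inv_into U' \<psi>)"
      by (simp add: comp_def)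
  qed
  then have "smooth_near \<A> x (\<lambda>y. \<phi> y $ i)"
    using c chartD(1) by (auto simp: smooth_near_def)
  then have "coord_vector \<A> (U, \<phi>) x w (\<lambda>y. \<phi> y $ i) = frechet_derivative ((\<lambda>y. \<phi> y $ i) \<circ> inv_into U \<phi>) (at (\<phi> x)) w"
    by (rule coord_vector_apply)
  also have "frechet_derivative ((\<lambda>y. \<phi> y $ i) \<circ> inv_into U \<phi>) (at (\<phi> x)) = (\<lambda>w. w $ i)"
  proof (rule frechet_derivative_at[symmetric])
    show "(((\<lambda>y. \<phi> y $ i) \<circ> inv_into U \<phi>) has_derivative (\<lambda>w. w $ i)) (at (\<phi> x))"
    proof (rule has_derivative_transform_within_open[OF bounded_linear_imp_has_derivative[OF bounded_linear_vec_nth]])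
      show "open (\<phi> ` U)" by (rule chartD(2)[OF c(1)])
    qed (use c chart_inverse(2)[OF c(1)] in auto)
  qed
  finally show ?thesis .
qed

lemma coord_vector_inj:
  assumes c: "(U, \<phi>) \<in> \<A>" "x \<in> U" and eq: "coord_vector \<A> (U, \<phi>) x a = coord_vector \<A> (U, \<phi>) x b"
  shows "a = b"
  using coord_vector_coordinate[OF c, of a] coord_vector_coordinate[OF c, of b] eq
  by (simp add: vec_eq_iff)

abbreviation transition where
  "transition U \<phi> \<psi> \<equiv> \<psi> \<circ> inv_into U \<phi>"

lemma transition_has_derivative:
  assumes c: "(U, \<phi>) \<in> \<A>" and c': "(U', \<psi>) \<in> \<A>" and x: "u \<in> \<phi> ` (U \<inter> U')"
  shows "(transition U \<phi> \<psi> has_derivative frechet_derivative (transition U \<phi> \<psi>) (at u)) (at u)"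
  by (rule smooth_on_has_derivative[OF transition_smooth[OF c c'] x])

text \<open>The chain rule for \<open>f \<circ> \<phi>\<^sup>-\<^sup>1 = (f \<circ> \<psi>\<^sup>-\<^sup>1) \<circ> (\<psi> \<circ> \<phi>\<^sup>-\<^sup>1)\<close>.\<close>

lemma coord_vector_change:
  assumes c: "(U, \<phi>) \<in> \<A>" "x \<in> U" and c': "(U', \<psi>) \<in> \<A>" "x \<in> U'"
  shows "coord_vector \<A> (U, \<phi>) x w
    = coord_vector \<A> (U', \<psi>) x (frechet_derivative (transition U \<phi> \<psi>) (at (\<phi> x)) w)"
proof
  fix f
  let ?\<theta> = "transition U \<phi> \<psi>"
  show "coord_vector \<A> (U, \<phi>) x w f = coord_vector \<A> (U', \<psi>) x (frechet_derivative ?\<theta> (at (\<phi> x)) w) f"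
  proof (cases "smooth_near \<A> x f")
    case True
    have \<theta>x: "?\<theta> (\<phi> x) = \<psi> x"
      using chart_inverse(1)[OF c] by simp
    have x: "\<phi> x \<in> \<phi> ` (U \<inter> U')" using c c' by auto
    have "((f \<circ> inv_into U' \<psi>) \<circ> ?\<theta> has_derivative
        frechet_derivative (f \<circ> inv_into U' \<psi>) (at (\<psi> x)) \<circ> frechet_derivative ?\<theta> (at (\<phi> x))) (at (\<phi> x))"
      using smooth_near_has_derivative[OF True c'] transition_has_derivative[OF c(1) c'(1) x]
      by (intro diff_chain_at) (simp_all add: \<theta>x del: comp_apply)
    then have "(f \<circ> inv_into U \<phi> has_derivative
        frechet_derivative (f \<circ> inv_into U' \<psi>) (at (\<psi> x)) \<circ> frechet_derivative ?\<theta> (at (\<phi> x))) (at (\<phi> x))"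
    proof (rule has_derivative_transform_within_open)
      show "open (\<phi> ` (U \<inter> U'))"
        by (rule open_chart_image[OF c(1) chartD(1)[OF c'(1)]])
      show "((f \<circ> inv_into U' \<psi>) \<circ> ?\<theta>) u = (f \<circ> inv_into U \<phi>) u" if "u \<in> \<phi> ` (U \<inter> U')" for u
        using that chart_inverse(1)[OF c(1)] chart_inverse(1)[OF c'(1)] by auto
    qed (rule x)
    from frechet_derivative_at[OF this, symmetric] show ?thesis
      by (simp add: coord_vector_apply[OF True])
  qed (simp add: coord_vector_def)
qed

lemma tangent_space_eq:
  assumes c: "(U, \<phi>) \<in> \<A>" "x \<in> U"
  shows "tangent_space \<A> x = range (coord_vector \<A> (U, \<phi>) x)"
proof (intro equalityI subsetI)
  fix X assume "X \<in> tangent_space \<A> x"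
  then obtain U' \<psi> w where "(U', \<psi>) \<in> \<A>" "x \<in> U'" "X = coord_vector \<A> (U', \<psi>) x w"
    unfolding tangent_space_def by auto
  then show "X \<in> range (coord_vector \<A> (U, \<phi>) x)"
    using coord_vector_change[OF _ _ c, of U' \<psi> w] by simp
next
  fix X assume "X \<in> range (coord_vector \<A> (U, \<phi>) x)"
  then obtain w where "X = coord_vector \<A> (U, \<phi>) x w" by blast
  then show "X \<in> tangent_space \<A> x"
    unfolding tangent_space_def using c by (intro CollectI exI[of _ "(U, \<phi>)"] exI[of _ w]) simp
qed

lemma smooth_on_directional:
  assumes v: "v \<in> C_infinity \<A>" and c: "(U, \<phi>) \<in> \<A>"
  shows "smooth_on (\<phi> ` U) (\<lambda>u. frechet_derivative (v \<circ> inv_into U \<phi>) (at u) w)"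
  by (rule smooth_on_derivative[OF C_infinityD[OF v c]])

text \<open>A tangent vector is \<open>0\<close> on functions that are not smooth near its base point; this lemma is what makes
it differentiate the function \<open>\<partial>\<^sub>w v\<close> in the definition of the Hessian.\<close>

lemma smooth_near_coord_derivative:
  assumes v: "v \<in> C_infinity \<A>" and c: "(U, \<phi>) \<in> \<A>" "x \<in> U"
  shows "smooth_near \<A> x (\<lambda>y. coord_vector \<A> (U, \<phi>) y w v)"
proof -
  have "smooth_fun_on \<A> U (\<lambda>y. coord_vector \<A> (U, \<phi>) y w v)"
    unfolding smooth_fun_on_def
  proof safe
    fix U' \<psi> assume c': "(U', \<psi>) \<in> \<A>"
    have open': "open (\<psi> ` (U' \<inter> U))"
      by (rule open_chart_image[OF c' chartD(1)[OF c(1)]])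
    have "smooth_on (\<psi> ` (U' \<inter> U)) (\<lambda>u. frechet_derivative (v \<circ> inv_into U \<phi>) (at (transition U' \<psi> \<phi> u)) w)"
      using chart_inverse(1)[OF c']
      by (intro smooth_on_compose[OF open' chartD(2)[OF c(1)] transition_smooth[OF c' c(1)] _ smooth_on_directional[OF v c(1)]]) auto
    then show "smooth_on (\<psi> ` (U' \<inter> U)) ((\<lambda>y. coord_vector \<A> (U, \<phi>) y w v) \<circ> inv_into U' \<psi>)"
      by (rule smooth_on_cong[OF open', rotated]) (simp add: coord_vector_apply C_infinity_smooth_near[OF v])
  qed
  then show ?thesis
    using c chartD(1) by (auto simp: smooth_near_def)
qed

lemma gradient_expansion:
  assumes v: "v \<in> C_infinity \<A>" and c: "(U, \<phi>) \<in> \<A>" and u: "u \<in> \<phi> ` U"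
  shows "frechet_derivative (v \<circ> inv_into U \<phi>) (at u) w
    = (\<Sum>j\<in>UNIV. frechet_derivative (v \<circ> inv_into U \<phi>) (at u) (axis j 1) * w $ j)"
proof -
  let ?D = "frechet_derivative (v \<circ> inv_into U \<phi>) (at u)"
  have lin: "linear ?D"
    by (rule has_derivative_linear[OF smooth_on_has_derivative[OF C_infinityD[OF v c] u]])
  have "?D w = ?D (\<Sum>j\<in>UNIV. w $ j *\<^sub>R axis j 1)"
    by (simp add: basis_expansion[of w, unfolded scalar_mult_eq_scaleR])
  also have "\<dots> = (\<Sum>j\<in>UNIV. ?D (axis j 1) * w $ j)"
    using lin by (simp add: linear_sum linear_cmul mult.commute)
  finally show ?thesis .
qed

text \<open>At a critical point every chart gives the same value, so the description that defines the Hessian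
determines it.  Let \<open>w\<close> represent in the chart \<open>\<psi>\<close> the vector \<open>b\<close> of the chart \<open>\<phi>\<close>.  By the chain rule
\<open>\<partial>\<^sub>b v\<close> in the chart \<open>\<phi>\<close> minus \<open>\<partial>\<^sub>w v\<close> in the chart \<open>\<psi>\<close> is \<open>\<Sum>\<^sub>j p\<^sub>j q\<^sub>j\<close>, where the \<open>p\<^sub>j\<close> are the partial
derivatives of \<open>v\<close> in the chart \<open>\<psi>\<close> and \<open>q\<close> is \<open>w\<close> subtracted from the image of \<open>b\<close> under the
derivative of the transition map.
Both factors vanish at \<open>x\<close>, hence so does the derivative of the sum.\<close>

lemma hessian_eq:
  assumes v: "v \<in> C_infinity \<A>" and c: "(U, \<phi>) \<in> \<A>" "x \<in> U"
    and crit: "\<And>X. X \<in> tangent_space \<A> x \<Longrightarrow> X v = 0"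
  shows "hessian \<A> x v (coord_vector \<A> (U, \<phi>) x a) (coord_vector \<A> (U, \<phi>) x b)
    = frechet_derivative (\<lambda>u. frechet_derivative (v \<circ> inv_into U \<phi>) (at u) b) (at (\<phi> x)) a"
proof -
  let ?X = "coord_vector \<A> (U, \<phi>) x a" and ?u = "\<phi> x"
  let ?Dv = "\<lambda>u. frechet_derivative (v \<circ> inv_into U \<phi>) (at u) b"
  have key: "?X (\<lambda>y. coord_vector \<A> (U', \<psi>) y w v) = frechet_derivative ?Dv (at ?u) a"
    if c': "(U', \<psi>) \<in> \<A>" "x \<in> U'" and w: "coord_vector \<A> (U', \<psi>) x w = coord_vector \<A> (U, \<phi>) x b" for U' \<psi> w
  proof -
    let ?\<theta> = "transition U \<phi> \<psi>" and ?S = "\<phi> ` (U \<inter> U')"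
    let ?F = "\<lambda>y. coord_vector \<A> (U', \<psi>) y w v"
    let ?vw = "v \<circ> inv_into U' \<psi>"
    have S: "open ?S" "?u \<in> ?S"
      using open_chart_image[OF c(1) chartD(1)[OF c'(1)]] c c' by auto
    have \<theta>u: "?\<theta> ?u = \<psi> x"
      using chart_inverse(1)[OF c] by simp
    have \<theta>S: "?\<theta> u \<in> \<psi> ` U'" if "u \<in> ?S" for u
      using that chart_inverse(1)[OF c(1)] by auto
    have b: "w = frechet_derivative ?\<theta> (at ?u) b"
      using coord_vector_inj[OF c'] w coord_vector_change[OF c c'] by metis
    have grad0: "frechet_derivative ?vw (at (\<psi> x)) z = 0" for z
      using crit[of "coord_vector \<A> (U', \<psi>) x z"] tangent_space_eq[OF c']
      by (simp add: coord_vector_apply C_infinity_smooth_near[OF v])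
    define p where "p = (\<lambda>j u. frechet_derivative ?vw (at (?\<theta> u)) (axis j 1))"
    define q where "q = (\<lambda>j u. (frechet_derivative ?\<theta> (at u) b - w) $ j)"
    have p0: "p j ?u = 0" for j
      unfolding p_def \<theta>u by (rule grad0)
    have q0: "q j ?u = 0" for j
      by (simp add: q_def b)
    have FD: "?Dv u - (?F \<circ> inv_into U \<phi>) u = (\<Sum>j\<in>UNIV. p j u * q j u)" if u: "u \<in> ?S" for u
    proof -
      have "((?vw \<circ> ?\<theta>) has_derivative frechet_derivative ?vw (at (?\<theta> u)) \<circ> frechet_derivative ?\<theta> (at u)) (at u)"
        by (rule diff_chain_at[OF transition_has_derivative[OF c(1) c'(1) u]
              smooth_on_has_derivative[OF C_infinityD[OF v c'(1)] \<theta>S[OF u]]])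
      then have "((v \<circ> inv_into U \<phi>) has_derivative frechet_derivative ?vw (at (?\<theta> u)) \<circ> frechet_derivative ?\<theta> (at u)) (at u)"
      proof (rule has_derivative_transform_within_open[OF _ S(1) u])
        show "(?vw \<circ> ?\<theta>) z = (v \<circ> inv_into U \<phi>) z" if "z \<in> ?S" for z
          using that chart_inverse(1)[OF c(1)] chart_inverse(1)[OF c'(1)] by auto
      qed
      from fun_cong[OF frechet_derivative_at[OF this], of b]
      have "?Dv u = frechet_derivative ?vw (at (?\<theta> u)) (frechet_derivative ?\<theta> (at u) b)"
        by (simp only: comp_apply)
      also have "\<dots> = (\<Sum>j\<in>UNIV. p j u * (frechet_derivative ?\<theta> (at u) b) $ j)"
        unfolding p_def by (rule gradient_expansion[OF v c'(1) \<theta>S[OF u]])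
      finally have 1: "?Dv u = (\<Sum>j\<in>UNIV. p j u * (frechet_derivative ?\<theta> (at u) b) $ j)" .
      have "(?F \<circ> inv_into U \<phi>) u = frechet_derivative ?vw (at (?\<theta> u)) w"
        by (simp add: coord_vector_apply C_infinity_smooth_near[OF v])
      also have "\<dots> = (\<Sum>j\<in>UNIV. p j u * w $ j)"
        unfolding p_def by (rule gradient_expansion[OF v c'(1) \<theta>S[OF u]])
      finally show ?thesis
        using 1 by (simp add: q_def sum_subtractf right_diff_distrib)
    qed
    have p_diff: "(p j has_derivative frechet_derivative (p j) (at ?u)) (at ?u)" for j
    proof -
      have "smooth_on ?S (p j)"
        unfolding p_def
        by (rule smooth_on_compose[OF S(1) chartD(2)[OF c'(1)] transition_smooth[OF c(1) c'(1)] _ smooth_on_directional[OF v c'(1)]])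
           (use \<theta>S in blast)
      then show ?thesis using S(2) by (rule smooth_on_has_derivative)
    qed
    have q_diff: "(q j has_derivative (\<lambda>z. frechet_derivative (\<lambda>u. frechet_derivative ?\<theta> (at u) b) (at ?u) z $ j)) (at ?u)" for j
    proof -
      have "((\<lambda>u. frechet_derivative ?\<theta> (at u) b) has_derivative frechet_derivative (\<lambda>u. frechet_derivative ?\<theta> (at u) b) (at ?u)) (at ?u)"
        by (rule smooth_on_has_derivative[OF smooth_on_derivative[OF transition_smooth[OF c(1) c'(1)]] S(2)])
      then have "((\<lambda>u. frechet_derivative ?\<theta> (at u) b $ j - w $ j) has_derivative
          (\<lambda>z. frechet_derivative (\<lambda>u. frechet_derivative ?\<theta> (at u) b) (at ?u) z $ j - 0)) (at ?u)"
        by (intro has_derivative_diff bounded_linear.has_derivative[OF bounded_linear_vec_nth] has_derivative_const)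
      then show ?thesis by (simp add: q_def)
    qed
    have "((\<lambda>u. \<Sum>j\<in>UNIV. p j u * q j u) has_derivative (\<lambda>z. \<Sum>j\<in>(UNIV::'m set). 0)) (at ?u)"
    proof (rule has_derivative_sum)
      fix j
      show "((\<lambda>u. p j u * q j u) has_derivative (\<lambda>z. 0)) (at ?u)"
        using has_derivative_mult[OF p_diff[of j] q_diff[of j]] by (simp add: p0 q0)
    qed
    then have "((\<lambda>u. \<Sum>j\<in>UNIV. p j u * q j u) has_derivative (\<lambda>z. 0)) (at ?u)"
      by (simp only: sum.neutral_const)
    then have diff0: "((\<lambda>u. ?Dv u - (?F \<circ> inv_into U \<phi>) u) has_derivative (\<lambda>z. 0)) (at ?u)"
      by (rule has_derivative_transform_within_open[OF _ S]) (rule FD[symmetric])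
    have "(?Dv has_derivative frechet_derivative ?Dv (at ?u)) (at ?u)"
      using c by (intro smooth_on_has_derivative[OF smooth_on_directional[OF v c(1)]]) auto
    from has_derivative_diff[OF this diff0]
    have "((?F \<circ> inv_into U \<phi>) has_derivative frechet_derivative ?Dv (at ?u)) (at ?u)"
      by (simp del: comp_apply)
    from frechet_derivative_at[OF this] show ?thesis
      unfolding coord_vector_apply[OF smooth_near_coord_derivative[OF v c']] by simp
  qed
  show ?thesis
    unfolding hessian_def
  proof (rule the_equality)
    show "\<forall>c\<in>\<A>. x \<in> fst c \<longrightarrow> (\<forall>w. coord_vector \<A> c x w = coord_vector \<A> (U, \<phi>) x b \<longrightarrow>
        ?X (\<lambda>y. coord_vector \<A> c y w v) = frechet_derivative ?Dv (at ?u) a)"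
      using key by auto
    fix r assume "\<forall>c\<in>\<A>. x \<in> fst c \<longrightarrow> (\<forall>w. coord_vector \<A> c x w = coord_vector \<A> (U, \<phi>) x b \<longrightarrow>
        ?X (\<lambda>y. coord_vector \<A> c y w v) = r)"
    then have "?X (\<lambda>y. coord_vector \<A> (U, \<phi>) y b v) = r"
      using c by auto
    then show "r = frechet_derivative ?Dv (at ?u) a"
      using key[OF c refl] by simp
  qed
qed

end

section \<open>Orthonormal bases of abstract Euclidean spaces\<close>

lemma inner_product_onD:
  assumes "inner_product_on W h"
  shows "\<And>x y z. x \<in> W \<Longrightarrow> y \<in> W \<Longrightarrow> z \<in> W \<Longrightarrow> h (x + y) z = h x z + h y z"
    "\<And>c x y. x \<in> W \<Longrightarrow> y \<in> W \<Longrightarrow> h (c *\<^sub>R x) y = c * h x y"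
    "\<And>x y. x \<in> W \<Longrightarrow> y \<in> W \<Longrightarrow> h x y = h y x"
    "\<And>x. x \<in> W \<Longrightarrow> x \<noteq> 0 \<Longrightarrow> 0 < h x x"
proof -
  note D = assms[unfolded inner_product_on_def]
  show "h (x + y) z = h x z + h y z" if "x \<in> W" "y \<in> W" "z \<in> W" for x y z
    by (rule D[THEN conjunct1, rule_format, OF that])
  show "h (c *\<^sub>R x) y = c * h x y" if "x \<in> W" "y \<in> W" for c x y
    by (rule D[THEN conjunct2, THEN conjunct1, rule_format, OF that])
  show "h x y = h y x" if "x \<in> W" "y \<in> W" for x y
    by (rule D[THEN conjunct2, THEN conjunct2, THEN conjunct1, rule_format, OF that])
  show "0 < h x x" if "x \<in> W" "x \<noteq> 0" for x
    by (rule D[THEN conjunct2, THEN conjunct2, THEN conjunct2, rule_format, OF that])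
qed

lemma inner_product_on_sum_left:
  assumes W: "subspace W" "inner_product_on W h" and I: "\<And>i. i \<in> I \<Longrightarrow> f i \<in> W" and z: "z \<in> W"
  shows "h (\<Sum>i\<in>I. c i *\<^sub>R f i) z = (\<Sum>i\<in>I. c i * h (f i) z)"
proof -
  have zero: "h 0 z = 0"
    using inner_product_onD(2)[OF W(2) subspace_0[OF W(1)] z, of 0] by simp
  show ?thesis
    using I
  proof (induction I rule: infinite_finite_induct)
    case (insert i I)
    have "(\<Sum>i\<in>I. c i *\<^sub>R f i) \<in> W"
      using insert.prems by (intro subspace_sum subspace_scale W) auto
    moreover have "c i *\<^sub>R f i \<in> W"
      using insert.prems by (intro subspace_scale W) auto
    ultimately show ?case
      using insert by (simp add: inner_product_onD(1,2)[OF W(2)] z)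
  qed (simp_all add: zero)
qed

lemma inner_product_on_sum_right:
  assumes W: "subspace W" "inner_product_on W h" and I: "\<And>i. i \<in> I \<Longrightarrow> f i \<in> W" and z: "z \<in> W"
  shows "h z (\<Sum>i\<in>I. c i *\<^sub>R f i) = (\<Sum>i\<in>I. c i * h z (f i))"
proof -
  have "(\<Sum>i\<in>I. c i *\<^sub>R f i) \<in> W"
    by (intro subspace_sum subspace_scale W I)
  then have "h z (\<Sum>i\<in>I. c i *\<^sub>R f i) = h (\<Sum>i\<in>I. c i *\<^sub>R f i) z"
    using inner_product_onD(3)[OF W(2)] z by blast
  also have "\<dots> = (\<Sum>i\<in>I. c i * h (f i) z)"
    by (rule inner_product_on_sum_left[OF W I z])
  also have "\<dots> = (\<Sum>i\<in>I. c i * h z (f i))"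
    using inner_product_onD(3)[OF W(2)] I z by (intro sum.cong refl) auto
  finally show ?thesis .
qed

lemma gram_schmidt:
  assumes W: "subspace W" "inner_product_on W h" and S: "finite S" "S \<subseteq> W"
  shows "\<exists>B. orthonormal_basis h (span S) B"
  using S
proof (induction S rule: finite_induct)
  case empty
  then show ?case by (intro exI[of _ "{}"]) (simp add: orthonormal_basis_def)
next
  case (insert a S)
  then obtain B where B: "finite B" "span B = span S"
    "\<And>b c. b \<in> B \<Longrightarrow> c \<in> B \<Longrightarrow> h b c = (if b = c then 1 else 0)"
    by (auto simp: orthonormal_basis_def)
  have "span S \<subseteq> W"
    using insert.prems by (intro span_minimal W) auto
  then have BW: "b \<in> W" if "b \<in> B" for b
    using that B(2) span_base by blast
  have aW: "a \<in> W" using insert.prems by simp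
  define p where "p = (\<Sum>b\<in>B. h a b *\<^sub>R b)"
  have pW: "p \<in> W"
    unfolding p_def by (intro subspace_sum subspace_scale W BW)
  have p_span: "p \<in> span B"
    unfolding p_def by (intro span_sum span_scale span_base)
  define a' where "a' = a - p"
  have a'W: "a' \<in> W"
    unfolding a'_def by (rule subspace_diff[OF W(1) aW pW])
  have orth: "h a' b = 0" if b: "b \<in> B" for b
  proof -
    have "h a b = h (a' + p) b" by (simp add: a'_def)
    also have "\<dots> = h a' b + h p b"
      by (rule inner_product_onD(1)[OF W(2) a'W pW BW[OF b]])
    also have "h p b = (\<Sum>c\<in>B. h a c * h c b)"
      unfolding p_def by (rule inner_product_on_sum_left[OF W BW BW[OF b]])
    also have "\<dots> = (\<Sum>c\<in>B. if c = b then h a c else 0)"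
      using B(3) b by (intro sum.cong) auto
    also have "\<dots> = h a b" using B(1) b by simp
    finally show ?thesis by simp
  qed
  show ?case
  proof (cases "a' = 0")
    case True
    then have "a \<in> span S" using p_span B(2) by (simp add: a'_def)
    then have "span (insert a S) = span S" by (rule span_redundant)
    then show ?thesis
      using B by (intro exI[of _ B]) (auto simp: orthonormal_basis_def)
  next
    case False
    then have pos: "0 < h a' a'" by (rule inner_product_onD(4)[OF W(2) a'W])
    define n where "n = sqrt (h a' a')"
    define c where "c = (1 / n) *\<^sub>R a'"
    have n: "0 < n" "n * n = h a' a'" using pos by (simp_all add: n_def)
    have cW: "c \<in> W" unfolding c_def by (rule subspace_scale[OF W(1) a'W])
    have cb: "h c b = 0" if "b \<in> B" for b
      unfolding c_def using inner_product_onD(2)[OF W(2) a'W BW[OF that]] orth[OF that] by simp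
    have bc: "h b c = 0" if "b \<in> B" for b
      using cb[OF that] inner_product_onD(3)[OF W(2) cW BW[OF that]] by simp
    have cc: "h c c = 1"
    proof -
      have "h c c = (1 / n) * h a' c"
        by (subst (1) c_def) (rule inner_product_onD(2)[OF W(2) a'W cW])
      also have "h a' c = h c a'" by (rule inner_product_onD(3)[OF W(2) a'W cW])
      also have "\<dots> = (1 / n) * h a' a'"
        by (subst c_def) (rule inner_product_onD(2)[OF W(2) a'W a'W])
      finally show ?thesis using n pos by (simp add: field_simps)
    qed
    have "c \<notin> B" using cb[of c] cc by auto
    have "span (insert c B) = span (insert a S)"
      unfolding span_eq
    proof (intro conjI subsetI)
      fix x assume "x \<in> insert c B"
      have sub: "span B \<subseteq> span (insert a S)"
        unfolding B(2) by (rule span_mono) auto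
      have "c \<in> span (insert a S)"
        unfolding c_def a'_def using sub p_span by (intro span_scale span_diff) (auto intro: span_base)
      then show "x \<in> span (insert a S)"
        using \<open>x \<in> insert c B\<close> sub span_base[of x B] by blast
    next
      fix x assume x: "x \<in> insert a S"
      have sub: "span B \<subseteq> span (insert c B)" by (rule span_mono) auto
      have "a = n *\<^sub>R c + p" using n(1) by (simp add: c_def a'_def)
      then have "a \<in> span (insert c B)"
        using sub p_span by (auto intro!: span_add span_scale intro: span_base)
      then show "x \<in> span (insert c B)"
        using x sub B(2) span_base[of x S] by blast
    qed
    then have "orthonormal_basis h (span (insert a S)) (insert c B)"
      using B(1,3) cb bc cc \<open>c \<notin> B\<close> by (auto simp: orthonormal_basis_def)
    then show ?thesis by blast
  qed
qed

lemma orthonormal_basis_exists: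
  assumes W: "subspace W" "inner_product_on W h" and fin: "finite T" "W \<subseteq> span T"
    and K: "subspace K" "K \<subseteq> W"
  shows "\<exists>B. orthonormal_basis h K B"
proof -
  obtain S where S: "S \<subseteq> K" "independent S" "K \<subseteq> span S"
    by (rule basis_exists[of K])
  have SW: "S \<subseteq> W"
    using S(1) K(2) by (rule order_trans)
  have "finite S"
    using independent_span_bound[OF fin(1) S(2) order_trans[OF SW fin(2)]] by simp
  from gram_schmidt[OF W this SW] show ?thesis
    unfolding span_subspace[OF S(1,3) K(1)] .
qed

lemma abstract_orthonormal_independent:
  assumes W: "subspace W" "inner_product_on W h" and B: "orthonormal_basis h W B"
  shows "independent B"
proof (rule independent_if_scalars_zero)
  show fin: "finite B" using B by (simp add: orthonormal_basis_def)
  have BW: "b \<in> W" if "b \<in> B" for b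
    using B that span_base[of b B] by (simp add: orthonormal_basis_def)
  fix c b assume 0: "(\<Sum>b\<in>B. c b *\<^sub>R b) = 0" and b: "b \<in> B"
  have "0 = h (\<Sum>b\<in>B. c b *\<^sub>R b) b"
    unfolding 0 using inner_product_onD(2)[OF W(2) subspace_0[OF W(1)] BW[OF b], of 0] by simp
  also have "\<dots> = (\<Sum>a\<in>B. c a * h a b)"
    by (rule inner_product_on_sum_left[OF W BW BW[OF b]])
  also have "\<dots> = (\<Sum>a\<in>B. if a = b then c a else 0)"
    using B b by (intro sum.cong) (auto simp: orthonormal_basis_def)
  also have "\<dots> = c b" using fin b by simp
  finally show "c b = 0" by simp
qed

text \<open>Coordinates with respect to an orthonormal basis of the whole space; they are isometric coordinates on
each of its subspaces.\<close>

locale orthonormal_coordinates =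
  fixes V :: "'v::real_vector set" and h :: "'v \<Rightarrow> 'v \<Rightarrow> real" and b :: "'n::finite \<Rightarrow> 'v"
  assumes V: "subspace V" "inner_product_on V h"
    and inj_b: "inj b" and onb: "orthonormal_basis h V (range b)"
begin

definition \<kappa> :: "'v \<Rightarrow> real^'n" where
  "\<kappa> v = (\<chi> k. h v (b k))"

lemma b_in_V: "b k \<in> V"
proof -
  have "span (range b) = V" using onb by (simp add: orthonormal_basis_def)
  then show ?thesis using span_base[of "b k" "range b"] by simp
qed

lemma h_b: "h (b k) (b l) = (if k = l then 1 else 0)"
  using onb inj_b by (auto simp: orthonormal_basis_def inj_eq)

lemma combination_in_V: "(\<Sum>k\<in>UNIV. c k *\<^sub>R b k) \<in> V"
  by (intro subspace_sum subspace_scale V b_in_V)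

lemma \<kappa>_combination: "\<kappa> (\<Sum>k\<in>UNIV. c k *\<^sub>R b k) = (\<chi> k. c k)"
  by (simp add: \<kappa>_def vec_eq_iff inner_product_on_sum_left[OF V b_in_V b_in_V] h_b if_distrib cong: if_cong)

lemma expansion: "v \<in> V \<Longrightarrow> v = (\<Sum>k\<in>UNIV. \<kappa> v $ k *\<^sub>R b k)"
proof -
  assume "v \<in> V"
  then have "v \<in> span (range b)" using onb by (simp add: orthonormal_basis_def)
  then obtain u where "v = (\<Sum>x\<in>range b. u x *\<^sub>R x)"
    by (auto simp: span_finite)
  then have "v = (\<Sum>k\<in>UNIV. u (b k) *\<^sub>R b k)"
    by (simp add: sum.reindex inj_b)
  then show ?thesis
    using \<kappa>_combination[of "\<lambda>k. u (b k)"] by simp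
qed

lemma \<kappa>_add: "x \<in> V \<Longrightarrow> y \<in> V \<Longrightarrow> \<kappa> (x + y) = \<kappa> x + \<kappa> y"
  by (simp add: \<kappa>_def vec_eq_iff inner_product_onD(1)[OF V(2)] b_in_V)

lemma \<kappa>_scaleR: "x \<in> V \<Longrightarrow> \<kappa> (c *\<^sub>R x) = c *\<^sub>R \<kappa> x"
  by (simp add: \<kappa>_def vec_eq_iff inner_product_onD(2)[OF V(2)] b_in_V)

lemma h_\<kappa>: "x \<in> V \<Longrightarrow> y \<in> V \<Longrightarrow> h x y = \<kappa> x \<bullet> \<kappa> y"
proof -
  assume x: "x \<in> V" and y: "y \<in> V"
  have "h x y = h x (\<Sum>k\<in>UNIV. \<kappa> y $ k *\<^sub>R b k)"
    using expansion[OF y] by simp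
  also have "\<dots> = (\<Sum>k\<in>UNIV. \<kappa> y $ k * h x (b k))"
    by (rule inner_product_on_sum_right[OF V b_in_V x])
  finally show ?thesis
    by (simp add: inner_vec_def \<kappa>_def mult.commute)
qed

lemma \<kappa>_surj: "\<exists>v\<in>V. \<kappa> v = w"
  using combination_in_V[of "\<lambda>k. w $ k"] \<kappa>_combination[of "\<lambda>k. w $ k"] by (auto simp: vec_eq_iff)

lemma isometric_coordinates_subspace:
  assumes K: "subspace K" "K \<subseteq> V"
  shows "isometric_coordinates K h \<kappa>"
proof
  have "V \<subseteq> span (range b)" using onb by (simp add: orthonormal_basis_def)
  then show "\<exists>B. orthonormal_basis h K B"
    by (intro orthonormal_basis_exists[OF V _ _ K, of "range b"]) auto
  have KV: "x \<in> V" if "x \<in> K" for x using K(2) that by blast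
  show "\<kappa> (x + y) = \<kappa> x + \<kappa> y" if "x \<in> K" "y \<in> K" for x y
    by (rule \<kappa>_add[OF KV[OF that(1)] KV[OF that(2)]])
  show "\<kappa> (c *\<^sub>R x) = c *\<^sub>R \<kappa> x" if "x \<in> K" for c x
    by (rule \<kappa>_scaleR[OF KV[OF that]])
  show "h x y = \<kappa> x \<bullet> \<kappa> y" if "x \<in> K" "y \<in> K" for x y
    by (rule h_\<kappa>[OF KV[OF that(1)] KV[OF that(2)]])
qed (rule K(1))

end

lemma (in orthonormal_coordinates) whole_space_coordinates:
  shows "isometric_coordinates V h \<kappa>"
    and "orthonormal_basis (\<bullet>) UNIV (isometric_coordinates.image_basis V h \<kappa>)"
    and "dim V = CARD('n)"
proof -
  show coords: "isometric_coordinates V h \<kappa>"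
    by (rule isometric_coordinates_subspace[OF V(1) order_refl])
  interpret W: isometric_coordinates V h \<kappa> by (rule coords)
  have "\<kappa> ` V = UNIV" using \<kappa>_surj by (auto simp: image_iff) metis
  then show onb: "orthonormal_basis (\<bullet>) UNIV W.image_basis" using W.image_basis by simp
  have "card W.image_basis = dim (UNIV :: (real^'n) set)"
  proof (rule dim_eq_card[OF _ orthonormal_basis_independent(1)[OF onb], symmetric])
    show "span W.image_basis = span UNIV" using onb by (simp add: orthonormal_basis_def)
  qed
  then show "dim V = CARD('n)" using W.card_image_basis by simp
qed

lemma orthonormal_coordinates_exist:
  fixes V :: "'v::real_vector set"
  assumes V: "subspace V" "inner_product_on V h" and dim: "dim V = CARD('n::finite)"
  shows "\<exists>b :: 'n \<Rightarrow> 'v. orthonormal_coordinates V h b"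
proof -
  obtain S where S: "S \<subseteq> V" "independent S" "V \<subseteq> span S" "card S = dim V"
    by (rule basis_exists[of V])
  have "finite S" using S(4) dim by (auto intro: card_ge_0_finite)
  then obtain B where B: "orthonormal_basis h V B"
    using orthonormal_basis_exists[OF V _ S(3) V(1)] by auto
  have "span B = V"
    using B by (simp add: orthonormal_basis_def)
  then have "span B = span V"
    by (metis span_span)
  from dim_eq_card[OF this abstract_orthonormal_independent[OF V B]]
  have "card B = dim V" by simp
  then obtain b :: "'n \<Rightarrow> 'v" where "bij_betw b UNIV B"
    using finite_same_card_bij[of "UNIV :: 'n set" B] B dim by (auto simp: orthonormal_basis_def)
  then show ?thesis
    using B V by (intro exI[of _ b]) (auto simp: orthonormal_coordinates_def bij_betw_def)
qed

section \<open>Orthonormal frames\<close>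

lemma representation_orthonormal:
  assumes W: "subspace W" "inner_product_on W h" and B: "orthonormal_basis h W B"
    and z: "z \<in> W" and b: "b \<in> B"
  shows "representation B z b = h z b"
proof -
  have ind: "independent B" by (rule abstract_orthonormal_independent[OF W B])
  have fin: "finite B" and sp: "span B = W" using B by (auto simp: orthonormal_basis_def)
  have BW: "c \<in> W" if "c \<in> B" for c using that sp span_base by blast
  have "h z b = h (\<Sum>c\<in>B. representation B z c *\<^sub>R c) b"
    using real_vector.sum_representation_eq[OF ind _ fin order_refl, of z] z sp by simp
  also have "\<dots> = (\<Sum>c\<in>B. representation B z c * h c b)"
    by (rule inner_product_on_sum_left[OF W BW BW[OF b]])
  also have "\<dots> = (\<Sum>c\<in>B. if c = b then representation B z c else 0)"
    using B b by (intro sum.cong) (auto simp: orthonormal_basis_def)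
  finally show ?thesis using fin b by simp
qed

locale riemannian_manifold = smooth_manifold \<A> for \<A> :: "('a::t2_space, 'm::finite) chart set" +
  fixes g :: "'a \<Rightarrow> 'a tangent \<Rightarrow> 'a tangent \<Rightarrow> real"
  assumes metric: "riemannian_metric \<A> g"
begin

definition gram :: "'a set \<Rightarrow> ('a \<Rightarrow> real^'m) \<Rightarrow> 'a \<Rightarrow> real^'m^'m" where
  "gram U \<phi> x = (\<chi> i j. g x (coord_vector \<A> (U, \<phi>) x (axis i 1)) (coord_vector \<A> (U, \<phi>) x (axis j 1)))"

lemma metric_det_gram: "metric_det \<A> g (U, \<phi>) x = det (gram U \<phi> x)"
  by (simp add: metric_det_def gram_def)

lemma metric_inner: "inner_product_on (tangent_space \<A> x) (g x)"
  using metric by (simp add: riemannian_metric_def)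

lemma subspace_tangent_space: "subspace (tangent_space \<A> x)"
proof -
  obtain U \<phi> where c: "(U, \<phi>) \<in> \<A>" "x \<in> U" using chart_exists by blast
  show ?thesis
    unfolding tangent_space_eq[OF c] by (rule linear_subspace_image[OF coord_vector_linear[OF c] subspace_UNIV])
qed

lemma coord_vector_expansion:
  assumes c: "(U, \<phi>) \<in> \<A>" "x \<in> U"
  shows "coord_vector \<A> (U, \<phi>) x w = (\<Sum>i\<in>UNIV. w $ i *\<^sub>R coord_vector \<A> (U, \<phi>) x (axis i 1))"
proof -
  have "coord_vector \<A> (U, \<phi>) x w = coord_vector \<A> (U, \<phi>) x (\<Sum>i\<in>UNIV. w $ i *\<^sub>R axis i 1)"
    by (simp add: basis_expansion[of w, unfolded scalar_mult_eq_scaleR])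
  also have "\<dots> = (\<Sum>i\<in>UNIV. w $ i *\<^sub>R coord_vector \<A> (U, \<phi>) x (axis i 1))"
    by (simp add: linear_sum[OF coord_vector_linear[OF c]] linear_cmul[OF coord_vector_linear[OF c]])
  finally show ?thesis .
qed

lemma coord_vector_in_tangent_space:
  "(U, \<phi>) \<in> \<A> \<Longrightarrow> x \<in> U \<Longrightarrow> coord_vector \<A> (U, \<phi>) x w \<in> tangent_space \<A> x"
  using tangent_space_eq by blast

lemma metric_gram:
  assumes c: "(U, \<phi>) \<in> \<A>" "x \<in> U"
  shows "g x (coord_vector \<A> (U, \<phi>) x v) (coord_vector \<A> (U, \<phi>) x w) = v \<bullet> (gram U \<phi> x *v w)"
proof -
  let ?d = "\<lambda>i. coord_vector \<A> (U, \<phi>) x (axis i 1)"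
  note T = subspace_tangent_space metric_inner
  note mem = coord_vector_in_tangent_space[OF c]
  have "g x (coord_vector \<A> (U, \<phi>) x v) (coord_vector \<A> (U, \<phi>) x w)
      = g x (\<Sum>i\<in>UNIV. v $ i *\<^sub>R ?d i) (coord_vector \<A> (U, \<phi>) x w)"
    by (subst coord_vector_expansion[OF c, of v]) simp
  also have "\<dots> = (\<Sum>i\<in>UNIV. v $ i * g x (?d i) (coord_vector \<A> (U, \<phi>) x w))"
    by (rule inner_product_on_sum_left[OF T mem mem])
  also have "\<dots> = (\<Sum>i\<in>UNIV. v $ i * g x (?d i) (\<Sum>j\<in>UNIV. w $ j *\<^sub>R ?d j))"
    by (subst coord_vector_expansion[OF c, of w]) simp
  also have "\<dots> = (\<Sum>i\<in>UNIV. v $ i * (\<Sum>j\<in>UNIV. w $ j * g x (?d i) (?d j)))"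
    by (subst inner_product_on_sum_right[OF T mem mem]) simp
  finally show ?thesis
    by (simp add: inner_vec_def matrix_vector_mult_def gram_def mult.commute)
qed

lemma orthonormal_frame_exists: "\<exists>e. orthonormal_frame \<A> g x e"
proof -
  obtain U \<phi> where c: "(U, \<phi>) \<in> \<A>" "x \<in> U" using chart_exists by blast
  let ?d = "\<lambda>i::'m. coord_vector \<A> (U, \<phi>) x (axis i 1)"
  have inj: "inj (coord_vector \<A> (U, \<phi>) x)"
    using coord_vector_inj[OF c] by (auto intro: injI)
  have inj_axis: "inj (\<lambda>i::'m. axis i 1 :: real^'m)"
    by (auto simp: inj_on_def axis_eq_axis)
  have Basis: "range (\<lambda>i::'m. axis i 1 :: real^'m) = Basis"
    by (auto simp: Basis_vec_def)
  have range_d: "range ?d = coord_vector \<A> (U, \<phi>) x ` Basis"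
    by (simp add: Basis[symmetric] image_image)
  have span: "span (range ?d) = tangent_space \<A> x"
    unfolding range_d tangent_space_eq[OF c]
    using linear_span_image[OF coord_vector_linear[OF c], of Basis] by simp
  have ind: "independent (range ?d)"
    unfolding range_d
    by (rule linear_independent_injective_image[OF coord_vector_linear[OF c] independent_Basis inj_on_subset[OF inj]]) simp
  have card: "card (range ?d) = CARD('m)"
    using inj inj_axis by (intro card_image) (auto simp: inj_on_def)
  obtain B where B: "orthonormal_basis (g x) (tangent_space \<A> x) B"
    using gram_schmidt[OF subspace_tangent_space metric_inner, of "range ?d" x] coord_vector_in_tangent_space[OF c] span
    by auto
  have spB: "span B = span (range ?d)"
    using B span by (simp add: orthonormal_basis_def)
  have "card B = dim (range ?d)"
    by (rule dim_eq_card[OF spB abstract_orthonormal_independent[OF subspace_tangent_space metric_inner B], symmetric])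
  also have "\<dots> = CARD('m)"
    using dim_eq_card[OF refl ind] card by simp
  finally obtain e :: "'m \<Rightarrow> 'a tangent" where "bij_betw e UNIV B"
    using finite_same_card_bij[of "UNIV :: 'm set" B] B by (auto simp: orthonormal_basis_def)
  then show ?thesis
    using B by (intro exI[of _ e]) (auto simp: orthonormal_frame_def bij_betw_def)
qed

lemma some_frame: "orthonormal_frame \<A> g x (some_frame \<A> g x)"
  unfolding some_frame_def using orthonormal_frame_exists by (rule someI_ex)

text \<open>The frame enters the formula for the number of critical points only through \<open>det P\<close>.\<close>

lemma frame_matrix:
  assumes c: "(U, \<phi>) \<in> \<A>" "x \<in> U"
  obtains P :: "real^'m^'m" where
    "\<And>j. some_frame \<A> g x j = coord_vector \<A> (U, \<phi>) x (column j P)"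
    "transpose P ** gram U \<phi> x ** P = mat 1"
proof -
  let ?e = "some_frame \<A> g x"
  have onb: "inj ?e" "orthonormal_basis (g x) (tangent_space \<A> x) (range ?e)"
    using some_frame by (auto simp: orthonormal_frame_def)
  have "?e j \<in> tangent_space \<A> x" for j
    using onb(2) span_base[of "?e j" "range ?e"] by (simp add: orthonormal_basis_def)
  then have "\<exists>a. ?e j = coord_vector \<A> (U, \<phi>) x a" for j
    unfolding tangent_space_eq[OF c] by blast
  then obtain a where a: "\<And>j. ?e j = coord_vector \<A> (U, \<phi>) x (a j)"
    by metis
  define P :: "real^'m^'m" where "P = (\<chi> i j. a j $ i)"
  have col: "column j P = a j" for j
    by (simp add: P_def column_def vec_eq_iff)
  have "(transpose P ** gram U \<phi> x ** P) $ i $ j = (mat 1 :: real^'m^'m) $ i $ j" for i j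
  proof -
    have "(transpose P ** gram U \<phi> x ** P) $ i $ j = a i \<bullet> (gram U \<phi> x *v a j)"
      unfolding matrix_mul_assoc[symmetric]
      by (simp add: matrix_matrix_mult_def transpose_def inner_vec_def matrix_vector_mult_def P_def)
    also have "\<dots> = g x (?e i) (?e j)"
      unfolding a by (rule metric_gram[OF c, symmetric])
    also have "\<dots> = (if i = j then 1 else 0)"
      using onb by (auto simp: orthonormal_basis_def inj_eq)
    finally show ?thesis by (simp add: mat_def)
  qed
  then have "transpose P ** gram U \<phi> x ** P = mat 1"
    by (simp add: vec_eq_iff)
  then show ?thesis
    using a col by (intro that[of P]) auto
qed

lemma frame_matrix_det:
  fixes P M :: "real^'m^'m"
  assumes "transpose P ** M ** P = mat 1"
  shows "det P \<noteq> 0" "0 < det M" "sqrt (det M) = 1 / \<bar>det P\<bar>"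
proof -
  have "det (transpose P ** M ** P) = 1" using assms by simp
  then have *: "det P * det M * det P = 1" by (simp add: det_mul)
  then show P: "det P \<noteq> 0" by auto
  have M: "det M = (1 / \<bar>det P\<bar>)\<^sup>2"
    using * P by (simp add: power2_eq_square field_simps)
  show "0 < det M" unfolding M using P by simp
  show "sqrt (det M) = 1 / \<bar>det P\<bar>" unfolding M using P by simp
qed

lemma gram_det_pos: "(U, \<phi>) \<in> \<A> \<Longrightarrow> x \<in> U \<Longrightarrow> 0 < det (gram U \<phi> x)"
  by (rule frame_matrix[of U \<phi> x]) (auto intro: frame_matrix_det)

end

section \<open>The volume density\<close>

lemma congruence_entry:
  fixes M :: "real^'i::finite^'i" and P :: "real^'j::finite^'i"
  shows "(transpose P ** M ** P) $ i $ j = column i P \<bullet> (M *v column j P)"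
  unfolding matrix_mul_assoc[symmetric]
  by (simp add: matrix_matrix_mult_def transpose_def inner_vec_def matrix_vector_mult_def column_def)

context smooth_manifold
begin

lemma chart_borel:
  assumes c: "(U, \<phi>) \<in> \<A>" and B: "B \<in> sets borel" "B \<subseteq> U"
  shows "\<phi> ` B \<in> sets borel"
proof -
  have "\<phi> ` B = {u \<in> \<phi> ` U. inv_into U \<phi> u \<in> B}"
    using chart_image_eq[OF c, of B] B(2) by (simp add: Int_absorb1)
  also have "\<dots> \<in> sets borel"
    by (rule borel_vimage_continuous_on[OF chart_continuous(2)[OF c] borel_open[OF chartD(2)[OF c]] B(1)])
  finally show ?thesis .
qed

text \<open>The inverse of a chart, extended by a constant so that it is a measurable function on the whole
coordinate space.\<close>

definition param :: "'a set \<Rightarrow> ('a \<Rightarrow> real^'m) \<Rightarrow> real^'m \<Rightarrow> 'a" where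
  "param U \<phi> u = (if u \<in> \<phi> ` U then inv_into U \<phi> u else undefined)"

lemma borel_measurable_param: "(U, \<phi>) \<in> \<A> \<Longrightarrow> param U \<phi> \<in> borel_measurable borel"
  unfolding param_def[abs_def]
  by (intro borel_measurable_if_continuous_on borel_open chartD(2) chart_continuous(2))

end

context riemannian_manifold
begin

definition volume_density :: "'a set \<Rightarrow> ('a \<Rightarrow> real^'m) \<Rightarrow> real^'m \<Rightarrow> ennreal" where
  "volume_density U \<phi> u = (if u \<in> \<phi> ` U then ennreal (sqrt (det (gram U \<phi> (inv_into U \<phi> u)))) else 0)"

lemma borel_measurable_volume_density [measurable]:
  assumes c: "(U, \<phi>) \<in> \<A>"
  shows "volume_density U \<phi> \<in> borel_measurable borel"
proof -
  have entry: "continuous_on (\<phi> ` U) (\<lambda>u. gram U \<phi> (inv_into U \<phi> u) $ i $ j)" for i j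
  proof -
    have "smooth_fun_on \<A> U (\<lambda>x. g x (coord_vector \<A> (U, \<phi>) x (axis i 1)) (coord_vector \<A> (U, \<phi>) x (axis j 1)))"
      using metric c unfolding riemannian_metric_def by fastforce
    from smooth_fun_onD[OF this c]
    have "smooth_on (\<phi> ` U) ((\<lambda>x. g x (coord_vector \<A> (U, \<phi>) x (axis i 1)) (coord_vector \<A> (U, \<phi>) x (axis j 1))) \<circ> inv_into U \<phi>)"
      by simp
    from Ck_on_imp_continuous_on[OF smooth_on_imp_Ck_on[OF this]] show ?thesis
      by (simp add: gram_def comp_def)
  qed
  have "continuous_on (\<phi> ` U) (\<lambda>u. sqrt (det (gram U \<phi> (inv_into U \<phi> u))))"
    unfolding det_def by (intro continuous_intros entry)
  then have "(\<lambda>u. if u \<in> \<phi> ` U then sqrt (det (gram U \<phi> (inv_into U \<phi> u))) else 0) \<in> borel_measurable borel"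
    by (intro borel_measurable_if_continuous_on borel_open chartD(2)[OF c])
  then have "(\<lambda>u. ennreal (if u \<in> \<phi> ` U then sqrt (det (gram U \<phi> (inv_into U \<phi> u))) else 0)) \<in> borel_measurable borel"
    by measurable
  also have "(\<lambda>u. ennreal (if u \<in> \<phi> ` U then sqrt (det (gram U \<phi> (inv_into U \<phi> u))) else 0)) = volume_density U \<phi>"
    by (auto simp: volume_density_def fun_eq_iff)
  finally show ?thesis .
qed

definition chart_mass :: "'a set \<Rightarrow> ('a \<Rightarrow> real^'m) \<Rightarrow> 'a set \<Rightarrow> ennreal" where
  "chart_mass U \<phi> B = (\<integral>\<^sup>+u\<in>\<phi> ` B. volume_density U \<phi> u \<partial>lborel)"

lemma chart_mass_eq:
  assumes "(U, \<phi>) \<in> \<A>" "B \<subseteq> U"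
  shows "(\<integral>\<^sup>+u\<in>\<phi> ` B. ennreal (sqrt (metric_det \<A> g (U, \<phi>) (inv_into U \<phi> u))) \<partial>lborel) = chart_mass U \<phi> B"
  unfolding chart_mass_def metric_det_gram using assms
  by (intro nn_integral_cong) (auto simp: volume_density_def split: split_indicator)

text \<open>By \<open>coord_vector_change\<close> the coordinate fields of one chart are those of the other, transformed by the
Jacobian matrix.\<close>

lemma gram_change:
  assumes c: "(U, \<phi>) \<in> \<A>" "x \<in> U" and c': "(U', \<psi>) \<in> \<A>" "x \<in> U'"
  defines "J \<equiv> matrix (frechet_derivative (transition U \<phi> \<psi>) (at (\<phi> x)))"
  shows "gram U \<phi> x = transpose J ** gram U' \<psi> x ** J"
proof -
  have x: "\<phi> x \<in> \<phi> ` (U \<inter> U')" using c c' by auto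
  have lin: "linear (frechet_derivative (transition U \<phi> \<psi>) (at (\<phi> x)))"
    by (rule has_derivative_linear[OF transition_has_derivative[OF c(1) c'(1) x]])
  have col: "frechet_derivative (transition U \<phi> \<psi>) (at (\<phi> x)) (axis i 1) = column i J" for i
    by (simp add: J_def matrix_def column_def vec_eq_iff)
  have "gram U \<phi> x $ i $ j = (transpose J ** gram U' \<psi> x ** J) $ i $ j" for i j
    unfolding congruence_entry col[symmetric] metric_gram[OF c', symmetric]
    by (simp add: gram_def coord_vector_change[OF c c', symmetric])
  then show ?thesis by (simp add: vec_eq_iff)
qed

text \<open>Gram matrices of two charts are congruent through the Jacobian matrix of the transition map, so the
square roots of their determinants differ by the factor in the change of variables formula.\<close>

lemma chart_mass_change:
  assumes c: "(U, \<phi>) \<in> \<A>" and c': "(U', \<psi>) \<in> \<A>" and B: "B \<in> sets borel" "B \<subseteq> U" "B \<subseteq> U'"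
  shows "chart_mass U \<phi> B = chart_mass U' \<psi> B"
proof -
  let ?\<theta> = "transition U \<phi> \<psi>" and ?S = "\<phi> ` (U \<inter> U')" and ?T = "\<psi> ` (U \<inter> U')"
  have open_S: "open ?S" by (rule open_chart_image[OF c chartD(1)[OF c']])
  have open_T: "open ?T"
    using open_chart_image[OF c' chartD(1)[OF c]] by (simp add: Int_commute)
  have smooth: "smooth_on ?S ?\<theta>" "smooth_on ?T (transition U' \<psi> \<phi>)"
    using transition_smooth[OF c c'] transition_smooth[OF c' c] by (simp_all add: Int_commute)
  have \<theta>: "?\<theta> (\<phi> x) = \<psi> x" "transition U' \<psi> \<phi> (\<psi> x) = \<phi> x" if "x \<in> U \<inter> U'" for x
    using that chart_inverse(1)[OF c] chart_inverse(1)[OF c'] by auto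
  have hom: "homeomorphism ?S ?T ?\<theta> (transition U' \<psi> \<phi>)"
    unfolding homeomorphism_def
  proof (intro conjI ballI)
    show "continuous_on ?S ?\<theta>" "continuous_on ?T (transition U' \<psi> \<phi>)"
      using smooth smooth_on_imp_Ck_on Ck_on_imp_continuous_on by blast+
    show "?\<theta> ` ?S = ?T" "transition U' \<psi> \<phi> ` ?T = ?S"
      unfolding image_image by (rule image_cong[OF refl], rule \<theta>, assumption)+
    show "transition U' \<psi> \<phi> (?\<theta> u) = u" if "u \<in> ?S" for u
      using that by (elim imageE) (simp only: \<theta>)
    show "?\<theta> (transition U' \<psi> \<phi> u) = u" if "u \<in> ?T" for u
      using that by (elim imageE) (simp only: \<theta>)
  qed
  have der: "(?\<theta> has_derivative frechet_derivative ?\<theta> (at u)) (at u)" if "u \<in> ?S" for u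
    by (rule transition_has_derivative[OF c c' that])
  have cont: "continuous_on ?S (\<lambda>u. det (matrix (frechet_derivative ?\<theta> (at u))))"
  proof -
    have "continuous_on ?S (\<lambda>u. frechet_derivative ?\<theta> (at u) w)" for w
      by (rule Ck_on_imp_continuous_on[OF smooth_on_imp_Ck_on[OF smooth_on_derivative[OF smooth(1)]]])
    then show ?thesis
      unfolding det_def matrix_def vec_lambda_beta by (intro continuous_intros)
  qed
  have S: "\<phi> ` B \<in> sets borel" "\<phi> ` B \<subseteq> ?S"
    using chart_borel[OF c B(1,2)] B by auto
  have image: "?\<theta> ` \<phi> ` B = \<psi> ` B"
    unfolding image_image using \<theta>(1) B by (intro image_cong) auto
  have "chart_mass U' \<psi> B = (\<integral>\<^sup>+y\<in>?\<theta> ` \<phi> ` B. volume_density U' \<psi> y \<partial>lborel)"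
    by (simp only: chart_mass_def image)
  also have "\<dots> = (\<integral>\<^sup>+u\<in>\<phi> ` B. volume_density U' \<psi> (?\<theta> u) * ennreal \<bar>det (matrix (frechet_derivative ?\<theta> (at u)))\<bar> \<partial>lborel)"
    by (rule nn_integral_diffeomorphism(2)[OF open_S open_T hom der cont S borel_measurable_volume_density[OF c']])
  also have "\<dots> = chart_mass U \<phi> B"
    unfolding chart_mass_def
  proof (rule nn_integral_cong)
    fix u
    show "volume_density U' \<psi> (?\<theta> u) * ennreal \<bar>det (matrix (frechet_derivative ?\<theta> (at u)))\<bar> * indicator (\<phi> ` B) u
        = volume_density U \<phi> u * indicator (\<phi> ` B) u"
    proof (cases "u \<in> \<phi> ` B")
      case True
      then obtain x where x: "x \<in> B" "u = \<phi> x" by blast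
      then have xU: "x \<in> U" "x \<in> U'" using B by auto
      have "\<theta>": "?\<theta> u = \<psi> x" using \<theta>(1) xU x by simp
      let ?J = "matrix (frechet_derivative ?\<theta> (at u))"
      have "det (gram U \<phi> x) = (det ?J)\<^sup>2 * det (gram U' \<psi> x)"
        using gram_change[OF c xU(1) c' xU(2)] by (simp add: x(2) det_mul power2_eq_square)
      then have "sqrt (det (gram U \<phi> x)) = sqrt (det (gram U' \<psi> x)) * \<bar>det ?J\<bar>"
        by (simp add: real_sqrt_mult)
      moreover have "volume_density U \<phi> u = ennreal (sqrt (det (gram U \<phi> x)))"
        using xU x chart_inverse(1)[OF c xU(1)] by (auto simp: volume_density_def)
      moreover have "volume_density U' \<psi> (?\<theta> u) = ennreal (sqrt (det (gram U' \<psi> x)))"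
        unfolding \<open>?\<theta> u = \<psi> x\<close> using xU chart_inverse(1)[OF c' xU(2)] by (auto simp: volume_density_def)
      ultimately show ?thesis
        using gram_det_pos[OF c' xU(2)] by (simp add: ennreal_mult)
    qed simp
  qed
  finally show ?thesis ..
qed

text \<open>The volume density restricted to a part \<open>D\<close> of the domain of a chart.\<close>

definition piece_measure :: "'a set \<Rightarrow> ('a \<Rightarrow> real^'m) \<Rightarrow> 'a set \<Rightarrow> 'a measure" where
  "piece_measure U \<phi> D
    = distr (density lborel (\<lambda>u. volume_density U \<phi> u * indicator (\<phi> ` D) u)) borel (param U \<phi>)"

lemma sets_piece_measure [simp]: "sets (piece_measure U \<phi> D) = sets borel"
  by (simp add: piece_measure_def)

lemma nn_integral_piece_measure:
  assumes c: "(U, \<phi>) \<in> \<A>" and D: "D \<in> sets borel" "D \<subseteq> U" and f: "f \<in> borel_measurable borel"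
  shows "(\<integral>\<^sup>+x. f x \<partial>piece_measure U \<phi> D)
    = (\<integral>\<^sup>+u. f (param U \<phi> u) * volume_density U \<phi> u * indicator (\<phi> ` D) u \<partial>lborel)"
proof -
  note [measurable] = borel_measurable_param[OF c] borel_measurable_volume_density[OF c] f chart_borel[OF c D]
  show ?thesis
    unfolding piece_measure_def
    by (subst nn_integral_distr, measurable, subst nn_integral_density) (auto simp: mult_ac)
qed

lemma emeasure_piece_measure:
  assumes c: "(U, \<phi>) \<in> \<A>" and D: "D \<in> sets borel" "D \<subseteq> U" and B: "B \<in> sets borel"
  shows "emeasure (piece_measure U \<phi> D) B = chart_mass U \<phi> (B \<inter> D)"
proof -
  have "emeasure (piece_measure U \<phi> D) B = (\<integral>\<^sup>+x. indicator B x \<partial>piece_measure U \<phi> D)"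
    using B by simp
  also have "\<dots> = (\<integral>\<^sup>+u. indicator B (param U \<phi> u) * volume_density U \<phi> u * indicator (\<phi> ` D) u \<partial>lborel)"
    by (rule nn_integral_piece_measure[OF c D]) (use B in simp)
  also have "\<dots> = chart_mass U \<phi> (B \<inter> D)"
    unfolding chart_mass_def
  proof (rule nn_integral_cong)
    fix u
    have "indicator B (param U \<phi> u) * indicator (\<phi> ` D) u = (indicator (\<phi> ` (B \<inter> D)) u :: ennreal)"
    proof (cases "u \<in> \<phi> ` D")
      case True
      then obtain x where x: "x \<in> D" "u = \<phi> x" by blast
      then have "param U \<phi> u = x"
        using D(2) chart_inverse(1)[OF c, of x] by (auto simp: param_def)
      moreover have "u \<in> \<phi> ` (B \<inter> D) \<longleftrightarrow> x \<in> B"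
        using x D(2) chart_continuous(3)[OF c] by (auto simp: inj_on_def)
      ultimately show ?thesis using True by (simp add: indicator_def)
    qed (auto simp: indicator_def)
    then show "indicator B (param U \<phi> u) * volume_density U \<phi> u * indicator (\<phi> ` D) u
        = volume_density U \<phi> u * indicator (\<phi> ` (B \<inter> D)) u"
      by (metis mult.assoc mult.commute)
  qed
  finally show ?thesis .
qed

definition is_volume :: "'a measure \<Rightarrow> bool" where
  "is_volume \<mu> \<longleftrightarrow> sets \<mu> = sets borel \<and>
     (\<forall>(U, \<phi>)\<in>\<A>. \<forall>B\<in>sets borel. B \<subseteq> U \<longrightarrow> emeasure \<mu> B = chart_mass U \<phi> B)"

lemma volume_measure_THE: "volume_measure \<A> g = (THE \<mu>. is_volume \<mu>)"
proof -
  have "(\<lambda>\<mu>. sets \<mu> = sets borel \<and>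
     (\<forall>(U, \<phi>)\<in>\<A>. \<forall>B\<in>sets borel. B \<subseteq> U \<longrightarrow>
        emeasure \<mu> B =
          (\<integral>\<^sup>+u\<in>\<phi> ` B. ennreal (sqrt (metric_det \<A> g (U, \<phi>) (inv_into U \<phi> u))) \<partial>lborel))) = is_volume"
    unfolding is_volume_def fun_eq_iff
    by (intro allI conj_cong refl ball_cong, clarify) (intro ball_cong refl imp_cong, simp only: chart_mass_eq)
  then show ?thesis
    unfolding volume_measure_def by (rule arg_cong)
qed

definition chart_partition :: "nat \<Rightarrow> (nat \<Rightarrow> 'a set) \<Rightarrow> (nat \<Rightarrow> 'a \<Rightarrow> real^'m) \<Rightarrow> (nat \<Rightarrow> 'a set) \<Rightarrow> bool" where
  "chart_partition r U \<phi> D \<longleftrightarrow> (\<forall>i<r. (U i, \<phi> i) \<in> \<A> \<and> D i \<in> sets borel \<and> D i \<subseteq> U i) \<and>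
     disjoint_family_on D {..<r} \<and> (\<Union>i<r. D i) = UNIV"

lemma emeasure_chart_partition:
  assumes P: "chart_partition r U \<phi> D" and \<mu>: "sets \<mu> = sets borel" and B: "B \<in> sets borel"
  shows "emeasure \<mu> B = (\<Sum>i<r. emeasure \<mu> (B \<inter> D i))"
proof -
  have "emeasure \<mu> (\<Union>i<r. B \<inter> D i) = (\<Sum>i<r. emeasure \<mu> (B \<inter> D i))"
  proof (rule sum_emeasure[symmetric])
    show "(\<lambda>i. B \<inter> D i) ` {..<r} \<subseteq> sets \<mu>"
      using P B unfolding \<mu> chart_partition_def by auto
    have "disjoint_family_on D {..<r}"
      using P by (simp add: chart_partition_def)
    then show "disjoint_family_on (\<lambda>i. B \<inter> D i) {..<r}"
      unfolding disjoint_family_on_def by blast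
  qed simp
  moreover have "(\<Union>i<r. B \<inter> D i) = B"
    using P unfolding chart_partition_def by blast
  ultimately show ?thesis by simp
qed

text \<open>The sum of the measures of the pieces of a partition has the required values in every chart because
the charts agree on overlaps, and no other measure has them because a measure is determined by its
restrictions to the pieces.\<close>

lemma is_volume_volume_measure:
  assumes P: "chart_partition r U \<phi> D"
  shows "is_volume (volume_measure \<A> g)"
proof -
  have c: "(U i, \<phi> i) \<in> \<A>" and D: "D i \<in> sets borel" "D i \<subseteq> U i" if "i < r" for i
    using P that unfolding chart_partition_def by auto
  define N where "N = (\<lambda>i. piece_measure (U i) (\<phi> i) (D i))"
  define \<mu> where "\<mu> = measure_of UNIV (sets (borel :: 'a measure)) (\<lambda>B. \<Sum>i<r. emeasure (N i) B)"
  have sets_\<mu>: "sets \<mu> = sets borel"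
    unfolding \<mu>_def using sets.sigma_sets_eq[of "borel :: 'a measure"] by simp
  have emeasure_\<mu>: "emeasure \<mu> B = (\<Sum>i<r. emeasure (N i) B)" if B: "B \<in> sets borel" for B
    unfolding \<mu>_def
  proof (rule emeasure_measure_of_sigma[OF _ _ _ B])
    show "sigma_algebra UNIV (sets (borel :: 'a measure))"
      using sets.sigma_algebra_axioms[of "borel :: 'a measure"] by simp
    show "positive (sets borel) (\<lambda>B. \<Sum>i<r. emeasure (N i) B)"
      by (simp add: positive_def)
    show "countably_additive (sets borel) (\<lambda>B. \<Sum>i<r. emeasure (N i) B)"
      unfolding countably_additive_def
    proof safe
      fix A :: "nat \<Rightarrow> 'a set" assume A: "range A \<subseteq> sets borel" "disjoint_family A"
      have "(\<Sum>j. \<Sum>i<r. emeasure (N i) (A j)) = (\<Sum>i<r. \<Sum>j. emeasure (N i) (A j))"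
        by (rule suminf_sum) simp
      also have "\<dots> = (\<Sum>i<r. emeasure (N i) (\<Union>j. A j))"
        using A by (intro sum.cong refl suminf_emeasure) (auto simp: N_def)
      finally show "(\<Sum>j. \<Sum>i<r. emeasure (N i) (A j)) = (\<Sum>i<r. emeasure (N i) (\<Union>j. A j))" .
    qed
  qed
  have vol: "is_volume \<mu>"
    unfolding is_volume_def
  proof (intro conjI ballI, rule sets_\<mu>, clarify)
    fix V \<psi> B assume c': "(V, \<psi>) \<in> \<A>" and B: "B \<in> sets (borel :: 'a measure)" "B \<subseteq> V"
    have "emeasure \<mu> B = (\<Sum>i<r. chart_mass (U i) (\<phi> i) (B \<inter> D i))"
      unfolding emeasure_\<mu>[OF B(1)] N_def
      by (intro sum.cong refl emeasure_piece_measure c D B) auto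
    also have "\<dots> = (\<Sum>i<r. chart_mass V \<psi> (B \<inter> D i))"
      using D B by (intro sum.cong refl chart_mass_change c c') auto
    also have "\<dots> = (\<Sum>i<r. emeasure (piece_measure V \<psi> B) (B \<inter> D i))"
      using D B by (intro sum.cong refl) (auto simp: emeasure_piece_measure[OF c' B] Int_commute Int_left_commute)
    also have "\<dots> = emeasure (piece_measure V \<psi> B) B"
      by (rule emeasure_chart_partition[OF P _ B(1), symmetric]) simp
    also have "\<dots> = chart_mass V \<psi> B"
      by (simp add: emeasure_piece_measure[OF c' B B(1)])
    finally show "emeasure \<mu> B = chart_mass V \<psi> B" .
  qed
  have unique: "\<mu>' = \<mu>" if v: "is_volume \<mu>'" for \<mu>'
  proof (rule measure_eqI)
    show sets_eq: "sets \<mu>' = sets \<mu>" using v sets_\<mu> by (simp add: is_volume_def)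
    fix B assume "B \<in> sets \<mu>'"
    then have B: "B \<in> sets borel" using v by (simp add: is_volume_def)
    have piece: "emeasure \<nu> (B \<inter> D i) = chart_mass (U i) (\<phi> i) (B \<inter> D i)" if "is_volume \<nu>" "i < r" for \<nu> i
    proof -
      have "B \<inter> D i \<in> sets borel" "B \<inter> D i \<subseteq> U i" using D[OF that(2)] B by auto
      then show ?thesis using that(1) c[OF that(2)] unfolding is_volume_def by blast
    qed
    have "emeasure \<mu>' B = (\<Sum>i<r. chart_mass (U i) (\<phi> i) (B \<inter> D i))"
      using v by (subst emeasure_chart_partition[OF P _ B]) (simp_all add: piece is_volume_def)
    also have "\<dots> = emeasure \<mu> B"
      using vol by (subst emeasure_chart_partition[OF P _ B]) (simp_all add: piece is_volume_def)
    finally show "emeasure \<mu>' B = emeasure \<mu> B" .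
  qed
  show ?thesis
    unfolding volume_measure_THE by (rule theI'[of is_volume]) (use vol unique in blast)
qed

lemma nn_integral_volume:
  assumes P: "chart_partition r U \<phi> D" and f: "f \<in> borel_measurable borel"
  shows "(\<integral>\<^sup>+x. f x \<partial>volume_measure \<A> g)
    = (\<Sum>i<r. \<integral>\<^sup>+u. f (param (U i) (\<phi> i) u) * volume_density (U i) (\<phi> i) u * indicator (\<phi> i ` D i) u \<partial>lborel)"
proof -
  let ?\<mu> = "volume_measure \<A> g"
  have vol: "is_volume ?\<mu>" by (rule is_volume_volume_measure[OF P])
  then have sets_\<mu>: "sets ?\<mu> = sets borel" by (simp add: is_volume_def)
  have f\<mu>: "f \<in> borel_measurable ?\<mu>"
    using f by (simp add: measurable_cong_sets[OF sets_\<mu> refl])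
  have c: "(U i, \<phi> i) \<in> \<A>" and D: "D i \<in> sets borel" "D i \<subseteq> U i" if "i < r" for i
    using P that unfolding chart_partition_def by auto
  have dens: "density ?\<mu> (indicator (D i)) = piece_measure (U i) (\<phi> i) (D i)" if i: "i < r" for i
  proof (rule measure_eqI)
    show "sets (density ?\<mu> (indicator (D i))) = sets (piece_measure (U i) (\<phi> i) (D i))"
      using sets_\<mu> by simp
    fix B assume "B \<in> sets (density ?\<mu> (indicator (D i)))"
    then have B: "B \<in> sets borel" using sets_\<mu> by simp
    have "emeasure (density ?\<mu> (indicator (D i))) B = (\<integral>\<^sup>+x. indicator (D i) x * indicator B x \<partial>?\<mu>)"
      using D[OF i] B sets_\<mu> by (intro emeasure_density) auto
    also have "\<dots> = emeasure ?\<mu> (D i \<inter> B)"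
      using D[OF i] B sets_\<mu> by (simp add: indicator_inter_arith[symmetric])
    also have "\<dots> = chart_mass (U i) (\<phi> i) (B \<inter> D i)"
    proof -
      have "B \<inter> D i \<in> sets borel" "B \<inter> D i \<subseteq> U i" using D[OF i] B by auto
      then have "emeasure ?\<mu> (B \<inter> D i) = chart_mass (U i) (\<phi> i) (B \<inter> D i)"
        using vol c[OF i] unfolding is_volume_def by blast
      then show ?thesis by (simp add: Int_commute)
    qed
    also have "\<dots> = emeasure (piece_measure (U i) (\<phi> i) (D i)) B"
      by (rule emeasure_piece_measure[OF c D B, symmetric]) (rule i)+
    finally show "emeasure (density ?\<mu> (indicator (D i))) B = emeasure (piece_measure (U i) (\<phi> i) (D i)) B" .
  qed
  have "(\<integral>\<^sup>+x. f x \<partial>?\<mu>) = (\<integral>\<^sup>+x. (\<Sum>i<r. indicator (D i) x * f x) \<partial>?\<mu>)"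
  proof (rule nn_integral_cong)
    fix x
    have "(\<Sum>i<r. indicator (D i) x :: ennreal) = indicator (\<Union>i<r. D i) x"
      using P unfolding chart_partition_def by (intro indicator_UN_disjoint[symmetric]) auto
    then have "(\<Sum>i<r. indicator (D i) x :: ennreal) = 1"
      using P unfolding chart_partition_def by simp
    then show "f x = (\<Sum>i<r. indicator (D i) x * f x)"
      by (simp add: sum_distrib_right[symmetric])
  qed
  also have "\<dots> = (\<Sum>i<r. \<integral>\<^sup>+x. indicator (D i) x * f x \<partial>?\<mu>)"
    using f\<mu> D sets_\<mu> by (intro nn_integral_sum borel_measurable_times_ennreal borel_measurable_indicator) auto
  also have "\<dots> = (\<Sum>i<r. \<integral>\<^sup>+x. f x \<partial>piece_measure (U i) (\<phi> i) (D i))"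
  proof (rule sum.cong[OF refl])
    fix i assume "i \<in> {..<r}"
    then have i: "i < r" by simp
    show "(\<integral>\<^sup>+x. indicator (D i) x * f x \<partial>?\<mu>) = (\<integral>\<^sup>+x. f x \<partial>piece_measure (U i) (\<phi> i) (D i))"
      unfolding dens[OF i, symmetric] using f\<mu> D[OF i] sets_\<mu>
      by (intro nn_integral_density[symmetric] borel_measurable_indicator) auto
  qed
  also have "\<dots> = (\<Sum>i<r. \<integral>\<^sup>+u. f (param (U i) (\<phi> i) u) * volume_density (U i) (\<phi> i) u * indicator (\<phi> i ` D i) u \<partial>lborel)"
    by (intro sum.cong refl nn_integral_piece_measure c D f) auto
  finally show ?thesis .
qed

end

section \<open>Critical points of functions in an ample space\<close>

lemma sum_fun_apply: "(\<Sum>k\<in>I. f k) x = (\<Sum>k\<in>I. f k x)" for f :: "'i \<Rightarrow> 'a \<Rightarrow> 'b::comm_monoid_add"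
  by (induction I rule: infinite_finite_induct) simp_all

lemma det_scaleR: "det (r *\<^sub>R M) = r ^ CARD('i) * det M" for M :: "real^'i::finite^'i"
proof -
  have "r *\<^sub>R M = (\<chi> i. r *s M $ i)"
    by (simp add: vec_eq_iff)
  then show ?thesis
    by (simp add: det_rows_mul)
qed

lemma matrix_derivative_scaleR: "matrix_derivative A x (r *\<^sub>R v) = r *\<^sub>R matrix_derivative A x v"
  by (simp add: matrix_derivative_def vec_eq_iff sum_distrib_left mult.left_commute)

text \<open>The differentials at \<open>x\<close> of the functions in \<open>V\<close> fill the cotangent space, for every \<open>x\<close>.\<close>

locale ample_function_space =
  riemannian_manifold \<A> g + orthonormal_coordinates V h b
  for \<A> :: "('a::t2_space, 'm::finite) chart set" and g
    and V :: "('a \<Rightarrow> real) set" and h and b :: "'n::finite \<Rightarrow> 'a \<Rightarrow> real" +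
  assumes smooth: "V \<subseteq> C_infinity \<A>"
    and ample: "\<And>x l. linear l \<Longrightarrow> \<exists>v\<in>V. \<forall>X\<in>tangent_space \<A> x. differential v X = l X"
begin

text \<open>The matrix that takes the coordinates of \<open>v \<in> V\<close> to the gradient of \<open>v\<close> in a chart.\<close>

definition Grad :: "'a set \<Rightarrow> ('a \<Rightarrow> real^'m) \<Rightarrow> real^'m \<Rightarrow> real^'n^'m" where
  "Grad U \<phi> u = (\<chi> i k. frechet_derivative (b k \<circ> inv_into U \<phi>) (at u) (axis i 1))"

lemma b_smooth: "b k \<in> C_infinity \<A>"
  using smooth b_in_V by blast

lemma Grad_family:
  assumes c: "(U, \<phi>) \<in> \<A>"
  shows "matrix_family (\<phi> ` U) (Grad U \<phi>)"
proof
  show "open (\<phi> ` U)" by (rule chartD(2)[OF c])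
  show "Ck_on (Suc 0) (\<phi> ` U) (\<lambda>u. Grad U \<phi> u $ i $ k)" for i k
    using smooth_on_imp_Ck_on[OF smooth_on_directional[OF b_smooth c]] by (simp add: Grad_def)
qed

lemma derivative_expansion:
  assumes c: "(U, \<phi>) \<in> \<A>" and u: "u \<in> \<phi> ` U" and v: "v \<in> V"
  shows "frechet_derivative (v \<circ> inv_into U \<phi>) (at u) w = (Grad U \<phi> u *v \<kappa> v) \<bullet> w"
proof -
  have v_eq: "v \<circ> inv_into U \<phi> = (\<lambda>u. \<Sum>k\<in>UNIV. \<kappa> v $ k * (b k \<circ> inv_into U \<phi>) u)"
  proof
    fix u
    have "v y = (\<Sum>k\<in>UNIV. \<kappa> v $ k * b k y)" for y
      by (subst expansion[OF v]) (simp add: sum_fun_apply scaleR_fun_def)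
    then show "(v \<circ> inv_into U \<phi>) u = (\<Sum>k\<in>UNIV. \<kappa> v $ k * (b k \<circ> inv_into U \<phi>) u)"
      by simp
  qed
  have "((v \<circ> inv_into U \<phi>) has_derivative
      (\<lambda>w. \<Sum>k\<in>UNIV. \<kappa> v $ k * frechet_derivative (b k \<circ> inv_into U \<phi>) (at u) w)) (at u)"
    unfolding v_eq
    by (intro has_derivative_sum has_derivative_mult_right smooth_on_has_derivative[OF C_infinityD[OF b_smooth c] u])
  from fun_cong[OF frechet_derivative_at[OF this], of w]
  have "frechet_derivative (v \<circ> inv_into U \<phi>) (at u) w
      = (\<Sum>k\<in>UNIV. \<kappa> v $ k * frechet_derivative (b k \<circ> inv_into U \<phi>) (at u) w)" by simp
  also have "\<dots> = (\<Sum>k\<in>UNIV. \<kappa> v $ k * (\<Sum>i\<in>UNIV. Grad U \<phi> u $ i $ k * w $ i))"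
    by (subst gradient_expansion[OF b_smooth c u]) (simp add: Grad_def)
  also have "\<dots> = (\<Sum>k\<in>UNIV. \<Sum>i\<in>UNIV. Grad U \<phi> u $ i $ k * \<kappa> v $ k * w $ i)"
    by (simp add: sum_distrib_left mult_ac)
  also have "\<dots> = (Grad U \<phi> u *v \<kappa> v) \<bullet> w"
    by (subst sum.swap) (simp add: inner_vec_def matrix_vector_mult_def sum_distrib_right)
  finally show ?thesis .
qed

lemma coord_vector_Grad:
  assumes c: "(U, \<phi>) \<in> \<A>" "x \<in> U" and v: "v \<in> V"
  shows "coord_vector \<A> (U, \<phi>) x w v = (Grad U \<phi> (\<phi> x) *v \<kappa> v) \<bullet> w"
proof -
  have "coord_vector \<A> (U, \<phi>) x w v = frechet_derivative (v \<circ> inv_into U \<phi>) (at (\<phi> x)) w"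
    using v smooth by (intro coord_vector_apply C_infinity_smooth_near) blast
  also have "\<dots> = (Grad U \<phi> (\<phi> x) *v \<kappa> v) \<bullet> w"
    by (rule derivative_expansion[OF c(1) _ v]) (use c in simp)
  finally show ?thesis .
qed

lemma critical_iff:
  assumes c: "(U, \<phi>) \<in> \<A>" "x \<in> U" and v: "v \<in> V"
  shows "(\<forall>X\<in>tangent_space \<A> x. differential v X = 0) \<longleftrightarrow> Grad U \<phi> (\<phi> x) *v \<kappa> v = 0"
proof
  assume "\<forall>X\<in>tangent_space \<A> x. differential v X = 0"
  then have "coord_vector \<A> (U, \<phi>) x w v = 0" for w
    using coord_vector_in_tangent_space[OF c] by (simp add: differential_def)
  from this[of "Grad U \<phi> (\<phi> x) *v \<kappa> v"] show "Grad U \<phi> (\<phi> x) *v \<kappa> v = 0"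
    unfolding coord_vector_Grad[OF c v] by simp
next
  assume "Grad U \<phi> (\<phi> x) *v \<kappa> v = 0"
  then show "\<forall>X\<in>tangent_space \<A> x. differential v X = 0"
    unfolding tangent_space_eq[OF c] by (auto simp: differential_def coord_vector_Grad[OF c v])
qed

lemma kernel_at_eq:
  "(U, \<phi>) \<in> \<A> \<Longrightarrow> x \<in> U \<Longrightarrow> kernel_at \<A> V x = {v \<in> V. Grad U \<phi> (\<phi> x) *v \<kappa> v = 0}"
  unfolding kernel_at_def using critical_iff by blast

lemma subspace_kernel_at: "subspace (kernel_at \<A> V x)"
proof -
  obtain U \<phi> where c: "(U, \<phi>) \<in> \<A>" "x \<in> U" using chart_exists by blast
  have "\<kappa> 0 = 0" using \<kappa>_scaleR[OF subspace_0[OF V(1)], of 0] by simp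
  then show ?thesis
    unfolding kernel_at_eq[OF c] using V(1)
    by (intro subspaceI)
       (auto simp: subspace_0 subspace_add subspace_scale \<kappa>_add \<kappa>_scaleR matrix_vector_right_distrib matrix_vector_mult_scaleR)
qed

lemma kernel_at_subset: "kernel_at \<A> V x \<subseteq> V"
  by (auto simp: kernel_at_def)

lemma \<kappa>_kernel_at:
  assumes c: "(U, \<phi>) \<in> \<A>" "x \<in> U"
  shows "\<kappa> ` kernel_at \<A> V x = {w. Grad U \<phi> (\<phi> x) *v w = 0}"
  unfolding kernel_at_eq[OF c] using \<kappa>_surj by (auto simp: image_iff) metis

text \<open>A prescribed gradient \<open>y\<close> is the restriction to tangent vectors of a linear functional on all
functionals: the combination with coefficients \<open>y\<^sub>i\<close> of the evaluations at the coordinate functions.\<close>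

lemma Grad_right_inverse:
  assumes c: "(U, \<phi>) \<in> \<A>" "x \<in> U"
  shows "\<exists>\<xi> :: real^'m^'n. Grad U \<phi> (\<phi> x) ** \<xi> = mat 1"
proof -
  let ?A = "Grad U \<phi> (\<phi> x)"
  have "\<exists>w. ?A *v w = y" for y
  proof -
    let ?l = "\<lambda>X::'a tangent. \<Sum>i\<in>UNIV. y $ i * X (\<lambda>z. \<phi> z $ i)"
    have "linear ?l"
      by (rule linearI) (simp_all add: scaleR_fun_def distrib_left sum.distrib sum_distrib_left mult.left_commute)
    then obtain v where v: "v \<in> V" "\<And>X. X \<in> tangent_space \<A> x \<Longrightarrow> differential v X = ?l X"
      using ample by blast
    have "(?A *v \<kappa> v) \<bullet> w = y \<bullet> w" for w
    proof -
      have "(?A *v \<kappa> v) \<bullet> w = ?l (coord_vector \<A> (U, \<phi>) x w)"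
        using v(2)[OF coord_vector_in_tangent_space[OF c]] coord_vector_Grad[OF c v(1)]
        by (simp add: differential_def)
      then show ?thesis
        by (simp add: coord_vector_coordinate[OF c] inner_vec_def)
    qed
    then have "?A *v \<kappa> v = y"
      using vector_eq_rdot[of "?A *v \<kappa> v" y] by blast
    then show ?thesis by blast
  qed
  then have "\<exists>w. \<forall>j. ?A *v w j = axis j 1"
    by (intro choice allI)
  then obtain w where w: "\<And>j. ?A *v w j = axis j 1" by blast
  have "(?A ** (\<chi> k j. w j $ k)) $ i $ j = (mat 1 :: real^'m^'m) $ i $ j" for i j
    using arg_cong[OF w[of j], of "\<lambda>y. y $ i"]
    by (simp add: matrix_matrix_mult_def matrix_vector_mult_def mat_def axis_def)
  then show ?thesis
    by (intro exI[of _ "\<chi> k j. w j $ k"]) (simp add: vec_eq_iff)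
qed

lemma hessian_matrix:
  assumes c: "(U, \<phi>) \<in> \<A>" "x \<in> U" and v: "v \<in> kernel_at \<A> V x"
  shows "hessian \<A> x v (coord_vector \<A> (U, \<phi>) x a) (coord_vector \<A> (U, \<phi>) x w)
    = w \<bullet> (matrix_derivative (Grad U \<phi>) (\<phi> x) (\<kappa> v) *v a)"
proof -
  interpret F: matrix_family "\<phi> ` U" "Grad U \<phi>" by (rule Grad_family[OF c(1)])
  have vV: "v \<in> V" and crit: "\<And>X. X \<in> tangent_space \<A> x \<Longrightarrow> X v = 0"
    using v by (auto simp: kernel_at_def differential_def)
  have vC: "v \<in> C_infinity \<A>" using vV smooth by blast
  have ux: "\<phi> x \<in> \<phi> ` U" using c by simp
  have lin: "linear (F.dA i k (\<phi> x))" for i k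
    by (rule has_derivative_linear[OF F.entry_has_derivative[OF ux]])
  have dA: "F.dA i k (\<phi> x) a = (\<Sum>l\<in>UNIV. F.dA i k (\<phi> x) (axis l 1) * a $ l)" for i k
  proof -
    have "F.dA i k (\<phi> x) a = F.dA i k (\<phi> x) (\<Sum>l\<in>UNIV. a $ l *\<^sub>R axis l 1)"
      by (simp add: basis_expansion[of a, unfolded scalar_mult_eq_scaleR])
    then show ?thesis
      by (simp add: linear_sum[OF lin] linear_cmul[OF lin] mult.commute)
  qed
  have "((\<lambda>u. (Grad U \<phi> u *v \<kappa> v) \<bullet> w) has_derivative
      (\<lambda>a. (\<chi> i. \<Sum>k\<in>UNIV. F.dA i k (\<phi> x) a * \<kappa> v $ k) \<bullet> w)) (at (\<phi> x))"
    by (intro has_derivative_inner_left F.apply_has_derivative ux)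
  then have "((\<lambda>u. frechet_derivative (v \<circ> inv_into U \<phi>) (at u) w) has_derivative
      (\<lambda>a. (\<chi> i. \<Sum>k\<in>UNIV. F.dA i k (\<phi> x) a * \<kappa> v $ k) \<bullet> w)) (at (\<phi> x))"
    by (rule has_derivative_transform_within_open[OF _ chartD(2)[OF c(1)] ux])
       (rule derivative_expansion[OF c(1) _ vV, symmetric])
  note deriv = fun_cong[OF frechet_derivative_at[OF this], of a]
  have "hessian \<A> x v (coord_vector \<A> (U, \<phi>) x a) (coord_vector \<A> (U, \<phi>) x w)
      = frechet_derivative (\<lambda>u. frechet_derivative (v \<circ> inv_into U \<phi>) (at u) w) (at (\<phi> x)) a"
    by (rule hessian_eq[OF vC c]) (rule crit)
  then have "hessian \<A> x v (coord_vector \<A> (U, \<phi>) x a) (coord_vector \<A> (U, \<phi>) x w)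
      = (\<chi> i. \<Sum>k\<in>UNIV. F.dA i k (\<phi> x) a * \<kappa> v $ k) \<bullet> w"
    by (simp only: deriv)
  also have "(\<chi> i. \<Sum>k\<in>UNIV. F.dA i k (\<phi> x) a * \<kappa> v $ k)
      = matrix_derivative (Grad U \<phi>) (\<phi> x) (\<kappa> v) *v a"
  proof -
    have "(\<Sum>k\<in>UNIV. F.dA i k (\<phi> x) a * \<kappa> v $ k)
        = (\<Sum>l\<in>UNIV. (\<Sum>k\<in>UNIV. F.dA i k (\<phi> x) (axis l 1) * \<kappa> v $ k) * a $ l)" for i
    proof -
      have "(\<Sum>k\<in>UNIV. F.dA i k (\<phi> x) a * \<kappa> v $ k)
          = (\<Sum>k\<in>UNIV. \<Sum>l\<in>UNIV. F.dA i k (\<phi> x) (axis l 1) * a $ l * \<kappa> v $ k)"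
        by (subst dA) (simp only: sum_distrib_right)
      also have "\<dots> = (\<Sum>l\<in>UNIV. \<Sum>k\<in>UNIV. F.dA i k (\<phi> x) (axis l 1) * a $ l * \<kappa> v $ k)"
        by (rule sum.swap)
      finally show ?thesis by (simp add: sum_distrib_left sum_distrib_right mult_ac)
    qed
    then show ?thesis
      by (simp add: matrix_derivative_def matrix_vector_mult_def)
  qed
  finally show ?thesis by (simp add: inner_commute)
qed

text \<open>In the frame with matrix \<open>P\<close> the Hessian operator has the matrix \<open>P\<^sup>T M P\<close>, where \<open>M\<close> is the coordinate
Hessian.\<close>

lemma endo_det_hessian:
  assumes c: "(U, \<phi>) \<in> \<A>" "x \<in> U" and v: "v \<in> kernel_at \<A> V x"
    and P: "\<And>j. some_frame \<A> g x j = coord_vector \<A> (U, \<phi>) x (column j P)"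
  shows "endo_det (some_frame \<A> g x) (hessian_operator \<A> g x v)
    = (det P)\<^sup>2 * det (matrix_derivative (Grad U \<phi>) (\<phi> x) (\<kappa> v))"
proof -
  let ?e = "some_frame \<A> g x" and ?T = "tangent_space \<A> x"
  let ?M = "matrix_derivative (Grad U \<phi>) (\<phi> x) (\<kappa> v)"
  note T = subspace_tangent_space[of x] metric_inner[of x]
  have onb: "inj ?e" "orthonormal_basis (g x) ?T (range ?e)"
    using some_frame by (auto simp: orthonormal_frame_def)
  have eT: "?e j \<in> ?T" for j
    unfolding P by (rule coord_vector_in_tangent_space[OF c])
  have ge: "g x (?e i) (?e j) = (if i = j then 1 else 0)" for i j
    using onb by (auto simp: orthonormal_basis_def inj_eq)
  have hess_e: "hessian \<A> x v (coord_vector \<A> (U, \<phi>) x a) (?e i) = column i P \<bullet> (?M *v a)" for a i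
    unfolding P by (rule hessian_matrix[OF c v])
  have op: "hessian_operator \<A> g x v X \<in> ?T \<and>
      (\<forall>Y\<in>?T. g x (hessian_operator \<A> g x v X) Y = hessian \<A> x v X Y)" if X: "X \<in> ?T" for X
  proof -
    obtain a where a: "X = coord_vector \<A> (U, \<phi>) x a"
      using X tangent_space_eq[OF c] by blast
    define Z where "Z = (\<Sum>i\<in>UNIV. hessian \<A> x v X (?e i) *\<^sub>R ?e i)"
    have ZT: "Z \<in> ?T"
      unfolding Z_def by (intro subspace_sum subspace_scale T eT)
    have Z: "g x Z Y = hessian \<A> x v X Y" if Y: "Y \<in> ?T" for Y
    proof -
      have "Y \<in> span (range ?e)" using onb Y by (simp add: orthonormal_basis_def)
      then obtain y where "Y = (\<Sum>e\<in>range ?e. y e *\<^sub>R e)"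
        by (auto simp: span_finite)
      then have Y': "Y = (\<Sum>i\<in>UNIV. y (?e i) *\<^sub>R ?e i)"
        by (simp add: sum.reindex onb(1))
      have Y_coord: "Y = coord_vector \<A> (U, \<phi>) x (\<Sum>i\<in>UNIV. y (?e i) *\<^sub>R column i P)"
        unfolding Y' P
        by (simp add: linear_sum[OF coord_vector_linear[OF c]] linear_cmul[OF coord_vector_linear[OF c]])
      have "g x Z Y = (\<Sum>i\<in>UNIV. y (?e i) * g x Z (?e i))"
        unfolding Y' by (rule inner_product_on_sum_right[OF T eT ZT])
      also have "\<dots> = (\<Sum>i\<in>UNIV. y (?e i) * hessian \<A> x v X (?e i))"
      proof (rule sum.cong[OF refl])
        fix i
        have "g x Z (?e i) = (\<Sum>j\<in>UNIV. hessian \<A> x v X (?e j) * g x (?e j) (?e i))"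
          unfolding Z_def by (rule inner_product_on_sum_left[OF T eT eT])
        also have "\<dots> = hessian \<A> x v X (?e i)"
          by (simp add: ge if_distrib cong: if_cong)
        finally show "y (?e i) * g x Z (?e i) = y (?e i) * hessian \<A> x v X (?e i)" by simp
      qed
      also have "\<dots> = (\<Sum>i\<in>UNIV. y (?e i) * (column i P \<bullet> (?M *v a)))"
        unfolding a by (simp only: hess_e)
      also have "\<dots> = (\<Sum>i\<in>UNIV. y (?e i) *\<^sub>R column i P) \<bullet> (?M *v a)"
        by (simp add: inner_sum_left)
      also have "\<dots> = hessian \<A> x v X Y"
        by (simp only: a Y_coord hessian_matrix[OF c v])
      finally show ?thesis .
    qed
    have "\<exists>!Z. Z \<in> ?T \<and> (\<forall>Y\<in>?T. g x Z Y = hessian \<A> x v X Y)"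
    proof (rule ex1I)
      show "Z \<in> ?T \<and> (\<forall>Y\<in>?T. g x Z Y = hessian \<A> x v X Y)" using ZT Z by blast
      fix Z' assume Z': "Z' \<in> ?T \<and> (\<forall>Y\<in>?T. g x Z' Y = hessian \<A> x v X Y)"
      let ?D = "Z' - Z"
      have DT: "?D \<in> ?T" using Z' ZT T(1) by (blast intro: subspace_diff)
      have "g x Z' ?D = g x (?D + Z) ?D" by simp
      also have "\<dots> = g x ?D ?D + g x Z ?D"
        by (rule inner_product_onD(1)[OF T(2) DT ZT DT])
      finally have "g x ?D ?D = 0" using Z' Z[OF DT] DT by simp
      then have "?D = 0" using inner_product_onD(4)[OF T(2) DT] by force
      then show "Z' = Z" by simp
    qed
    from theI'[OF this] show ?thesis
      unfolding hessian_operator_def .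
  qed
  have "representation (range ?e) (hessian_operator \<A> g x v (?e j)) (?e i) = (transpose P ** ?M ** P) $ i $ j" for i j
  proof -
    have "representation (range ?e) (hessian_operator \<A> g x v (?e j)) (?e i)
        = g x (hessian_operator \<A> g x v (?e j)) (?e i)"
      using op[OF eT] by (intro representation_orthonormal[OF T onb(2)]) auto
    also have "\<dots> = hessian \<A> x v (?e j) (?e i)"
      using op[OF eT] eT by blast
    also have "\<dots> = column i P \<bullet> (?M *v column j P)"
      unfolding P by (rule hessian_matrix[OF c v])
    finally show ?thesis by (simp only: congruence_entry)
  qed
  then have "endo_det ?e (hessian_operator \<A> g x v) = det (\<chi> i j. (transpose P ** ?M ** P) $ i $ j)"
    by (simp only: endo_det_def)
  also have "(\<chi> i j. (transpose P ** ?M ** P) $ i $ j) = transpose P ** ?M ** P"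
    by (simp add: vec_eq_iff)
  finally show ?thesis by (simp add: det_mul power2_eq_square)
qed

text \<open>In orthonormal coordinates of \<open>V\<close> the map \<open>A\<^sub>x\<^sup>\<dagger>\<close> is given by the transpose of the matrix \<open>Grad\<close>.\<close>

lemma adjoint_jacobian_eq:
  assumes c: "(U, \<phi>) \<in> \<A>" "x \<in> U"
    and P: "\<And>j. some_frame \<A> g x j = coord_vector \<A> (U, \<phi>) x (column j P)"
  defines "A \<equiv> Grad U \<phi> (\<phi> x)"
  shows "adjoint_jacobian \<A> g V h x = \<bar>det P\<bar> * sqrt (det (A ** transpose A))"
proof -
  note transpose_matrix_vector [simp del]
  have adj: "adjoint_evaluation V h (coord_vector \<A> (U, \<phi>) x a) \<in> V \<and>
      \<kappa> (adjoint_evaluation V h (coord_vector \<A> (U, \<phi>) x a)) = transpose A *v a" for a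
  proof -
    let ?X = "coord_vector \<A> (U, \<phi>) x a"
    obtain u where u: "u \<in> V" "\<kappa> u = transpose A *v a" using \<kappa>_surj by blast
    have hu: "h u v = differential v ?X" if v: "v \<in> V" for v
    proof -
      have "h u v = (transpose A *v a) \<bullet> \<kappa> v" using h_\<kappa>[OF u(1) v] u(2) by simp
      also have "\<dots> = a \<bullet> (A *v \<kappa> v)" by (rule transpose_inner)
      also have "\<dots> = differential v ?X"
        by (simp add: differential_def coord_vector_Grad[OF c v] A_def inner_commute)
      finally show ?thesis .
    qed
    have "adjoint_evaluation V h ?X = u"
      unfolding adjoint_evaluation_def
    proof (rule the_equality)
      show "u \<in> V \<and> (\<forall>v\<in>V. h u v = differential v ?X)" using u hu by blast
      fix u' assume u': "u' \<in> V \<and> (\<forall>v\<in>V. h u' v = differential v ?X)"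
      then have "h u' (b k) = h u (b k)" for k
        using hu[OF b_in_V, of k] b_in_V[of k] by simp
      then have "\<kappa> u' = \<kappa> u" by (simp add: \<kappa>_def)
      then show "u' = u" using expansion[OF u(1)] expansion[of u'] u' by simp
    qed
    then show ?thesis using u by simp
  qed
  have "h (adjoint_evaluation V h (some_frame \<A> g x i)) (adjoint_evaluation V h (some_frame \<A> g x j))
      = (transpose P ** (A ** transpose A) ** P) $ i $ j" for i j
  proof -
    have "h (adjoint_evaluation V h (some_frame \<A> g x i)) (adjoint_evaluation V h (some_frame \<A> g x j))
        = (transpose A *v column i P) \<bullet> (transpose A *v column j P)"
      unfolding P using adj by (simp add: h_\<kappa>)
    also have "\<dots> = column i P \<bullet> ((A ** transpose A) *v column j P)"
      by (simp add: transpose_inner matrix_vector_mul_assoc)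
    finally show ?thesis by (simp only: congruence_entry)
  qed
  then have "adjoint_jacobian \<A> g V h x = sqrt (det (\<chi> i j. (transpose P ** (A ** transpose A) ** P) $ i $ j))"
    by (simp only: adjoint_jacobian_def)
  also have "(\<chi> i j. (transpose P ** (A ** transpose A) ** P) $ i $ j) = transpose P ** (A ** transpose A) ** P"
    by (simp add: vec_eq_iff)
  also have "det (transpose P ** (A ** transpose A) ** P) = (det P)\<^sup>2 * det (A ** transpose A)"
    by (simp add: det_mul[of "transpose P ** _"] det_mul[of "transpose P"] power2_eq_square)
  finally show ?thesis by (simp add: real_sqrt_mult)
qed

end

lemma fsigma_open_diff_open:
  fixes S :: "'e::euclidean_space set"
  assumes "open S" "open T"
  shows "fsigma (S - T)"
proof -
  obtain K :: "nat \<Rightarrow> 'e set" where K: "\<And>n. compact (K n)" "\<Union>(range K) = S"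
    by (rule open_Union_compact_subsets[OF assms(1)]) blast
  have "range (\<lambda>n. K n - T) \<subseteq> Collect compact"
    using K(1) assms(2) by (auto intro: compact_diff)
  moreover have "S - T = \<Union>(range (\<lambda>n. K n - T))"
    using K(2) by auto
  ultimately show ?thesis
    unfolding fsigma_Union_compact by blast
qed

lemma emeasure_count_space_image:
  assumes "inj_on f S"
  shows "emeasure (count_space UNIV) (f ` S) = emeasure (count_space UNIV) S"
  using assms by (simp add: emeasure_count_space card_image finite_image_iff)

lemma (in isometric_coordinates) emeasure_unit_sphere:
  "emeasure (sphere_area h W) (unit_sphere h W)
    = of_nat (dim W) * (\<integral>\<^sup>+x. indicator (cball 0 1 - {0}) x \<partial>coord_lebesgue image_basis)"
proof -
  have "emeasure (sphere_area h W) (unit_sphere h W) = (\<integral>\<^sup>+w. 1 \<partial>sphere_area h W)"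
    using space_sphere_area by simp
  also have "\<dots> = of_nat (dim W) * (\<integral>\<^sup>+x. 1 * indicator (cball 0 1 - {0}) x \<partial>coord_lebesgue image_basis)"
    by (rule nn_integral_sphere_area) auto
  finally show ?thesis by simp
qed

text \<open>The identity map provides isometric coordinates on Euclidean space itself.\<close>

lemma emeasure_unit_sphere_UNIV:
  "emeasure (sphere_area (\<bullet>) (UNIV :: (real^'n::finite) set)) (sphere 0 1)
    = of_nat CARD('n) * (\<integral>\<^sup>+x. indicator (cball 0 1 - {0}) x \<partial>(lborel :: (real^'n) measure))"
proof -
  have Basis: "orthonormal_basis (\<bullet>) UNIV (Basis :: (real^'n) set)"
    by (auto simp: orthonormal_basis_def inner_Basis)
  interpret isometric_coordinates UNIV "(\<bullet>)" "\<lambda>x::real^'n. x"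
    by standard (use Basis in auto)
  have "unit_sphere (\<bullet>) (UNIV :: (real^'n) set) = sphere 0 1"
    by (auto simp: unit_sphere_def norm_eq_sqrt_inner[symmetric])
  moreover have "(\<integral>\<^sup>+x. indicator (cball 0 1 - {0}) x \<partial>coord_lebesgue image_basis)
      = (\<integral>\<^sup>+x. indicator (cball 0 1 - {0}) x \<partial>(lborel :: (real^'n) measure))"
    using image_basis by (intro coord_lebesgue_UNIV borel_measurable_indicator) auto
  ultimately show ?thesis
    using emeasure_unit_sphere by simp
qed

context ample_function_space
begin

definition kernel_basis :: "'a \<Rightarrow> (real^'n) set" where
  "kernel_basis x = isometric_coordinates.image_basis (kernel_at \<A> V x) h \<kappa>"

lemma kernel_coordinates: "isometric_coordinates (kernel_at \<A> V x) h \<kappa>"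
  by (rule isometric_coordinates_subspace[OF subspace_kernel_at kernel_at_subset])

lemma kernel_basis:
  assumes c: "(U, \<phi>) \<in> \<A>" "x \<in> U"
  shows "orthonormal_basis (\<bullet>) {w. Grad U \<phi> (\<phi> x) *v w = 0} (kernel_basis x)"
  using isometric_coordinates.image_basis[OF kernel_coordinates, of x] \<kappa>_kernel_at[OF c]
  by (simp add: kernel_basis_def)

text \<open>The density that the Kac-Rice formula yields for the family \<open>Grad\<close> and the punctured unit ball.\<close>

definition density_in_chart :: "'a set \<Rightarrow> ('a \<Rightarrow> real^'m) \<Rightarrow> real^'m \<Rightarrow> ennreal" where
  "density_in_chart U \<phi> u = ennreal (1 / sqrt (det (Grad U \<phi> u ** transpose (Grad U \<phi> u)))) *
     (\<integral>\<^sup>+w. indicator (cball 0 1 - {0}) w * ennreal \<bar>det (matrix_derivative (Grad U \<phi>) u w)\<bar>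
       \<partial>coord_lebesgue (kernel_basis (inv_into U \<phi> u)))"

text \<open>The Hessian determinant contributes \<open>(det P)\<^sup>2\<close>, the Jacobian \<open>|det P|\<close> and the volume density
\<open>1 / |det P|\<close>, so the metric cancels.  On the kernel, of dimension \<open>k = n - m\<close>, homogeneity of degree \<open>m\<close>
turns \<open>k\<close> times the integral over directions, which is \<open>\<Delta>\<^sub>x\<close>, into \<open>k + m = n\<close> times the integral over
the ball.\<close>

lemma Delta_over_Jacobian:
  assumes c: "(U, \<phi>) \<in> \<A>" "x \<in> U"
  shows "ennreal (Delta \<A> g V h x / adjoint_jacobian \<A> g V h x) * volume_density U \<phi> (\<phi> x)
    = of_nat CARD('n) * density_in_chart U \<phi> (\<phi> x)"
proof -
  let ?K = "kernel_at \<A> V x" and ?E = "kernel_basis x" and ?A = "Grad U \<phi> (\<phi> x)"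
  let ?M = "matrix_derivative (Grad U \<phi>) (\<phi> x)" and ?m = "CARD('m)" and ?n = "CARD('n)"
  let ?ball = "indicator (cball 0 1 - {0}) :: real^'n \<Rightarrow> ennreal"
  interpret K: isometric_coordinates ?K h \<kappa> by (rule kernel_coordinates)
  have ux: "\<phi> x \<in> \<phi> ` U" using c by simp
  obtain P :: "real^'m^'m" where P: "\<And>j. some_frame \<A> g x j = coord_vector \<A> (U, \<phi>) x (column j P)"
    and PG: "transpose P ** gram U \<phi> x ** P = mat 1"
    by (rule frame_matrix[OF c]) (rule that)
  note detP = frame_matrix_det[OF PG]
  obtain \<xi> :: "real^'m^'n" where \<xi>: "?A ** \<xi> = mat 1" using Grad_right_inverse[OF c] by blast
  have \<rho>1: "(\<integral>\<^sup>+p. indicator (box 0 One) p \<partial>(lborel :: (real^'m) measure)) = 1"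
    by (simp add: emeasure_lborel_box_eq)
  note kernel = nn_integral_transversal_kernel[OF \<xi> kernel_basis[OF c], of "\<lambda>_. 0" "indicator (box 0 One)", OF _ _ \<rho>1]
  have AA: "0 < det (?A ** transpose ?A)"
    by (rule kernel(1)) simp_all
  have card: "card ?E + ?m = ?n"
    by (rule kernel(2)) simp_all
  have E_eq: "?E = K.image_basis" by (simp add: kernel_basis_def)
  have dimK: "dim ?K = card ?E" using K.card_image_basis by (simp add: E_eq)
  have onbE: "orthonormal_basis (\<bullet>) {w. ?A *v w = 0} ?E" by (rule kernel_basis[OF c])
  have finE: "finite ?E" using onbE by (simp add: orthonormal_basis_def)
  define F where "F = (\<lambda>w. (det P)\<^sup>2 * \<bar>det (?M w)\<bar>)"
  have F_cont: "continuous_on UNIV F"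
    unfolding F_def
    by (intro continuous_intros matrix_family.continuous_on_det_derivative_at[OF Grad_family[OF c(1)] ux])
  then have [measurable]: "F \<in> borel_measurable borel" by (rule borel_measurable_continuous_onI)
  have det_meas [measurable]: "(\<lambda>w. det (?M w)) \<in> borel_measurable borel"
    by (rule borel_measurable_continuous_onI[OF matrix_family.continuous_on_det_derivative_at[OF Grad_family[OF c(1)] ux]])
  have F_nonneg: "0 \<le> F w" for w by (simp add: F_def)
  have endo: "\<bar>endo_det (some_frame \<A> g x) (hessian_operator \<A> g x v)\<bar> = F (\<kappa> v)" if "v \<in> unit_sphere h ?K" for v
    using that by (subst endo_det_hessian[OF c _ P]) (auto simp: unit_sphere_def F_def abs_mult)
  define I where "I = (\<integral>\<^sup>+w. ennreal (F (w /\<^sub>R norm w)) * ?ball w \<partial>coord_lebesgue ?E)"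
  define I' where "I' = (\<integral>\<^sup>+w. ?ball w * ennreal \<bar>det (?M w)\<bar> \<partial>coord_lebesgue ?E)"
  define X where "X = (\<integral>\<^sup>+v. ennreal \<bar>endo_det (some_frame \<A> g x) (hessian_operator \<A> g x v)\<bar> \<partial>sphere_area h ?K)"
  have X_I: "X = of_nat (card ?E) * I"
    unfolding X_def I_def E_eq dimK[symmetric, unfolded E_eq]
    by (rule K.nn_integral_sphere_area) (simp_all add: endo)
  \<comment> \<open>\<open>F\<close> is bounded on the unit sphere; so the integral that defines \<open>\<Delta>\<^sub>x\<close> converges.\<close>
  have I_fin: "I < \<infinity>"
  proof -
    have "bounded (F ` sphere 0 1)"
      by (intro compact_imp_bounded compact_continuous_image continuous_on_subset[OF F_cont]) auto
    then obtain C where "\<forall>y\<in>F ` sphere 0 1. norm y \<le> C"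
      by (auto simp: bounded_iff)
    then have C: "F w \<le> C" if "norm w = 1" for w
      using that by (auto dest: bspec[of _ _ w])
    have "I \<le> (\<integral>\<^sup>+w. ennreal C * indicator (cball 0 1) w \<partial>coord_lebesgue ?E)"
      unfolding I_def
    proof (rule nn_integral_mono)
      fix w :: "real^'n"
      show "ennreal (F (w /\<^sub>R norm w)) * ?ball w \<le> ennreal C * indicator (cball 0 1) w"
        using C[of "w /\<^sub>R norm w"] by (auto split: split_indicator intro: ennreal_leI)
    qed
    also have "\<dots> = ennreal C * emeasure (coord_lebesgue ?E) (cball 0 1)"
      by (rule nn_integral_cmult_indicator) simp
    also have "\<dots> < \<infinity>"
      using emeasure_coord_lebesgue_ball_finite[OF onbE] by (simp add: ennreal_mult_less_top)
    finally show ?thesis .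
  qed
  have "of_nat (card ?E + ?m) * (\<integral>\<^sup>+w. ennreal (F w) * ?ball w \<partial>coord_lebesgue ?E) = of_nat (card ?E) * I"
    unfolding I_def
  proof (rule nn_integral_homogeneous_ball[OF finE])
    show "ennreal (F (r *\<^sub>R w)) = ennreal (r ^ ?m) * ennreal (F w)" if "0 < r" for r w
      using that F_nonneg[of w]
      by (simp add: F_def matrix_derivative_scaleR det_scaleR abs_mult ennreal_mult[symmetric] mult_ac)
    show "(\<integral>\<^sup>+w. ennreal (F (w /\<^sub>R norm w)) * ?ball w \<partial>coord_lebesgue ?E) < \<infinity>"
      using I_fin by (simp add: I_def)
  qed auto
  then have X1: "X = of_nat ?n * (\<integral>\<^sup>+w. ennreal (F w) * ?ball w \<partial>coord_lebesgue ?E)"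
    by (simp only: X_I card)
  have "(\<integral>\<^sup>+w. ennreal (F w) * ?ball w \<partial>coord_lebesgue ?E)
      = (\<integral>\<^sup>+w. ennreal ((det P)\<^sup>2) * (?ball w * ennreal \<bar>det (?M w)\<bar>) \<partial>coord_lebesgue ?E)"
    by (intro nn_integral_cong) (simp add: F_def ennreal_mult mult_ac)
  also have "\<dots> = ennreal ((det P)\<^sup>2) * I'"
    unfolding I'_def by (rule nn_integral_cmult) (auto intro!: borel_measurable_times_ennreal borel_measurable_indicator)
  finally have X2: "X = ennreal (real ?n * (det P)\<^sup>2) * I'"
    unfolding X1 by (simp add: ennreal_mult ennreal_of_nat_eq_real_of_nat mult.assoc)
  have X_fin: "X < \<infinity>"
    unfolding X_I using I_fin by (simp add: ennreal_mult_less_top of_nat_less_top)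
  have "I' \<noteq> \<infinity>"
  proof
    assume "I' = \<infinity>"
    then have "X = \<infinity>" unfolding X2 using detP(1) by (simp add: ennreal_mult_top)
    then show False using X_fin by simp
  qed
  then obtain i where i: "I' = ennreal i" "0 \<le> i"
    by (cases I' rule: ennreal_cases) auto
  have X3: "X = ennreal (real ?n * (det P)\<^sup>2 * i)"
    unfolding X2 i(1) using i(2) by (simp add: ennreal_mult)
  have "Delta \<A> g V h x = enn2real X"
    unfolding Delta_def X_def
  proof (rule integral_eq_nn_integral)
    show "(\<lambda>v. \<bar>endo_det (some_frame \<A> g x) (hessian_operator \<A> g x v)\<bar>) \<in> borel_measurable (sphere_area h ?K)"
      by (rule K.measurable_sphere_area[of F]) (simp_all add: endo)
  qed simp
  then have Delta: "Delta \<A> g V h x = real ?n * (det P)\<^sup>2 * i"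
    unfolding X3 using i(2) by simp
  let ?s = "sqrt (det (?A ** transpose ?A))"
  have s: "0 < ?s" using AA by simp
  have J: "adjoint_jacobian \<A> g V h x = \<bar>det P\<bar> * ?s"
    by (rule adjoint_jacobian_eq[OF c P])
  have dens: "volume_density U \<phi> (\<phi> x) = ennreal (1 / \<bar>det P\<bar>)"
    using ux chart_inverse(1)[OF c] detP(3) by (simp add: volume_density_def)
  have "real ?n * (det P)\<^sup>2 * i / (\<bar>det P\<bar> * ?s) * (1 / \<bar>det P\<bar>) = real ?n * (1 / ?s * i)"
    using detP(1) s by (simp add: power2_eq_square abs_mult[symmetric] field_simps)
  then have "ennreal (Delta \<A> g V h x / adjoint_jacobian \<A> g V h x) * volume_density U \<phi> (\<phi> x)
      = ennreal (real ?n * (1 / ?s * i))"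
    unfolding Delta J dens using i(2) s by (subst ennreal_mult[symmetric]) simp_all
  also have "\<dots> = of_nat ?n * (ennreal (1 / ?s) * I')"
    unfolding i(1) ennreal_of_nat_eq_real_of_nat using i(2) s by (simp only: ennreal_mult[symmetric] of_nat_0_le_iff mult_nonneg_nonneg less_imp_le zero_le_divide_1_iff)
  also have "ennreal (1 / ?s) * I' = density_in_chart U \<phi> (\<phi> x)"
    using chart_inverse(1)[OF c] by (simp add: density_in_chart_def I'_def)
  finally show ?thesis .
qed

text \<open>Around each point of \<open>M\<close> a right inverse \<open>\<xi>\<close> of \<open>Grad\<close> at that point keeps \<open>Grad ** \<xi>\<close> invertible on an
open set; finitely many of these sets cover \<open>M\<close>.  The pieces of the resulting partition are differences
of open sets, hence \<open>\<sigma>\<close>-compact in their charts, which the count of zeros requires.\<close>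

lemma nondegenerate_partition:
  assumes compact: "compact (UNIV :: 'a set)"
  obtains r U \<phi> D G \<xi> where "chart_partition r U \<phi> D"
    "\<And>i. i < r \<Longrightarrow> open (G i) \<and> G i \<subseteq> \<phi> i ` U i \<and> \<phi> i ` D i \<subseteq> G i \<and> fsigma (\<phi> i ` D i)"
    "\<And>i u. i < r \<Longrightarrow> u \<in> G i \<Longrightarrow> det (Grad (U i) (\<phi> i) u ** (\<xi> i :: real^'m^'n)) \<noteq> 0"
proof -
  have "\<exists>U \<phi> \<xi>. (U, \<phi>) \<in> \<A> \<and> x \<in> U \<and> Grad U \<phi> (\<phi> x) ** (\<xi> :: real^'m^'n) = mat 1" for x
    using chart_exists[of x] Grad_right_inverse by blast
  then obtain U \<phi> \<xi> where c: "\<And>x. (U x, \<phi> x) \<in> \<A>" "\<And>x. x \<in> U x"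
    and \<xi>: "\<And>x. Grad (U x) (\<phi> x) (\<phi> x x) ** (\<xi> x :: real^'m^'n) = mat 1"
    by metis
  define G where "G = (\<lambda>x. {u \<in> \<phi> x ` U x. det (Grad (U x) (\<phi> x) u ** \<xi> x) \<noteq> 0})"
  have open_G: "open (G x)" for x
  proof -
    interpret F: matrix_family "\<phi> x ` U x" "Grad (U x) (\<phi> x)" by (rule Grad_family[OF c(1)])
    have "continuous_on (\<phi> x ` U x) (\<lambda>u. det (Grad (U x) (\<phi> x) u ** \<xi> x))"
      unfolding det_def matrix_matrix_mult_def vec_lambda_beta
      by (intro continuous_intros F.continuous_on_entry)
    from continuous_open_preimage[OF this chartD(2)[OF c(1)], of "- {0}"]
    have "open (\<phi> x ` U x \<inter> (\<lambda>u. det (Grad (U x) (\<phi> x) u ** \<xi> x)) -` (- {0}))"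
      by (simp add: open_Compl)
    moreover have "\<phi> x ` U x \<inter> (\<lambda>u. det (Grad (U x) (\<phi> x) u ** \<xi> x)) -` (- {0}) = G x"
      by (auto simp: G_def)
    ultimately show ?thesis by simp
  qed
  define W where "W = (\<lambda>x. {y \<in> U x. \<phi> x y \<in> G x})"
  have open_W: "open (W x)" for x
    unfolding W_def by (rule open_chart_vimage[OF c(1) open_G])
  have W_image: "\<phi> x ` W x = G x" for x
    by (auto simp: W_def G_def)
  have "x \<in> W x" for x
    using c(2) \<xi> by (simp add: W_def G_def)
  then have cover: "UNIV \<subseteq> (\<Union>x\<in>UNIV. W x)" by blast
  obtain C where "C \<subseteq> UNIV" and C: "finite C" "UNIV \<subseteq> (\<Union>x\<in>C. W x)"
    by (rule compactE_image[OF compact open_W cover])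
  obtain xs :: "nat \<Rightarrow> 'a" where xs: "bij_betw xs {0..<card C} C"
    using ex_bij_betw_nat_finite[OF C(1)] by blast
  define D where "D = disjointed (\<lambda>i. W (xs i))"
  have D_eq: "D i = W (xs i) - (\<Union>j\<in>{0..<i}. W (xs j))" for i
    by (simp add: D_def disjointed_def)
  have D_W: "D i \<subseteq> W (xs i)" for i by (auto simp: D_eq)
  have W_U: "W x \<subseteq> U x" for x by (auto simp: W_def)
  have partition: "chart_partition (card C) (\<lambda>i. U (xs i)) (\<lambda>i. \<phi> (xs i)) D"
    unfolding chart_partition_def
  proof (intro conjI allI impI)
    show "(U (xs i), \<phi> (xs i)) \<in> \<A>" for i by (rule c(1))
    show "D i \<in> sets borel" for i
      unfolding D_eq using open_W by (intro sets.Diff borel_open open_UN) auto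
    show "D i \<subseteq> U (xs i)" for i using D_W W_U by blast
    show "disjoint_family_on D {..<card C}"
      using disjoint_family_disjointed[of "\<lambda>i. W (xs i)"] unfolding D_def disjoint_family_on_def by blast
    have "(\<Union>i<card C. D i) = (\<Union>i\<in>{0..<card C}. W (xs i))"
      using finite_UN_disjointed_eq[of "\<lambda>i. W (xs i)" "card C"] by (simp add: D_def lessThan_atLeast0)
    also have "\<dots> = (\<Union>x\<in>C. W x)"
      using bij_betw_imp_surj_on[OF xs] by (metis image_image)
    also have "\<dots> = UNIV"
      by (rule top.extremum_uniqueI[OF C(2)])
    finally show "(\<Union>i<card C. D i) = UNIV" .
  qed
  have fs: "fsigma (\<phi> (xs i) ` D i)" for i
  proof -
    let ?O = "\<Union>j\<in>{0..<i}. W (xs j)"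
    have "\<phi> (xs i) ` D i = G (xs i) - \<phi> (xs i) ` (U (xs i) \<inter> ?O)"
    proof -
      have "inj_on (\<phi> (xs i)) (U (xs i))" by (rule chart_continuous(3)[OF c(1)])
      then have "\<phi> (xs i) ` (W (xs i) - (U (xs i) \<inter> ?O)) = \<phi> (xs i) ` W (xs i) - \<phi> (xs i) ` (U (xs i) \<inter> ?O)"
        by (rule inj_on_image_set_diff) (use W_U in auto)
      moreover have "W (xs i) - (U (xs i) \<inter> ?O) = D i" using W_U by (auto simp: D_eq)
      ultimately show ?thesis by (simp add: W_image)
    qed
    moreover have "open ?O" using open_W by (intro open_UN) auto
    ultimately show ?thesis
      using fsigma_open_diff_open[OF open_G open_chart_image[OF c(1)]] by simp
  qed
  show ?thesis
  proof (rule that[OF partition, of "\<lambda>i. G (xs i)" "\<lambda>i. \<xi> (xs i)"])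
    fix i
    have "\<phi> (xs i) ` D i \<subseteq> G (xs i)"
      using D_W[of i] W_image[of "xs i"] by blast
    then show "open (G (xs i)) \<and> G (xs i) \<subseteq> \<phi> (xs i) ` U (xs i) \<and> \<phi> (xs i) ` D i \<subseteq> G (xs i) \<and> fsigma (\<phi> (xs i) ` D i)"
      using open_G fs by (auto simp: G_def)
    show "det (Grad (U (xs i)) (\<phi> (xs i)) u ** \<xi> (xs i)) \<noteq> 0" if "u \<in> G (xs i)" for u
      using that by (simp add: G_def)
  qed
qed

text \<open>Both sides are \<open>n\<close> times the sum over the pieces of the partition of the integral of the Kac-Rice
density.  On the left this is the Kac-Rice formula for the punctured unit ball, on the right
\<open>Delta_over_Jacobian\<close>.\<close>

theorem sphere_integral_critical_points:
  assumes compact: "compact (UNIV :: 'a set)"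
  shows "(\<integral>\<^sup>+v. emeasure (count_space UNIV) (critical_points \<A> v) \<partial>sphere_area h V)
    = (\<integral>\<^sup>+x. ennreal (Delta \<A> g V h x / adjoint_jacobian \<A> g V h x) \<partial>volume_measure \<A> g)"
proof -
  obtain r U \<phi> D G \<xi> where partition: "chart_partition r U \<phi> D"
    and G: "\<And>i. i < r \<Longrightarrow> open (G i) \<and> G i \<subseteq> \<phi> i ` U i \<and> \<phi> i ` D i \<subseteq> G i \<and> fsigma (\<phi> i ` D i)"
    and \<xi>: "\<And>i u. i < r \<Longrightarrow> u \<in> G i \<Longrightarrow> det (Grad (U i) (\<phi> i) u ** (\<xi> i :: real^'m^'n)) \<noteq> 0"
    using nondegenerate_partition[OF compact] by metis
  have c: "(U i, \<phi> i) \<in> \<A>" and D: "D i \<in> sets borel" "D i \<subseteq> U i" if "i < r" for i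
    using partition that unfolding chart_partition_def by auto
  let ?ball = "indicator (cball 0 1 - {0}) :: real^'n \<Rightarrow> ennreal"
  let ?R = "\<lambda>i. density_in_chart (U i) (\<phi> i)"
  define N where "N = (\<lambda>i w. emeasure (count_space UNIV) {u \<in> \<phi> i ` D i. Grad (U i) (\<phi> i) u *v w = 0})"
  have fam: "matrix_family (G i) (Grad (U i) (\<phi> i))" if "i < r" for i
    using G[OF that] by (intro matrix_family.matrix_family_subset[OF Grad_family[OF c[OF that]]]) auto
  have N_meas: "N i \<in> borel_measurable borel" if "i < r" for i
    unfolding N_def using G[OF that] by (intro matrix_family.borel_measurable_count[OF fam[OF that]]) auto
  have ball_meas: "?ball \<in> borel_measurable borel"
    by (intro borel_measurable_indicator) simp
  have chart: "(\<lambda>u. ?R i u * indicator (\<phi> i ` D i) u) \<in> borel_measurable borel"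
    "(\<integral>\<^sup>+w. ?ball w * N i w \<partial>lborel) = (\<integral>\<^sup>+u. ?R i u * indicator (\<phi> i ` D i) u \<partial>lborel)" if i: "i < r" for i
  proof -
    have E: "orthonormal_basis (\<bullet>) {w. Grad (U i) (\<phi> i) u *v w = 0} (kernel_basis (inv_into (U i) (\<phi> i) u))"
      if "u \<in> G i" for u
    proof -
      have u: "u \<in> \<phi> i ` U i" using G[OF i] that by auto
      show ?thesis
        using kernel_basis[OF c[OF i] chart_inverse(3)[OF c[OF i] u]] chart_inverse(2)[OF c[OF i] u] by simp
    qed
    have B: "fsigma (\<phi> i ` D i)" "\<phi> i ` D i \<subseteq> G i" using G[OF i] by auto
    note KR = kac_rice[OF fam[OF i] \<xi>[OF i] B E ball_meas]
    show "(\<lambda>u. ?R i u * indicator (\<phi> i ` D i) u) \<in> borel_measurable borel"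
      unfolding density_in_chart_def by (rule KR(2))
    show "(\<integral>\<^sup>+w. ?ball w * N i w \<partial>lborel) = (\<integral>\<^sup>+u. ?R i u * indicator (\<phi> i ` D i) u \<partial>lborel)"
      unfolding density_in_chart_def N_def by (rule KR(3))
  qed
  define S where "S = (\<Sum>i<r. \<integral>\<^sup>+u. ?R i u * indicator (\<phi> i ` D i) u \<partial>lborel)"
  interpret W: isometric_coordinates V h \<kappa> by (rule whole_space_coordinates(1))
  note onbW = whole_space_coordinates(2) and dimV = whole_space_coordinates(3)
  define Nt where "Nt = (\<lambda>w. \<Sum>i<r. N i w)"
  have Nt_meas: "Nt \<in> borel_measurable borel"
    unfolding Nt_def by (intro borel_measurable_sum N_meas) auto
  have count: "emeasure (count_space UNIV) (critical_points \<A> v) = Nt (\<kappa> v)" if v: "v \<in> V" for v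
  proof -
    have "emeasure (count_space UNIV) (critical_points \<A> v) = emeasure (count_space UNIV) (\<Union>i<r. critical_points \<A> v \<inter> D i)"
      using partition unfolding chart_partition_def by (metis Int_UN_distrib Int_UNIV_right)
    also have "\<dots> = (\<Sum>i<r. emeasure (count_space UNIV) (critical_points \<A> v \<inter> D i))"
    proof (rule sum_emeasure[symmetric])
      have "disjoint_family_on D {..<r}" using partition by (simp add: chart_partition_def)
      then show "disjoint_family_on (\<lambda>i. critical_points \<A> v \<inter> D i) {..<r}"
        unfolding disjoint_family_on_def by blast
    qed auto
    also have "\<dots> = Nt (\<kappa> v)"
      unfolding Nt_def
    proof (rule sum.cong[OF refl])
      fix i assume "i \<in> {..<r}"
      then have i: "i < r" by simp
      have "x \<in> critical_points \<A> v \<longleftrightarrow> Grad (U i) (\<phi> i) (\<phi> i x) *v \<kappa> v = 0" if "x \<in> D i" for x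
        using critical_iff[OF c[OF i] _ v, of x] D(2)[OF i] that by (auto simp: critical_points_def)
      then have "{u \<in> \<phi> i ` D i. Grad (U i) (\<phi> i) u *v \<kappa> v = 0} = \<phi> i ` (critical_points \<A> v \<inter> D i)"
        by blast
      moreover have "inj_on (\<phi> i) (critical_points \<A> v \<inter> D i)"
        using chart_continuous(3)[OF c[OF i]] D(2)[OF i] by (auto intro: inj_on_subset)
      ultimately show "emeasure (count_space UNIV) (critical_points \<A> v \<inter> D i) = N i (\<kappa> v)"
        by (simp add: N_def emeasure_count_space_image)
    qed
    finally show ?thesis .
  qed
  have Nt_scale: "Nt (w /\<^sub>R norm w) * ?ball w = ?ball w * Nt w" for w
  proof (cases "w = 0")
    case False
    then have "{u \<in> \<phi> i ` D i. Grad (U i) (\<phi> i) u *v (w /\<^sub>R norm w) = 0} = {u \<in> \<phi> i ` D i. Grad (U i) (\<phi> i) u *v w = 0}" for i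
      by (simp add: matrix_vector_mult_scaleR)
    then show ?thesis by (simp add: Nt_def N_def mult.commute)
  qed simp
  have "(\<integral>\<^sup>+v. emeasure (count_space UNIV) (critical_points \<A> v) \<partial>sphere_area h V)
      = of_nat (dim V) * (\<integral>\<^sup>+w. Nt (w /\<^sub>R norm w) * ?ball w \<partial>coord_lebesgue W.image_basis)"
    by (rule W.nn_integral_sphere_area[OF Nt_meas]) (auto simp: unit_sphere_def count)
  also have "\<dots> = of_nat CARD('n) * (\<integral>\<^sup>+w. ?ball w * Nt w \<partial>coord_lebesgue W.image_basis)"
    by (simp only: Nt_scale dimV)
  also have "(\<integral>\<^sup>+w. ?ball w * Nt w \<partial>coord_lebesgue W.image_basis) = (\<integral>\<^sup>+w. ?ball w * Nt w \<partial>lborel)"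
    by (rule coord_lebesgue_UNIV[OF onbW]) (intro borel_measurable_times_ennreal ball_meas Nt_meas)
  also have "\<dots> = (\<integral>\<^sup>+w. (\<Sum>i<r. ?ball w * N i w) \<partial>lborel)"
    by (simp only: Nt_def sum_distrib_left)
  also have "\<dots> = (\<Sum>i<r. \<integral>\<^sup>+w. ?ball w * N i w \<partial>lborel)"
    using N_meas ball_meas by (intro nn_integral_sum borel_measurable_times_ennreal) auto
  also have "\<dots> = S"
    unfolding S_def by (intro sum.cong refl chart(2)) auto
  finally have left: "(\<integral>\<^sup>+v. emeasure (count_space UNIV) (critical_points \<A> v) \<partial>sphere_area h V) = of_nat CARD('n) * S" .

  define f where "f = (\<lambda>x. ennreal (Delta \<A> g V h x / adjoint_jacobian \<A> g V h x))"
  have f_dens: "f x * volume_density (U i) (\<phi> i) (\<phi> i x) = of_nat CARD('n) * ?R i (\<phi> i x)" if "i < r" "x \<in> U i" for i x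
    unfolding f_def by (rule Delta_over_Jacobian[OF c[OF that(1)] that(2)])
  have f_meas: "f \<in> borel_measurable borel"
  proof -
    \<comment> \<open>\<open>Delta_over_Jacobian\<close> solved for the integrand; the measurability of the density is part of the Kac-Rice formula.\<close>
    define k where "k = (\<lambda>i u. of_nat CARD('n) * (?R i u * indicator (\<phi> i ` D i) u) * inverse (volume_density (U i) (\<phi> i) u))"
    have k_meas: "k i \<in> borel_measurable borel" if "i < r" for i
      unfolding k_def
      by (rule borel_measurable_times_ennreal[OF borel_measurable_times_ennreal[OF borel_measurable_const
            chart(1)[OF that]] borel_measurable_inverse_ennreal[OF borel_measurable_volume_density[OF c[OF that]]]])
    have f_k: "f x = k i (\<phi> i x)" if i: "i < r" and x: "x \<in> D i" for i x
    proof -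
      have xU: "x \<in> U i" using D(2)[OF i] x by auto
      obtain d where d: "volume_density (U i) (\<phi> i) (\<phi> i x) = ennreal d" "0 < d"
        using gram_det_pos[OF c[OF i] xU] chart_inverse(1)[OF c[OF i] xU] xU
        by (auto simp: volume_density_def)
      have "k i (\<phi> i x) = f x * (ennreal d * inverse (ennreal d))"
        unfolding k_def using x f_dens[OF i xU] d(1) by (simp add: mult.assoc[symmetric])
      also have "ennreal d * inverse (ennreal d) = 1"
        using d(2) by (simp add: inverse_ennreal ennreal_mult[symmetric])
      finally show ?thesis by simp
    qed
    have "f x = (\<Sum>i<r. k i (if x \<in> U i then \<phi> i x else 0) * indicator (D i) x)" for x
    proof -
      have "(\<Sum>i<r. indicator (D i) x :: ennreal) = indicator (\<Union>i<r. D i) x"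
        using partition unfolding chart_partition_def by (intro indicator_UN_disjoint[symmetric]) auto
      then have "(\<Sum>i<r. indicator (D i) x :: ennreal) = 1"
        using partition unfolding chart_partition_def by simp
      then have "f x = (\<Sum>i<r. f x * indicator (D i) x)"
        by (simp add: sum_distrib_left[symmetric])
      also have "\<dots> = (\<Sum>i<r. k i (if x \<in> U i then \<phi> i x else 0) * indicator (D i) x)"
        using f_k D(2) by (intro sum.cong refl) (auto split: split_indicator)
      finally show ?thesis .
    qed
    then have "f = (\<lambda>x. \<Sum>i<r. k i (if x \<in> U i then \<phi> i x else 0) * indicator (D i) x)"
      by (rule ext)
    also have "\<dots> \<in> borel_measurable borel"
    proof (intro borel_measurable_sum borel_measurable_times_ennreal borel_measurable_indicator)
      fix i assume "i \<in> {..<r}"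
      then have i: "i < r" by simp
      have "(\<lambda>x. if x \<in> U i then \<phi> i x else 0) \<in> borel_measurable borel"
        by (intro borel_measurable_if_continuous_on borel_open chartD(1)[OF c[OF i]] chart_continuous(1)[OF c[OF i]])
      then show "(\<lambda>x. k i (if x \<in> U i then \<phi> i x else 0)) \<in> borel_measurable borel"
        by (rule measurable_compose[OF _ k_meas[OF i]])
      show "D i \<in> sets borel" by (rule D(1)[OF i])
    qed
    finally show ?thesis .
  qed
  have "(\<integral>\<^sup>+x. f x \<partial>volume_measure \<A> g)
    = (\<Sum>i<r. \<integral>\<^sup>+u. f (param (U i) (\<phi> i) u) * volume_density (U i) (\<phi> i) u * indicator (\<phi> i ` D i) u \<partial>lborel)"
    by (rule nn_integral_volume[OF partition f_meas])
  also have "\<dots> = (\<Sum>i<r. of_nat CARD('n) * (\<integral>\<^sup>+u. ?R i u * indicator (\<phi> i ` D i) u \<partial>lborel))"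
  proof (rule sum.cong[OF refl])
    fix i assume "i \<in> {..<r}"
    then have i: "i < r" by simp
    have "(\<integral>\<^sup>+u. f (param (U i) (\<phi> i) u) * volume_density (U i) (\<phi> i) u * indicator (\<phi> i ` D i) u \<partial>lborel)
        = (\<integral>\<^sup>+u. of_nat CARD('n) * (?R i u * indicator (\<phi> i ` D i) u) \<partial>lborel)"
    proof (rule nn_integral_cong)
      fix u
      show "f (param (U i) (\<phi> i) u) * volume_density (U i) (\<phi> i) u * indicator (\<phi> i ` D i) u
          = of_nat CARD('n) * (?R i u * indicator (\<phi> i ` D i) u)"
      proof (cases "u \<in> \<phi> i ` D i")
        case True
        then obtain x where x: "x \<in> D i" "u = \<phi> i x" by blast
        then have xU: "x \<in> U i" using D(2)[OF i] by auto
        then have "param (U i) (\<phi> i) u = x"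
          using x chart_inverse(1)[OF c[OF i] xU] by (simp add: param_def)
        then show ?thesis
          using f_dens[OF i xU] True x by (simp add: mult.assoc[symmetric])
      qed simp
    qed
    also have "\<dots> = of_nat CARD('n) * (\<integral>\<^sup>+u. ?R i u * indicator (\<phi> i ` D i) u \<partial>lborel)"
      using chart(1)[OF i] by (intro nn_integral_cmult) simp
    finally show "(\<integral>\<^sup>+u. f (param (U i) (\<phi> i) u) * volume_density (U i) (\<phi> i) u * indicator (\<phi> i ` D i) u \<partial>lborel)
        = of_nat CARD('n) * (\<integral>\<^sup>+u. ?R i u * indicator (\<phi> i ` D i) u \<partial>lborel)" .
  qed
  also have "\<dots> = of_nat CARD('n) * S"
    by (simp only: S_def sum_distrib_left)
  finally show ?thesis
    by (simp only: left f_def)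
qed

lemma emeasure_unit_sphere_V:
  "emeasure (sphere_area h V) (unit_sphere h V) = emeasure (sphere_area (\<bullet>) (UNIV :: (real^'n) set)) (sphere 0 1)"
proof -
  interpret W: isometric_coordinates V h \<kappa> by (rule whole_space_coordinates(1))
  show ?thesis
    unfolding W.emeasure_unit_sphere emeasure_unit_sphere_UNIV whole_space_coordinates(3)
    by (subst coord_lebesgue_UNIV[OF whole_space_coordinates(2)]) (simp_all add: borel_measurable_indicator)
qed

end

theorem corollary1p3:
  fixes \<A> :: "('a::t2_space, 'm::finite) chart set"
    and g :: "'a \<Rightarrow> 'a tangent \<Rightarrow> 'a tangent \<Rightarrow> real"
    and V :: "('a \<Rightarrow> real) set"
    and h :: "('a \<Rightarrow> real) \<Rightarrow> ('a \<Rightarrow> real) \<Rightarrow> real"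
  assumes "smooth_atlas \<A>"
    and "compact (UNIV :: 'a set)"
    and "connected (UNIV :: 'a set)"
    and "riemannian_metric \<A> g"
    and "V \<subseteq> C_infinity \<A>"
    and "subspace V"
    and "dim V = CARD('n::finite)"
    and "inner_product_on V h"
    and "\<And>x l. linear l \<Longrightarrow> \<exists>v\<in>V. \<forall>X\<in>tangent_space \<A> x. differential v X = l X"
  shows "1 / emeasure (sphere_area h V) (unit_sphere h V)
           * (\<integral>\<^sup>+v. emeasure (count_space UNIV) (critical_points \<A> v) \<partial>sphere_area h V)
         = 1 / emeasure (sphere_area (\<bullet>) (UNIV :: (real ^ 'n) set)) (sphere 0 1)
           * (\<integral>\<^sup>+x. ennreal (Delta \<A> g V h x / adjoint_jacobian \<A> g V h x) \<partial>volume_measure \<A> g)"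
proof -
  obtain b :: "'n \<Rightarrow> 'a \<Rightarrow> real" where b: "orthonormal_coordinates V h b"
    using orthonormal_coordinates_exist[OF assms(6,8,7)] by blast
  have "riemannian_manifold \<A> g"
    using assms(1,4) by (simp add: riemannian_manifold_def smooth_manifold_def riemannian_manifold_axioms_def)
  then interpret ample_function_space \<A> g V h b
    using b assms(5,9) by (intro ample_function_space.intro ample_function_space_axioms.intro)
  show ?thesis
    by (simp only: sphere_integral_critical_points[OF assms(2)] emeasure_unit_sphere_V)
qed

end
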